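(* Let $1\le p<\frac{n}{n-1}$ and suppose that assumption (A1$_p$) (stated in the context) is satisfied. Let $\phi:\mathbb{R}\to\mathbb{R}$ be continuous with $\operatorname{supp}\phi\subset(-K,K)$ for some $K>0$ and $\int_{\mathbb{R}}\phi(s)\,ds=1$, and for $\varepsilon>0$ put $$\delta^\varepsilon(x)=\frac1{\varepsilon^n}\prod_{i=1}^n\phi\left(\frac{x_i}{\varepsilon}\right)\qquad(x=(x_1,\dots,x_n)\in\mathbb{R}^n).$$ Let $F\in L^p(\Theta)^n$, and let $(u,\pi)$ and $(u^\varepsilon,\pi^\varepsilon)$ in $W^{1,p}_0(\Omega)^n\times L^p_0(\Omega)$ be the weak solutions of the Stokes problem with right-hand side $f$ and $f^\varepsilon$, respectively. Then $$\|u-u^\varepsilon\|_{W^{1,p}}+\|\pi-\pi^\varepsilon\|_{L^p}\le C\|F\|_{L^p(\Theta)}\,\varepsilon^{1-n+\frac np},$$ where $C>0$ is a constant depending only on $n$, $p$, $\|J_X\|_{L^\infty(\Theta)}$, $K$, $\|\phi\|_{L^\infty(\mathbb{R})}$ and $\Omega$ (the geometric data $\Omega,\Theta,X$ being fixed).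
   Context: Geometry (fixed throughout). $\Omega\subset\mathbb{R}^n$, $n\in\{2,3\}$, is a (bounded) polyhedral domain with boundary $\partial\Omega$. It is divided into two disjoint components $\Omega_0,\Omega_1$ by a simple closed curve ($n=2$) or closed surface ($n=3$) $\Gamma$ (the immersed boundary), parametrized as $\Gamma=\{X(\theta)=(X_1(\theta),\dots,X_n(\theta)) : \theta\in\Theta\}$, where $\Theta\subset\mathbb{R}^{n-1}$ is bounded. Define $J_X=\sqrt{|\partial X_1/\partial\theta|^2+|\partial X_2/\partial\theta|^2}$ if $n=2$, and $J_X=\sqrt{\left|\frac{\partial(X_2,X_3)}{\partial(\theta_1,\theta_2)}\right|^2+\left|\frac{\partial(X_3,X_1)}{\partial(\theta_1,\theta_2)}\right|^2+\left|\frac{\partial(X_1,X_2)}{\partial(\theta_1,\theta_2)}\right|^2}$ if $n=3$. Standing assumptions: $\Gamma$ is a $C^1$ boundary and $X$ is a $C^1$ function; $\operatorname{dist}(\Gamma,\partial\Omega)>0$; $J_X(\theta)\ne0$ for $\theta\in\Theta$. Notation. $p'$ is the conjugate exponent of $p$. $W^{1,s}_0(\Omega)=\{v\in W^{1,s}(\Omega): v|_{\partial\Omega}=0\}$; $W^{-1,p}(\Omega)^n$ is the topological dual of $W^{1,p'}_0(\Omega)^n$; $L^s_0(\Omega)=\{q\in L^s(\Omega):\int_\Omega q\,dx=0\}$. Forces. $f\in W^{-1,p}(\Omega)^n$ is the functional $\langle f,\varphi\rangle=\int_\Theta F(\theta)\cdot\varphi(X(\theta))\,d\theta$, $\varphi\in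 W^{1,p'}_0(\Omega)^n$ (note $p'>n$, so $\varphi$ is continuous). $f^\varepsilon(x)=\int_\Theta F(\theta)\,\delta^\varepsilon(x-X(\theta))\,d\theta$, identified with the functional $\varphi\mapsto\int_\Omega f^\varepsilon\cdot\varphi\,dx$. Stokes problem. Fix $\nu>0$. For $g\in W^{-1,p}(\Omega)^n$, a weak solution of $-\nu\Delta w+\nabla r=g$, $\nabla\cdot w=0$ in $\Omega$, $w=0$ on $\partial\Omega$, is a pair $(w,r)\in W^{1,p}_0(\Omega)^n\times L^p_0(\Omega)$ with $a(w,v)+b(r,v)=\langle g,v\rangle$ for all $v\in W^{1,p'}_0(\Omega)^n$ and $b(q,w)=0$ for all $q\in L^{p'}_0(\Omega)$, where $a(u,v)=\frac{\nu}{2}\int_\Omega\sum_{i,j}\left(\frac{\partial u_j}{\partial x_i}+\frac{\partial u_i}{\partial x_j}\right)\left(\frac{\partial v_j}{\partial x_i}+\frac{\partial v_i}{\partial x_j}\right)dx$ and $b(\pi,u)=-\int_\Omega\pi(\nabla\cdot u)\,dx$. Assumption (A1$_p$): for every $g\in W^{-1,p}(\Omega)^n$ there is a unique weak solution $(w,r)\in W^{1,p}_0(\Omega)^n\times L^p_0(\Omega)$ of the Stokes problem with right-hand side $g$, and $\|w\|_{W^{1,p}}+\|r\|_{L^p}\le C_1\|g\|_{W^{-1,p}}$; moreover, if $g\in W^{-1,2}(\Omega)^n\cap L^p(\Omega)^n$, then $(w,r)\in W^{2,p}(\Omega)^n\times W^{1,p}(\Omega)$ and $\|w\|_{W^{2,p}}+\|r\|_{W^{1,p}}\le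 C_2\|g\|_{L^p}$. Here $C_1,C_2>0$ depend only on $p$ and $\Omega$. *)

theory Defs
  imports "HOL-Analysis.Analysis"
begin

text \<open>Elements of Lebesgue and Sobolev spaces are functions, not classes; equality of elements is
  equality almost everywhere. Only exponents in \<open>[1, \<infinity>]\<close> are meaningful.\<close>

definition Lp_space :: "ereal \<Rightarrow> 'a measure \<Rightarrow> ('a \<Rightarrow> 'b::euclidean_space) set" where
  "Lp_space s M = {f \<in> borel_measurable M.
     if s = \<infinity> then (\<exists>C. AE x in M. norm (f x) \<le> C)
     else integrable M (\<lambda>x. norm (f x) powr real_of_ereal s)}"

definition Lp_norm :: "ereal \<Rightarrow> 'a measure \<Rightarrow> ('a \<Rightarrow> 'b::euclidean_space) \<Rightarrow> real" where
  "Lp_norm s M f =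
     (if s = \<infinity> then Inf {C. 0 \<le> C \<and> (AE x in M. norm (f x) \<le> C)}
      else (\<integral>x. norm (f x) powr real_of_ereal s \<partial>M) powr (1 / real_of_ereal s))"

definition Lp0_space :: "ereal \<Rightarrow> (real^'n) set \<Rightarrow> (real^'n \<Rightarrow> real) set" where
  "Lp0_space s \<Omega> = {q \<in> Lp_space s (lebesgue_on \<Omega>). (\<integral>x. q x \<partial>lebesgue_on \<Omega>) = 0}"

definition conj_exponent :: "real \<Rightarrow> ereal" where
  "conj_exponent p = (if p = 1 then \<infinity> else ereal (p / (p - 1)))"

text \<open>\<open>D \<alpha>\<close> is the iterated partial derivative of \<open>f\<close> along the list of indices \<open>\<alpha>\<close>.\<close>

definition smooth_fun :: "(real^'n \<Rightarrow> 'b::euclidean_space) \<Rightarrow> bool" where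
  "smooth_fun f \<longleftrightarrow> (\<exists>D. D [] = f \<and>
     (\<forall>\<alpha> x. (D \<alpha> has_derivative (\<lambda>h. \<Sum>i\<in>UNIV. (h $ i) *\<^sub>R D (i # \<alpha>) x)) (at x)))"

definition test_funs :: "(real^'n) set \<Rightarrow> (real^'n \<Rightarrow> 'b::euclidean_space) set" where
  "test_funs \<Omega> = {\<psi>. smooth_fun \<psi> \<and> compact (closure {x. \<psi> x \<noteq> 0}) \<and> closure {x. \<psi> x \<noteq> 0} \<subseteq> \<Omega>}"

definition locally_integrable :: "(real^'n) set \<Rightarrow> (real^'n \<Rightarrow> 'b::euclidean_space) \<Rightarrow> bool" where
  "locally_integrable \<Omega> v \<longleftrightarrow> (\<forall>S. compact S \<and> S \<subseteq> \<Omega> \<longrightarrow> integrable (lebesgue_on S) v)"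

definition has_weak_partial ::
    "(real^'n) set \<Rightarrow> 'n \<Rightarrow> (real^'n \<Rightarrow> 'b::euclidean_space) \<Rightarrow> (real^'n \<Rightarrow> 'b) \<Rightarrow> bool" where
  "has_weak_partial \<Omega> i v d \<longleftrightarrow> locally_integrable \<Omega> v \<and> locally_integrable \<Omega> d \<and>
     (\<forall>\<psi> :: real^'n \<Rightarrow> real. \<psi> \<in> test_funs \<Omega> \<longrightarrow>
        (\<integral>x. frechet_derivative \<psi> (at x) (axis i 1) *\<^sub>R v x \<partial>lebesgue_on \<Omega>)
          = - (\<integral>x. \<psi> x *\<^sub>R d x \<partial>lebesgue_on \<Omega>))"

definition weak_partial ::
    "(real^'n) set \<Rightarrow> 'n \<Rightarrow> (real^'n \<Rightarrow> 'b::euclidean_space) \<Rightarrow> real^'n \<Rightarrow> 'b" where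
  "weak_partial \<Omega> i v = (SOME d. has_weak_partial \<Omega> i v d)"

primrec sobolev :: "nat \<Rightarrow> ereal \<Rightarrow> (real^'n) set \<Rightarrow> (real^'n \<Rightarrow> 'b::euclidean_space) set" where
  "sobolev 0 s \<Omega> = Lp_space s (lebesgue_on \<Omega>)"
| "sobolev (Suc k) s \<Omega> = {v \<in> Lp_space s (lebesgue_on \<Omega>).
     \<forall>i. \<exists>d. has_weak_partial \<Omega> i v d \<and> d \<in> sobolev k s \<Omega>}"

primrec sobolev_norm ::
    "nat \<Rightarrow> ereal \<Rightarrow> (real^'n) set \<Rightarrow> (real^'n \<Rightarrow> 'b::euclidean_space) \<Rightarrow> real" where
  "sobolev_norm 0 s \<Omega> v = Lp_norm s (lebesgue_on \<Omega>) v"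
| "sobolev_norm (Suc k) s \<Omega> v =
     (if s = \<infinity> then
        max (Lp_norm s (lebesgue_on \<Omega>) v)
            (Max (range (\<lambda>i. sobolev_norm k s \<Omega> (weak_partial \<Omega> i v))))
      else
        (Lp_norm s (lebesgue_on \<Omega>) v powr real_of_ereal s
          + (\<Sum>i\<in>UNIV. sobolev_norm k s \<Omega> (weak_partial \<Omega> i v) powr real_of_ereal s))
        powr (1 / real_of_ereal s))"

definition hausdorff_premeasure :: "nat \<Rightarrow> real \<Rightarrow> 'a::metric_space set \<Rightarrow> ennreal" where
  "hausdorff_premeasure m \<delta> A =
     (INF C \<in> {C :: nat \<Rightarrow> 'a set. A \<subseteq> (\<Union>j. C j) \<and> (\<forall>j. bounded (C j) \<and> diameter (C j) \<le> \<delta>)}.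
        \<Sum>j. ennreal (unit_ball_vol (real m) * (diameter (C j) / 2) ^ m))"

definition hausdorff_measure :: "nat \<Rightarrow> 'a::metric_space measure" where
  "hausdorff_measure m =
     measure_of UNIV (sets borel) (\<lambda>A. SUP \<delta>\<in>{0<..}. hausdorff_premeasure m \<delta> A)"

text \<open>The trace operator is the continuous extension to \<open>W\<^sup>1\<^sup>,\<^sup>1(\<Omega>)\<close> of the restriction map
  \<open>V \<mapsto> V|\<^bsub>\<partial>\<Omega>\<^esub>\<close>, with values in \<open>L\<^sup>1(\<partial>\<Omega>)\<close>. On a bounded domain \<open>W\<^sup>1\<^sup>,\<^sup>s(\<Omega>)\<close> is contained in
  \<open>W\<^sup>1\<^sup>,\<^sup>1(\<Omega>)\<close> for every \<open>s \<in> [1, \<infinity>]\<close>, which also covers \<open>s = \<infinity>\<close>, where smooth functions are not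
  dense.\<close>

definition has_trace ::
    "(real^'n) set \<Rightarrow> (real^'n \<Rightarrow> 'b::euclidean_space) \<Rightarrow> (real^'n \<Rightarrow> 'b) \<Rightarrow> bool" where
  "has_trace \<Omega> v \<tau> \<longleftrightarrow> v \<in> sobolev 1 1 \<Omega> \<and> \<tau> \<in> borel_measurable borel \<and>
     (\<exists>V. (\<forall>k::nat. smooth_fun (V k)) \<and>
        (\<lambda>k. sobolev_norm 1 1 \<Omega> (\<lambda>x. V k x - v x)) \<longlonglongrightarrow> 0 \<and>
        (\<lambda>k. \<integral>\<^sup>+x\<in>frontier \<Omega>. ennreal (norm (V k x - \<tau> x)) \<partial>hausdorff_measure (CARD('n) - 1))
          \<longlonglongrightarrow> 0)"

definition sobolev0 :: "ereal \<Rightarrow> (real^'n) set \<Rightarrow> (real^'n \<Rightarrow> 'b::euclidean_space) set" where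
  "sobolev0 s \<Omega> = {v \<in> sobolev 1 s \<Omega>. has_trace \<Omega> v (\<lambda>x. 0)}"

definition dual_sobolev :: "real \<Rightarrow> (real^'n) set \<Rightarrow> ((real^'n \<Rightarrow> real^'n) \<Rightarrow> real) set" where
  "dual_sobolev p \<Omega> = {g.
     (\<forall>v\<in>sobolev0 (conj_exponent p) \<Omega>. \<forall>w\<in>sobolev0 (conj_exponent p) \<Omega>.
        g (\<lambda>x. v x + w x) = g v + g w) \<and>
     (\<forall>c. \<forall>v\<in>sobolev0 (conj_exponent p) \<Omega>. g (\<lambda>x. c *\<^sub>R v x) = c * g v) \<and>
     (\<exists>C. \<forall>v\<in>sobolev0 (conj_exponent p) \<Omega>. \<bar>g v\<bar> \<le> C * sobolev_norm 1 (conj_exponent p) \<Omega> v)}"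

definition dual_sobolev_norm ::
    "real \<Rightarrow> (real^'n) set \<Rightarrow> ((real^'n \<Rightarrow> real^'n) \<Rightarrow> real) \<Rightarrow> real" where
  "dual_sobolev_norm p \<Omega> g =
     (SUP v \<in> {v \<in> sobolev0 (conj_exponent p) \<Omega>. sobolev_norm 1 (conj_exponent p) \<Omega> v \<le> 1}. \<bar>g v\<bar>)"

definition fun_functional ::
    "(real^'n) set \<Rightarrow> (real^'n \<Rightarrow> real^'n) \<Rightarrow> (real^'n \<Rightarrow> real^'n) \<Rightarrow> real" where
  "fun_functional \<Omega> g v = (\<integral>x. g x \<bullet> v x \<partial>lebesgue_on \<Omega>)"

definition stokes_a ::
    "real \<Rightarrow> (real^'n) set \<Rightarrow> (real^'n \<Rightarrow> real^'n) \<Rightarrow> (real^'n \<Rightarrow> real^'n) \<Rightarrow> real" where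
  "stokes_a \<nu> \<Omega> u v = \<nu> / 2 * (\<integral>x. (\<Sum>i\<in>UNIV. \<Sum>j\<in>UNIV.
       (weak_partial \<Omega> i u x $ j + weak_partial \<Omega> j u x $ i) *
       (weak_partial \<Omega> i v x $ j + weak_partial \<Omega> j v x $ i)) \<partial>lebesgue_on \<Omega>)"

definition stokes_b :: "(real^'n) set \<Rightarrow> (real^'n \<Rightarrow> real) \<Rightarrow> (real^'n \<Rightarrow> real^'n) \<Rightarrow> real" where
  "stokes_b \<Omega> \<pi> u = - (\<integral>x. \<pi> x * (\<Sum>i\<in>UNIV. weak_partial \<Omega> i u x $ i) \<partial>lebesgue_on \<Omega>)"

definition stokes_weak_solution ::
    "real \<Rightarrow> real \<Rightarrow> (real^'n) set \<Rightarrow> ((real^'n \<Rightarrow> real^'n) \<Rightarrow> real) \<Rightarrow>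
     (real^'n \<Rightarrow> real^'n) \<Rightarrow> (real^'n \<Rightarrow> real) \<Rightarrow> bool" where
  "stokes_weak_solution \<nu> p \<Omega> g w r \<longleftrightarrow>
     w \<in> sobolev0 (ereal p) \<Omega> \<and> r \<in> Lp0_space (ereal p) \<Omega> \<and>
     (\<forall>v\<in>sobolev0 (conj_exponent p) \<Omega>. stokes_a \<nu> \<Omega> w v + stokes_b \<Omega> r v = g v) \<and>
     (\<forall>q\<in>Lp0_space (conj_exponent p) \<Omega>. stokes_b \<Omega> q w = 0)"

text \<open>A function \<open>g \<in> L\<^sup>p(\<Omega>)\<^sup>n\<close> belongs to \<open>W\<^sup>-\<^sup>1\<^sup>,\<^sup>2(\<Omega>)\<^sup>n\<close> if, as a
  distribution, it coincides with an element \<open>h\<close> of that space.\<close>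

definition stokes_regularity :: "real \<Rightarrow> real \<Rightarrow> (real^'n) set \<Rightarrow> bool" where
  "stokes_regularity \<nu> p \<Omega> \<longleftrightarrow> (\<exists>C1>0. \<exists>C2>0.
     (\<forall>g\<in>dual_sobolev p \<Omega>.
        (\<exists>w r. stokes_weak_solution \<nu> p \<Omega> g w r) \<and>
        (\<forall>w r w' r'. stokes_weak_solution \<nu> p \<Omega> g w r \<longrightarrow> stokes_weak_solution \<nu> p \<Omega> g w' r' \<longrightarrow>
           (AE x in lebesgue_on \<Omega>. w x = w' x \<and> r x = r' x)) \<and>
        (\<forall>w r. stokes_weak_solution \<nu> p \<Omega> g w r \<longrightarrow>
           sobolev_norm 1 (ereal p) \<Omega> w + Lp_norm (ereal p) (lebesgue_on \<Omega>) r
             \<le> C1 * dual_sobolev_norm p \<Omega> g)) \<and>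
     (\<forall>g\<in>Lp_space (ereal p) (lebesgue_on \<Omega>).
        (\<exists>h\<in>dual_sobolev 2 \<Omega>. \<forall>\<psi>\<in>test_funs \<Omega>. h \<psi> = fun_functional \<Omega> g \<psi>) \<longrightarrow>
        (\<forall>w r. stokes_weak_solution \<nu> p \<Omega> (fun_functional \<Omega> g) w r \<longrightarrow>
           w \<in> sobolev 2 (ereal p) \<Omega> \<and> r \<in> sobolev 1 (ereal p) \<Omega> \<and>
           sobolev_norm 2 (ereal p) \<Omega> w + sobolev_norm 1 (ereal p) \<Omega> r
             \<le> C2 * Lp_norm (ereal p) (lebesgue_on \<Omega>) g)))"

definition polyhedral_domain :: "(real^'n) set \<Rightarrow> bool" where
  "polyhedral_domain \<Omega> \<longleftrightarrow> \<Omega> \<noteq> {} \<and> connected \<Omega> \<and>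
     (\<exists>\<P>. finite \<P> \<and> (\<forall>P\<in>\<P>. polytope P) \<and> \<Omega> = interior (\<Union>\<P>))"

definition C1_on :: "'a::euclidean_space set \<Rightarrow> ('a \<Rightarrow> 'b::euclidean_space) \<Rightarrow> bool" where
  "C1_on U f \<longleftrightarrow> (\<exists>f' :: 'a \<Rightarrow> 'a \<Rightarrow>\<^sub>L 'b.
     (\<forall>x\<in>U. (f has_derivative blinfun_apply (f' x)) (at x)) \<and> continuous_on U f')"

definition simple_closed_curve :: "'a::euclidean_space set \<Rightarrow> bool" where
  "simple_closed_curve S \<longleftrightarrow>
     (\<exists>c. simple_path c \<and> pathfinish c = pathstart c \<and> path_image c = S)"

definition closed_surface :: "'a::euclidean_space set \<Rightarrow> bool" where
  "closed_surface S \<longleftrightarrow> S \<noteq> {} \<and> compact S \<and> connected S \<and>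
     (\<forall>x\<in>S. \<exists>U. openin (top_of_set S) U \<and> x \<in> U \<and> U homeomorphic ball (0 :: real^2) 1)"

text \<open>Near each of its points \<open>S\<close> is the graph of a \<open>C\<^sup>1\<close> function over the hyperplane orthogonal to
  a unit vector \<open>e\<close>, with \<open>A\<close> and \<open>B\<close> lying on the two sides of it.\<close>

definition C1_boundary_between ::
    "'a::euclidean_space set \<Rightarrow> 'a set \<Rightarrow> 'a set \<Rightarrow> bool" where
  "C1_boundary_between S A B \<longleftrightarrow> (\<forall>x\<in>S. \<exists>r>0. \<exists>e \<gamma>. norm e = 1 \<and> C1_on UNIV (\<gamma> :: 'a \<Rightarrow> real) \<and>
     S \<inter> ball x r = {y \<in> ball x r. y \<bullet> e = \<gamma> (y - (y \<bullet> e) *\<^sub>R e)} \<and>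
     A \<inter> ball x r = {y \<in> ball x r. y \<bullet> e > \<gamma> (y - (y \<bullet> e) *\<^sub>R e)} \<and>
     B \<inter> ball x r = {y \<in> ball x r. y \<bullet> e < \<gamma> (y - (y \<bullet> e) *\<^sub>R e)})"

text \<open>The square root of the sum of the squares of all \<open>m \<times> m\<close> minors of the \<open>n \<times> m\<close> Jacobian
  matrix, \<open>m = n - 1\<close>. Every choice of \<open>m\<close> rows is enumerated by \<open>m!\<close> injections \<open>\<sigma>\<close>, which give
  the same minor up to sign.\<close>

definition surface_jacobian :: "(real^'m \<Rightarrow> real^'n) \<Rightarrow> real^'m \<Rightarrow> real" where
  "surface_jacobian X \<theta> =
     sqrt ((\<Sum>\<sigma> \<in> {\<sigma> :: 'm \<Rightarrow> 'n. inj \<sigma>}. (det (\<chi> k l. jacobian X (at \<theta>) $ \<sigma> k $ l))\<^sup>2)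
           / fact CARD('m))"

definition immersed_boundary ::
    "(real^'n) set \<Rightarrow> (real^'n) set \<Rightarrow> (real^'n) set \<Rightarrow> (real^'m) set \<Rightarrow> (real^'m \<Rightarrow> real^'n) \<Rightarrow> bool" where
  "immersed_boundary \<Omega> \<Omega>0 \<Omega>1 \<Theta> X \<longleftrightarrow>
     bounded \<Theta> \<and> \<Theta> \<in> sets lebesgue \<and>
     (\<exists>U. open U \<and> \<Theta> \<subseteq> U \<and> C1_on U X) \<and>
     (\<forall>\<theta>\<in>\<Theta>. surface_jacobian X \<theta> \<noteq> 0) \<and>
     (if CARD('n) = 2 then simple_closed_curve (X ` \<Theta>) else closed_surface (X ` \<Theta>)) \<and>
     X ` \<Theta> \<subseteq> \<Omega> \<and> setdist (X ` \<Theta>) (frontier \<Omega>) > 0 \<and>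
     \<Omega>0 \<noteq> \<Omega>1 \<and> components (\<Omega> - X ` \<Theta>) = {\<Omega>0, \<Omega>1} \<and>
     C1_boundary_between (X ` \<Theta>) \<Omega>0 \<Omega>1"

text \<open>Point values of a Sobolev function are those of its continuous representative, which is
  unique on an open set.\<close>

definition continuous_rep ::
    "(real^'n) set \<Rightarrow> (real^'n \<Rightarrow> 'b::euclidean_space) \<Rightarrow> real^'n \<Rightarrow> 'b" where
  "continuous_rep \<Omega> v = (SOME w. continuous_on \<Omega> w \<and> (AE x in lebesgue_on \<Omega>. w x = v x))"

definition force_functional ::
    "(real^'n) set \<Rightarrow> (real^'m) set \<Rightarrow> (real^'m \<Rightarrow> real^'n) \<Rightarrow> (real^'m \<Rightarrow> real^'n) \<Rightarrow>
     (real^'n \<Rightarrow> real^'n) \<Rightarrow> real" where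
  "force_functional \<Omega> \<Theta> X F v = (\<integral>\<theta>. F \<theta> \<bullet> continuous_rep \<Omega> v (X \<theta>) \<partial>lebesgue_on \<Theta>)"

definition regularized_delta :: "(real \<Rightarrow> real) \<Rightarrow> real \<Rightarrow> real^'n \<Rightarrow> real" where
  "regularized_delta \<phi> \<epsilon> x = 1 / \<epsilon> ^ CARD('n) * (\<Prod>i\<in>UNIV. \<phi> (x $ i / \<epsilon>))"

definition regularized_force ::
    "(real^'m) set \<Rightarrow> (real^'m \<Rightarrow> real^'n) \<Rightarrow> (real^'m \<Rightarrow> real^'n) \<Rightarrow> (real \<Rightarrow> real) \<Rightarrow> real \<Rightarrow>
     real^'n \<Rightarrow> real^'n" where
  "regularized_force \<Theta> X F \<phi> \<epsilon> x =
     (\<integral>\<theta>. regularized_delta \<phi> \<epsilon> (x - X \<theta>) *\<^sub>R F \<theta> \<partial>lebesgue_on \<Theta>)"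

end

theory Submission
  imports Defs
begin

text \<open>Write \<open>n\<close> for the dimension, \<open>q\<close> for the conjugate exponent of \<open>p\<close> and \<open>\<alpha> = 1 - n + n/p = 1 - n/q\<close>,
which is positive exactly because \<open>p < n/(n-1)\<close>. The difference of the two solutions is the weak
solution for \<open>g = f - f\<^sup>\<epsilon>\<close> (\<open>stokes_weak_solution_diff\<close>), so the stability half of the
regularity assumption bounds it by the norm of \<open>g\<close> in the dual of \<open>W\<^sub>0\<^sup>1\<^sup>,\<^sup>q(\<Omega>)\<close>. By Fubini

\<open>g(v) = \<integral>\<^sub>\<Theta> F(\<theta>) \<bullet> (v(X \<theta>) - \<integral>\<^sub>\<Omega> \<delta>\<^sup>\<epsilon>(x - X \<theta>) v(x) dx) d\<theta>\<close>,

and Hoelder's inequality on the bounded set \<open>\<Theta>\<close> controls the \<open>L\<^sup>1\<close> norm of \<open>F\<close>. Everything is thus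
reduced to a pointwise statement: mollifying a function of \<open>W\<^sup>1\<^sup>,\<^sup>q\<close>, \<open>q > n\<close>, at scale \<open>\<epsilon>\<close> changes its
value at a point of the immersed boundary by at most a constant times \<open>\<epsilon> powr \<alpha>\<close>.

This is Morrey's estimate, obtained here directly for the given kernel. For a continuous kernel \<open>k\<close> on a
box \<open>Q\<close> let \<open>A(s) = \<integral>\<^sub>Q k(z) v(x + s z) dz\<close>. Differentiating under the integral sign, substituting
and applying Hoelder's inequality on the dilated box \<open>x + s Q\<close> gives
\<open>|A'(s)| \<le> const * s\<^sup>-\<^sup>n * \<integral> |\<nabla>v| \<le> const * s powr (\<alpha> - 1) * |\<nabla>v|\<^sub>q\<close>, the integrals being over
\<open>x + s Q\<close>. The bound is integrable at \<open>0\<close>, whence \<open>|A(t) - A(r)| \<le> const * (t powr \<alpha> - r powr \<alpha>)\<close>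
(\<open>kernel_avg_increment\<close>). Since \<open>v\<close> is not differentiable, this is carried out for the smooth functions
that the definition of the zero trace provides. They converge to \<open>v\<close> only in \<open>W\<^sup>1\<^sup>,\<^sup>1\<close>, but this is
enough: for fixed \<open>r > 0\<close> their error on \<open>[r, t]\<close> is at most a multiple of \<open>r\<^sup>-\<^sup>n\<close> times an \<open>L\<^sup>1\<close>
norm that tends to \<open>0\<close>.

The estimate is used twice. With the constant kernel on the unit cube it shows that the averages of \<open>v\<close>
converge locally uniformly as the cube shrinks; the limit is the continuous representative, by Lebesgue's
differentiation theorem (\<open>continuous_representative_exists\<close>). With \<open>\<delta>\<^sup>1\<close> as kernel and \<open>r\<close> tending to \<open>0\<close>
it is the mollification error (\<open>kernel_avg_minus_continuous_representative\<close>). The boxes have to stay inside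
\<open>\<Omega>\<close>, which holds for \<open>\<epsilon>\<close> up to some \<open>\<epsilon>\<^sub>0\<close> given by the distance of the immersed boundary from
\<open>\<partial>\<Omega>\<close>. For larger \<open>\<epsilon>\<close> both terms of the error are bounded and \<open>\<epsilon> powr \<alpha>\<close> is bounded below
(\<open>continuous_rep_minus_mollification\<close>).

The weak partial derivatives in the norms and bilinear forms are chosen by Hilbert's operator, so all
linearity statements rest on their uniqueness almost everywhere (\<open>has_weak_partial_unique\<close>).\<close>

section \<open>Smooth bump functions\<close>

text \<open>A family of functions that is closed under differentiation and contains the bumps \<open>interval_bump\<close> below.
Its generators are \<open>P(1/s) exp(-1/s)\<close> for \<open>s > 0\<close>, continued by \<open>0\<close>, at the affine arguments
\<open>s = c t + d\<close>. The polynomial factor is what differentiating \<open>exp(-1/s)\<close> produces.\<close>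

inductive_set exp_bump_algebra :: "(real \<Rightarrow> real) set" where
  base: "(\<lambda>t. if c * t + d > 0 then poly P (1 / (c * t + d)) * exp (- (1 / (c * t + d))) else 0)
     \<in> exp_bump_algebra"
| add: "f \<in> exp_bump_algebra \<Longrightarrow> g \<in> exp_bump_algebra \<Longrightarrow> (\<lambda>t. f t + g t) \<in> exp_bump_algebra"
| mult: "f \<in> exp_bump_algebra \<Longrightarrow> g \<in> exp_bump_algebra \<Longrightarrow> (\<lambda>t. f t * g t) \<in> exp_bump_algebra"

lemma poly_times_exp_neg_tendsto_0:
  "((\<lambda>x::real. poly P x * exp (- x)) \<longlongrightarrow> 0) at_top"
proof -
  have "((\<lambda>x::real. \<Sum>i\<le>degree P. coeff P i * (x ^ i / exp x)) \<longlongrightarrow> (\<Sum>i\<le>degree P. coeff P i * 0)) at_top"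
    by (intro tendsto_intros tendsto_power_div_exp_0)
  then show ?thesis
    by (simp add: poly_altdef sum_distrib_right exp_minus divide_inverse mult.assoc)
qed

text \<open>Only \<open>s = 0\<close> is not a matter of calculation: there the difference quotient from the right is a
polynomial in \<open>1/s\<close> times \<open>exp(-1/s)\<close>, and the exponential wins.\<close>

lemma exp_bump_has_derivative:
  fixes P :: "real poly"
  defines "e \<equiv> \<lambda>P s. if s > 0 then poly P (1 / s) * exp (- (1 / s)) else (0::real)"
  shows "(e P has_real_derivative e (([:0, 0, 1:] * P) - ([:0, 0, 1:] * pderiv P)) s) (at s)"
proof (cases s "0::real" rule: linorder_cases)
  case greater
  have *: "((\<lambda>s. poly P (1 / s) * exp (- (1 / s))) has_real_derivative
      e (([:0, 0, 1:] * P) - ([:0, 0, 1:] * pderiv P)) s) (at s)"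
    using greater unfolding e_def
    by (auto intro!: derivative_eq_intros DERIV_chain2[OF poly_DERIV]
        simp: field_simps power2_eq_square)
  show ?thesis
    by (rule has_field_derivative_transform_within_open[OF *, of "{0<..}"])
      (use greater in \<open>auto simp: e_def\<close>)
next
  case less
  have *: "((\<lambda>s. 0) has_real_derivative 0) (at s)" by simp
  have "(e P has_real_derivative 0) (at s)"
    by (rule has_field_derivative_transform_within_open[OF *, of "{..<0}"])
      (use less in \<open>auto simp: e_def\<close>)
  then show ?thesis using less by (simp add: e_def)
next
  case equal
  have R: "((\<lambda>h. e P h / h) \<longlongrightarrow> 0) (at_right 0)"
  proof -
    have "((\<lambda>h. poly ([:0, 1:] * P) (inverse h) * exp (- inverse h)) \<longlongrightarrow> 0) (at_right (0::real))"
      by (rule filterlim_compose[OF poly_times_exp_neg_tendsto_0 filterlim_inverse_at_top_right])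
    moreover have "eventually (\<lambda>h. poly ([:0, 1:] * P) (inverse h) * exp (- inverse h) = e P h / h)
        (at_right (0::real))"
      unfolding eventually_at_right_field
      by (auto intro!: exI[of _ 1] simp: e_def divide_inverse)
    ultimately show ?thesis by (rule Lim_transform_eventually)
  qed
  have L: "((\<lambda>h. e P h / h) \<longlongrightarrow> 0) (at_left 0)"
  proof -
    have "eventually (\<lambda>h. 0 = e P h / h) (at_left (0::real))"
      unfolding eventually_at_left_field
      by (auto intro!: exI[of _ "-1"] simp: e_def)
    then show ?thesis by (rule Lim_transform_eventually[OF tendsto_const])
  qed
  have "((\<lambda>h. e P h / h) \<longlongrightarrow> 0) (at 0)"
    using L R filterlim_split_at by blast
  then have "(e P has_real_derivative 0) (at 0)"
    by (simp add: DERIV_def e_def cong: if_cong)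
  then show ?thesis using equal by (simp add: e_def)
qed

lemma exp_bump_algebra_derivative:
  assumes "f \<in> exp_bump_algebra"
  shows "\<exists>f'\<in>exp_bump_algebra. \<forall>t. (f has_real_derivative f' t) (at t)"
  using assms
proof induction
  case (base c d P)
  define Q where "Q = smult c (([:0, 0, 1:] * P) - ([:0, 0, 1:] * pderiv P))"
  show ?case
  proof (intro bexI allI)
    fix t
    have "((\<lambda>t. c * t + d) has_real_derivative c) (at t)"
      by (auto intro!: derivative_eq_intros)
    from DERIV_chain2[OF exp_bump_has_derivative[of P "c * t + d"] this]
    show "((\<lambda>t. if c * t + d > 0 then poly P (1 / (c * t + d)) * exp (- (1 / (c * t + d))) else 0)
        has_real_derivative
        (\<lambda>t. if c * t + d > 0 then poly Q (1 / (c * t + d)) * exp (- (1 / (c * t + d))) else 0) t) (at t)"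
      by (rule DERIV_cong) (simp add: Q_def)
  qed (rule exp_bump_algebra.base)
next
  case (add f g)
  then obtain f' g' where "f' \<in> exp_bump_algebra" "g' \<in> exp_bump_algebra"
    "\<And>t. (f has_real_derivative f' t) (at t)" "\<And>t. (g has_real_derivative g' t) (at t)" by blast
  then show ?case
    by (intro bexI[of _ "\<lambda>t. f' t + g' t"] allI) (auto intro: exp_bump_algebra.add derivative_intros)
next
  case (mult f g)
  then obtain f' g' where "f' \<in> exp_bump_algebra" "g' \<in> exp_bump_algebra"
    "\<And>t. (f has_real_derivative f' t) (at t)" "\<And>t. (g has_real_derivative g' t) (at t)" by blast
  then show ?case using mult
    by (intro bexI[of _ "\<lambda>t. f' t * g t + g' t * f t"] allI)
      (auto intro!: exp_bump_algebra.add exp_bump_algebra.mult DERIV_mult)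
qed

lemma exp_bump_algebra_iterated_derivatives:
  assumes "f \<in> exp_bump_algebra"
  obtains G where "G 0 = f" "\<And>m t. (G m has_real_derivative G (Suc m) t) (at t)"
proof -
  obtain d where d: "\<And>f. f \<in> exp_bump_algebra \<Longrightarrow> d f \<in> exp_bump_algebra"
    "\<And>f t. f \<in> exp_bump_algebra \<Longrightarrow> (f has_real_derivative d f t) (at t)"
    using exp_bump_algebra_derivative by metis
  have "(d ^^ m) f \<in> exp_bump_algebra" for m
    by (induction m) (auto simp: assms d(1))
  then show ?thesis using that[of "\<lambda>m. (d ^^ m) f"] d(2) by simp
qed

text \<open>A product of functions of one coordinate each is smooth: differentiating along a list of indices
differentiates the \<open>i\<close>-th factor as often as \<open>i\<close> occurs in the list.\<close>

lemma smooth_fun_prod: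
  fixes G :: "'n::finite \<Rightarrow> nat \<Rightarrow> real \<Rightarrow> real"
  assumes "\<And>i m t. (G i m has_real_derivative G i (Suc m) t) (at t)"
  shows "smooth_fun (\<lambda>x::real^'n. \<Prod>i\<in>UNIV. G i 0 (x $ i))"
  unfolding smooth_fun_def
proof (intro exI conjI allI)
  let ?D = "\<lambda>\<alpha> (x::real^'n). \<Prod>i\<in>UNIV. G i (count_list \<alpha> i) (x $ i)"
  show "?D [] = (\<lambda>x. \<Prod>i\<in>UNIV. G i 0 (x $ i))" by simp
  fix \<alpha> and x :: "real^'n"
  have *: "((\<lambda>x. G i (count_list \<alpha> i) (x $ i)) has_derivative
      (\<lambda>h. G i (Suc (count_list \<alpha> i)) (x $ i) * (h $ i))) (at x)" for i
    using has_derivative_compose[OF bounded_linear.has_derivative[OF bounded_linear_vec_nth has_derivative_ident, of i]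
      assms[of i "count_list \<alpha> i" "x $ i", unfolded has_field_derivative_def]] by simp
  show "(?D \<alpha> has_derivative (\<lambda>h. \<Sum>i\<in>UNIV. h $ i *\<^sub>R ?D (i # \<alpha>) x)) (at x)"
  proof (rule has_derivative_eq_rhs[OF has_derivative_prod[OF *]], intro ext sum.cong refl)
    fix h :: "real^'n" and i :: 'n
    have "(\<Prod>j\<in>UNIV. G j (count_list (i # \<alpha>) j) (x $ j))
        = G i (Suc (count_list \<alpha> i)) (x $ i) * (\<Prod>j\<in>UNIV - {i}. G j (count_list \<alpha> j) (x $ j))"
      by (subst prod.remove[of _ i]) (auto intro!: prod.cong)
    then show "G i (Suc (count_list \<alpha> i)) (x $ i) * (h $ i) * (\<Prod>j\<in>UNIV - {i}. G j (count_list \<alpha> j) (x $ j))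
        = h $ i *\<^sub>R (\<Prod>j\<in>UNIV. G j (count_list (i # \<alpha>) j) (x $ j))"
      by (simp add: ac_simps)
  qed
qed

text \<open>As \<open>k\<close> grows these smooth functions increase to the indicator function of the interval.\<close>

definition interval_bump :: "nat \<Rightarrow> real \<Rightarrow> real \<Rightarrow> real \<Rightarrow> real" where
  "interval_bump k a b t =
     (if a < t \<and> t < b then exp (- 1 / (real (Suc k) * (t - a))) * exp (- 1 / (real (Suc k) * (b - t))) else 0)"

lemma interval_bump_range: "0 \<le> interval_bump k a b t" "interval_bump k a b t \<le> 1"
  by (auto simp: interval_bump_def mult_le_one)

lemma interval_bump_in_algebra: "interval_bump k a b \<in> exp_bump_algebra"
proof -
  let ?e = "\<lambda>c d (t::real). if c * t + d > 0
     then poly [:1::real:] (1 / (c * t + d)) * exp (- (1 / (c * t + d))) else 0"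
  have "?e (real (Suc k)) (- (real (Suc k) * a)) t * ?e (- real (Suc k)) (real (Suc k) * b) t = interval_bump k a b t" for t
  proof -
    have "real (Suc k) * t + - (real (Suc k) * a) = real (Suc k) * (t - a)"
      "(- real (Suc k)) * t + (real (Suc k) * b) = real (Suc k) * (b - t)"
      by (simp_all add: algebra_simps)
    moreover have "real (Suc k) * (t - a) > 0 \<longleftrightarrow> t > a" "real (Suc k) * (b - t) > 0 \<longleftrightarrow> b > t"
      by (auto simp: zero_less_mult_iff)
    ultimately show ?thesis unfolding interval_bump_def by (simp only: if_True if_False) (simp del: of_nat_Suc)
  qed
  then have "interval_bump k a b = (\<lambda>t. ?e (real (Suc k)) (- (real (Suc k) * a)) t * ?e (- real (Suc k)) (real (Suc k) * b) t)"
    by (intro ext) (rule sym)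
  then show ?thesis
    using exp_bump_algebra.mult[OF
        exp_bump_algebra.base[of "real (Suc k)" "- (real (Suc k) * a)" "[:1:]"]
        exp_bump_algebra.base[of "- real (Suc k)" "real (Suc k) * b" "[:1:]"]]
    by (simp only:)
qed

lemma interval_bump_tendsto:
  assumes "a < t" "t < b"
  shows "(\<lambda>k. interval_bump k a b t) \<longlonglongrightarrow> 1"
proof -
  have 1: "(\<lambda>k. exp (- 1 / (real (Suc k) * r))) \<longlonglongrightarrow> 1" if "r > 0" for r :: real
  proof -
    have "(\<lambda>k. exp (- ((1 / r) * inverse (real (Suc k))))) \<longlonglongrightarrow> exp (- ((1 / r) * 0))"
      by (intro tendsto_intros LIMSEQ_inverse_real_of_nat)
    then show ?thesis by (simp add: divide_inverse mult.commute)
  qed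
  have "(\<lambda>k. exp (- 1 / (real (Suc k) * (t - a))) * exp (- 1 / (real (Suc k) * (b - t)))) \<longlonglongrightarrow> 1 * 1"
    by (intro tendsto_mult 1) (use assms in auto)
  then show ?thesis using assms by (simp add: interval_bump_def)
qed

definition box_bump :: "nat \<Rightarrow> real^'n \<Rightarrow> real^'n \<Rightarrow> real^'n \<Rightarrow> real" where
  "box_bump k a b x = (\<Prod>i\<in>UNIV. interval_bump k (a $ i) (b $ i) (x $ i))"

lemma box_bump_range: "0 \<le> box_bump k a b x" "box_bump k a b x \<le> 1"
  unfolding box_bump_def by (auto intro!: prod_nonneg prod_le_1 interval_bump_range)

lemma box_bump_outside: 
  assumes "x \<notin> box a b" shows "box_bump k a b x = 0"
proof -
  obtain i where "\<not> (a $ i < x $ i \<and> x $ i < b $ i)" using assms by (auto simp: mem_box_cart)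
  then have "interval_bump k (a $ i) (b $ i) (x $ i) = 0" by (auto simp: interval_bump_def)
  then show ?thesis unfolding box_bump_def by (metis UNIV_I finite prod_zero)
qed

lemma box_bump_tendsto: "(\<lambda>k. box_bump k a b x) \<longlonglongrightarrow> indicator (box a b) x"
proof (cases "x \<in> box a b")
  case True
  then have "(\<lambda>k. box_bump k a b x) \<longlonglongrightarrow> (\<Prod>i\<in>(UNIV::'a set). 1)" 
    unfolding box_bump_def by (intro tendsto_prod interval_bump_tendsto) (auto simp: mem_box_cart)
  then show ?thesis using True by simp
qed (simp add: box_bump_outside)

lemma box_bump_smooth: "smooth_fun (box_bump k a b)"
proof -
  have "\<exists>G. \<forall>i. G i 0 = interval_bump k (a $ i) (b $ i) \<and>
     (\<forall>m t. (G i m has_real_derivative G i (Suc m) t) (at t))"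
    by (rule choice) (metis exp_bump_algebra_iterated_derivatives interval_bump_in_algebra)
  then obtain G where G: "\<And>i. G i 0 = interval_bump k (a $ i) (b $ i)"
     "\<And>i m t. (G i m has_real_derivative G i (Suc m) t) (at t)" by blast
  show ?thesis using smooth_fun_prod[of G, OF G(2)] by (simp add: G(1) box_bump_def[abs_def])
qed

lemma box_bump_test_fun:
  assumes "cbox a b \<subseteq> \<Omega>"
  shows "box_bump k a b \<in> test_funs \<Omega>"
proof -
  have "closure {x. box_bump k a b x \<noteq> 0} \<subseteq> cbox a b"
    by (intro closure_minimal) (use box_bump_outside[of _ a b k] box_subset_cbox[of a b] in auto)
  moreover from this have "bounded (closure {x. box_bump k a b x \<noteq> 0})"
    by (rule bounded_subset[OF bounded_cbox])
  ultimately show ?thesis using assms box_bump_smooth unfolding test_funs_def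
    by (auto simp: compact_eq_bounded_closed)
qed

section \<open>Weak partial derivatives\<close>

abbreviation has_partials ::
    "(real^'n \<Rightarrow> 'b::euclidean_space) \<Rightarrow> ('n \<Rightarrow> real^'n \<Rightarrow> 'b) \<Rightarrow> real^'n \<Rightarrow> bool" where
  "has_partials f P x \<equiv> (f has_derivative (\<lambda>h. \<Sum>i\<in>UNIV. (h $ i) *\<^sub>R P i x)) (at x)"

lemma integral_lebesgue_on_subset:
  fixes f :: "'a::euclidean_space \<Rightarrow> 'b::euclidean_space"
  assumes "S \<in> sets lebesgue" "T \<in> sets lebesgue" "S \<subseteq> T" "\<And>x. x \<in> T - S \<Longrightarrow> f x = 0"
  shows "integral\<^sup>L (lebesgue_on T) f = integral\<^sup>L (lebesgue_on S) f"
    and "integrable (lebesgue_on T) f \<longleftrightarrow> integrable (lebesgue_on S) f"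
proof -
  have eq: "(\<lambda>x. indicator T x *\<^sub>R f x) = (\<lambda>x. indicator S x *\<^sub>R f x)"
    using assms(3,4) by (auto simp: indicator_def fun_eq_iff)
  show "integral\<^sup>L (lebesgue_on T) f = integral\<^sup>L (lebesgue_on S) f"
    "integrable (lebesgue_on T) f \<longleftrightarrow> integrable (lebesgue_on S) f"
    using assms(1,2) eq by (simp_all add: integral_restrict_space integrable_restrict_space)
qed

lemma integrable_lebesgue_on_mono:
  fixes f :: "'a::euclidean_space \<Rightarrow> 'b::euclidean_space"
  assumes "integrable (lebesgue_on T) f" "S \<in> sets lebesgue" "T \<in> sets lebesgue" "S \<subseteq> T"
  shows "integrable (lebesgue_on S) f"
  using set_integrable_subset[of lebesgue T f S] assms
  by (simp add: integrable_restrict_space set_integrable_def)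

lemma AE_lebesgue_on_iff:
  assumes "S \<in> sets lebesgue"
  shows "(AE x in lebesgue_on S. P x) \<longleftrightarrow> negligible {x \<in> S. \<not> P x}"
proof -
  have "(AE x in lebesgue_on S. P x) \<longleftrightarrow> (AE x in lebesgue. x \<in> S \<longrightarrow> P x)"
    using assms by (simp add: AE_restrict_space_iff)
  also have "\<dots> \<longleftrightarrow> {x. \<not> (x \<in> S \<longrightarrow> P x)} \<in> null_sets lebesgue"
    using completion.AE_iff_null_sets[where M = lborel and P = "\<lambda>x. x \<in> S \<longrightarrow> P x"]
    by (simp only: space_completion space_lborel) simp
  also have "{x. \<not> (x \<in> S \<longrightarrow> P x)} = {x \<in> S. \<not> P x}" by auto
  finally show ?thesis by (simp add: negligible_iff_null_sets)
qed

lemma borel_measurable_lebesgue_on_AE: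
  fixes f :: "'a::euclidean_space \<Rightarrow> 'b::euclidean_space"
  assumes "f \<in> borel_measurable (lebesgue_on S)" "AE x in lebesgue_on S. f x = g x" "S \<in> sets lebesgue"
  shows "g \<in> borel_measurable (lebesgue_on S)"
proof -
  have "(\<lambda>x. indicator S x *\<^sub>R g x) \<in> borel_measurable lebesgue"
  proof (rule borel_measurable_AE)
    show "(\<lambda>x. indicator S x *\<^sub>R f x) \<in> borel_measurable lebesgue"
      using assms(1,3) by (simp add: borel_measurable_restrict_space_iff)
    have "AE x in lebesgue. x \<in> S \<longrightarrow> f x = g x"
      using assms(2,3) by (simp add: AE_restrict_space_iff)
    then show "AE x in lebesgue. indicator S x *\<^sub>R f x = indicator S x *\<^sub>R g x"
      by eventually_elim (auto simp: indicator_def)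
  qed
  then show ?thesis using assms(3) by (simp add: borel_measurable_restrict_space_iff)
qed

text \<open>By Lebesgue's differentiation theorem almost every value of \<open>d\<close> is a limit of averages over small
cubes, all of which vanish. Only boxes inside \<open>\<Omega>\<close> are available, so the argument is made on each of
countably many boxes that cover \<open>\<Omega>\<close>.\<close>

lemma AE_zero_if_box_integrals_zero:
  fixes d :: "'a::euclidean_space \<Rightarrow> 'b::euclidean_space"
  assumes "open \<Omega>"
    and int: "\<And>a b. cbox a b \<subseteq> \<Omega> \<Longrightarrow> d integrable_on cbox a b"
    and zero: "\<And>a b. cbox a b \<subseteq> \<Omega> \<Longrightarrow> integral (cbox a b) d = 0"
  shows "AE x in lebesgue_on \<Omega>. d x = 0"
proof -
  have cell: "negligible {x \<in> cbox a b. d x \<noteq> 0}" if ab: "cbox a b \<subseteq> \<Omega>" for a b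
  proof -
    define f where "f x = (if x \<in> cbox a b then d x else 0)" for x
    have "f integrable_on UNIV" unfolding f_def using int[OF ab] integrable_restrict_UNIV by blast
    then have "f integrable_on cbox u v" for u v by (meson integrable_on_subcbox subset_UNIV)
    then obtain N where N: "negligible N" and avg: "\<And>x e. \<lbrakk>x \<notin> N; 0 < e\<rbrakk> \<Longrightarrow>
       \<exists>\<delta>>0. \<forall>h. 0 < h \<and> h < \<delta> \<longrightarrow> norm (integral (cbox x (x + h *\<^sub>R One)) f /\<^sub>R h ^ DIM('a) - f x) < e"
      using integrable_ccontinuous_explicit[of f] by blast
    have "d x = 0" if x: "x \<in> box a b" "x \<notin> N" for x
    proof (rule ccontr)
      assume "d x \<noteq> 0"
      then have "norm (f x) > 0" using x box_subset_cbox by (auto simp: f_def)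
      from avg[OF x(2) this] obtain \<delta> where \<delta>: "\<delta> > 0"
        "\<And>h. 0 < h \<Longrightarrow> h < \<delta> \<Longrightarrow>
           norm (integral (cbox x (x + h *\<^sub>R One)) f /\<^sub>R h ^ DIM('a) - f x) < norm (f x)"
        by blast
      obtain r where r: "r > 0" "cball x r \<subseteq> box a b"
        using x(1) open_box open_contains_cball by blast
      define h where "h = min (\<delta> / 2) (r / real DIM('a))"
      have h: "0 < h" "h < \<delta>" "h \<le> r / real DIM('a)" using \<delta>(1) r(1) by (auto simp: h_def)
      have sub: "cbox x (x + h *\<^sub>R One) \<subseteq> cball x r"
      proof
        fix y assume y: "y \<in> cbox x (x + h *\<^sub>R One)"
        have "norm (y - x) \<le> (\<Sum>i\<in>Basis. \<bar>(y - x) \<bullet> i\<bar>)" by (rule norm_le_l1)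
        also have "\<dots> \<le> (\<Sum>i\<in>(Basis::'a set). h)"
        proof (rule sum_mono)
          fix i :: 'a assume "i \<in> Basis"
          then have "x \<bullet> i \<le> y \<bullet> i" "y \<bullet> i \<le> (x + h *\<^sub>R One) \<bullet> i" using y by (auto simp: mem_box)
          then show "\<bar>(y - x) \<bullet> i\<bar> \<le> h" using \<open>i \<in> Basis\<close>
            by (simp add: inner_diff_left inner_add_left)
        qed
        also have "\<dots> \<le> r" using h(3) by (simp add: field_simps)
        finally show "y \<in> cball x r" by (simp add: dist_norm norm_minus_commute)
      qed
      then have sub2: "cbox x (x + h *\<^sub>R One) \<subseteq> cbox a b" using r(2) box_subset_cbox by blast
      have "integral (cbox x (x + h *\<^sub>R One)) f = integral (cbox x (x + h *\<^sub>R One)) d"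
        by (rule integral_cong) (use sub2 in \<open>auto simp: f_def\<close>)
      also have "\<dots> = 0" using zero sub2 ab by blast
      finally show False using \<delta>(2)[OF h(1,2)] by simp
    qed
    then have "{x \<in> cbox a b. d x \<noteq> 0} \<subseteq> N \<union> (cbox a b - box a b)" by blast
    then show ?thesis
      using N negligible_frontier_interval negligible_Un negligible_subset by blast
  qed
  obtain \<D> where \<D>: "countable \<D>" "\<D> \<subseteq> Pow \<Omega>" "\<And>X. X \<in> \<D> \<Longrightarrow> \<exists>a b. X = cbox a b" "\<Union>\<D> = \<Omega>"
    using open_countable_Union_open_cbox[OF assms(1)] by metis
  have "negligible (\<Union>((\<lambda>X. {x \<in> X. d x \<noteq> 0}) ` \<D>))"
  proof (rule negligible_countable_Union)
    fix S assume "S \<in> (\<lambda>X. {x \<in> X. d x \<noteq> 0}) ` \<D>"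
    then obtain X where X: "X \<in> \<D>" "S = {x \<in> X. d x \<noteq> 0}" by blast
    obtain a b where ab: "X = cbox a b" using \<D>(3)[OF X(1)] by blast
    have "cbox a b \<subseteq> \<Omega>" using X(1) \<D>(2) ab by blast
    then show "negligible S" unfolding X(2) ab by (rule cell)
  qed (use \<D>(1) in auto)
  moreover have "{x \<in> \<Omega>. \<not> d x = 0} = \<Union>((\<lambda>X. {x \<in> X. d x \<noteq> 0}) ` \<D>)" using \<D>(4) by blast
  ultimately show ?thesis using assms(1) by (simp add: AE_lebesgue_on_iff)
qed

lemma smooth_fun_partials:
  fixes f :: "real^'n \<Rightarrow> 'b::euclidean_space"
  assumes "smooth_fun f"
  obtains P where "\<And>x. has_partials f P x"
    "\<And>i. continuous_on UNIV (P i)"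
proof -
  obtain D where D: "D [] = f"
     "\<And>\<alpha> x. (D \<alpha> has_derivative (\<lambda>h. \<Sum>i\<in>UNIV. (h $ i) *\<^sub>R D (i # \<alpha>) x)) (at x)"
    using assms unfolding smooth_fun_def by blast
  have "continuous_on UNIV (D [i])" for i
    by (rule has_derivative_continuous_on) (use D(2) in auto)
  moreover have "(f has_derivative (\<lambda>h. \<Sum>i\<in>UNIV. (h $ i) *\<^sub>R D [i] x)) (at x)" for x
    using D(2)[of "[]"] D(1) by simp
  ultimately show ?thesis by (rule that[rotated])
qed

lemma smooth_fun_continuous:
  fixes f :: "real^'n \<Rightarrow> 'b::euclidean_space"
  assumes "smooth_fun f"
  shows "continuous_on UNIV f"
proof -
  obtain P where P: "\<And>x. has_partials f P x"
    using smooth_fun_partials[OF assms] by metis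
  show ?thesis by (rule has_derivative_continuous_on) (use P in auto)
qed

lemma sum_axis_scaleR:
  fixes c :: "'n::finite \<Rightarrow> 'b::real_vector"
  shows "(\<Sum>j\<in>UNIV. ((axis i t :: real^'n) $ j) *\<^sub>R c j) = t *\<^sub>R c i"
proof -
  have "(\<Sum>j\<in>UNIV. ((axis i t :: real^'n) $ j) *\<^sub>R c j) = (\<Sum>j\<in>UNIV. if j = i then t *\<^sub>R c j else 0)"
    by (intro sum.cong) (auto simp: axis_def)
  then show ?thesis by simp
qed

lemma frechet_derivative_axis:
  fixes f :: "real^'n \<Rightarrow> 'b::euclidean_space"
  assumes "has_partials f P x"
  shows "frechet_derivative f (at x) (axis i 1) = P i x"
  using frechet_derivative_at[OF assms, symmetric] sum_axis_scaleR[of i 1 "\<lambda>i. P i x"] by simp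

lemma partial_zero_outside_support:
  fixes f :: "real^'n \<Rightarrow> 'b::euclidean_space"
  assumes "has_partials f P x" "x \<notin> closure {x. f x \<noteq> 0}"
  shows "P i x = 0"
proof -
  have "(f has_derivative (\<lambda>h. 0)) (at x)"
  proof (rule has_derivative_transform_within_open[of "\<lambda>x. 0"])
    show "open (- closure {x. f x \<noteq> 0})" using closed_closure by (rule open_Compl)
    show "x \<in> - closure {x. f x \<noteq> 0}" using assms(2) by simp
    show "0 = f y" if "y \<in> - closure {x. f x \<noteq> 0}" for y
      using that closure_subset[of "{x. f x \<noteq> 0}"] by auto
  qed simp
  then have "(\<lambda>h. \<Sum>i\<in>UNIV. (h $ i) *\<^sub>R P i x) = (\<lambda>h. 0)"
    using has_derivative_unique assms(1) by blast
  then show ?thesis using sum_axis_scaleR[of i 1 "\<lambda>i. P i x"] by (metis scaleR_one)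
qed

lemma integrable_scaleR_compact_support:
  fixes v :: "real^'n \<Rightarrow> 'b::euclidean_space" and g :: "real^'n \<Rightarrow> real"
  assumes "locally_integrable \<Omega> v" "continuous_on UNIV g" "compact S" "S \<subseteq> \<Omega>"
    "\<And>x. x \<notin> S \<Longrightarrow> g x = 0" "\<Omega> \<in> sets lebesgue"
  shows "integrable (lebesgue_on \<Omega>) (\<lambda>x. g x *\<^sub>R v x)"
proof -
  have S: "S \<in> sets lebesgue" using assms(3) by (simp add: compact_imp_closed)
  have "integrable (lebesgue_on S) v" using assms(1,3,4) by (simp add: locally_integrable_def)
  then have "v absolutely_integrable_on S"
    using S by (simp add: integrable_restrict_space set_integrable_def)
  moreover have "g \<in> borel_measurable (lebesgue_on S)"
    by (intro continuous_imp_measurable_on_sets_lebesgue S continuous_on_subset[OF assms(2)]) auto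
  moreover have "bounded (g ` S)"
    by (intro compact_imp_bounded compact_continuous_image assms(3) continuous_on_subset[OF assms(2)]) auto
  moreover have "bilinear (\<lambda>(r::real) (v::'b). r *\<^sub>R v)"
    by (simp add: bilinear_def linear_iff algebra_simps)
  ultimately have "(\<lambda>x. g x *\<^sub>R v x) absolutely_integrable_on S"
    using absolutely_integrable_bounded_measurable_product[of "\<lambda>(r::real) (v::'b). r *\<^sub>R v"] S by blast
  then have "integrable (lebesgue_on S) (\<lambda>x. g x *\<^sub>R v x)"
    using S by (simp add: integrable_restrict_space set_integrable_def)
  then show ?thesis
    using integral_lebesgue_on_subset(2)[OF S assms(6,4), of "\<lambda>x. g x *\<^sub>R v x"] assms(5) by simp
qed

lemma locally_integrable_continuous:
  fixes v :: "real^'n \<Rightarrow> 'b::euclidean_space"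
  assumes "continuous_on UNIV v"
  shows "locally_integrable \<Omega> v"
  unfolding locally_integrable_def
proof (intro allI impI)
  fix S :: "(real^'n) set" assume S: "compact S \<and> S \<subseteq> \<Omega>"
  then have "integrable lborel (\<lambda>x. indicator S x *\<^sub>R v x)"
    using borel_integrable_compact continuous_on_subset[OF assms] by blast
  then have "integrable lebesgue (\<lambda>x. indicator S x *\<^sub>R v x)"
    by (subst integrable_completion) auto
  then show "integrable (lebesgue_on S) v"
    using S by (simp add: integrable_restrict_space compact_imp_closed)
qed

lemma locally_integrable_diff:
  assumes "locally_integrable \<Omega> v" "locally_integrable \<Omega> w"
  shows "locally_integrable \<Omega> (\<lambda>x. v x - w x)"
  using assms by (simp add: locally_integrable_def)

lemma test_fun_integrable:
  fixes v :: "real^'n \<Rightarrow> 'b::euclidean_space" and \<psi> :: "real^'n \<Rightarrow> real"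
  assumes "\<psi> \<in> test_funs \<Omega>" "locally_integrable \<Omega> v" "open \<Omega>"
  shows "integrable (lebesgue_on \<Omega>) (\<lambda>x. \<psi> x *\<^sub>R v x)"
    and "integrable (lebesgue_on \<Omega>) (\<lambda>x. frechet_derivative \<psi> (at x) (axis i 1) *\<^sub>R v x)"
proof -
  have supp: "compact (closure {x. \<psi> x \<noteq> 0})" "closure {x. \<psi> x \<noteq> 0} \<subseteq> \<Omega>" and sm: "smooth_fun \<psi>"
    using assms(1) by (auto simp: test_funs_def)
  have L: "\<Omega> \<in> sets lebesgue" using assms(3) by simp
  obtain P where P: "\<And>x. has_partials \<psi> P x"
    "\<And>i. continuous_on UNIV (P i)" using smooth_fun_partials[OF sm] by blast
  have "continuous_on UNIV \<psi>"
    by (rule has_derivative_continuous_on) (use P(1) in auto)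
  then show "integrable (lebesgue_on \<Omega>) (\<lambda>x. \<psi> x *\<^sub>R v x)"
    by (rule integrable_scaleR_compact_support[OF assms(2) _ supp _ L])
      (use closure_subset[of "{x. \<psi> x \<noteq> 0}"] in auto)
  have "integrable (lebesgue_on \<Omega>) (\<lambda>x. P i x *\<^sub>R v x)"
    by (rule integrable_scaleR_compact_support[OF assms(2) P(2) supp _ L])
      (rule partial_zero_outside_support[OF P(1)])
  moreover have "frechet_derivative \<psi> (at x) (axis i 1) = P i x" for x
    by (rule frechet_derivative_axis[OF P(1)])
  ultimately show "integrable (lebesgue_on \<Omega>) (\<lambda>x. frechet_derivative \<psi> (at x) (axis i 1) *\<^sub>R v x)"
    by simp
qed

text \<open>The fundamental lemma of the calculus of variations. Smooth bumps converge boundedly to the indicator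
function of a box, so the integral of \<open>d\<close> over every box in \<open>\<Omega>\<close> vanishes.\<close>

lemma AE_zero_if_test_integrals_zero:
  fixes d :: "real^'n \<Rightarrow> 'b::euclidean_space"
  assumes "open \<Omega>" "locally_integrable \<Omega> d"
    and zero: "\<And>\<psi> :: real^'n \<Rightarrow> real. \<psi> \<in> test_funs \<Omega> \<Longrightarrow> (\<integral>x. \<psi> x *\<^sub>R d x \<partial>lebesgue_on \<Omega>) = 0"
  shows "AE x in lebesgue_on \<Omega>. d x = 0"
proof (rule AE_zero_if_box_integrals_zero[OF assms(1)])
  fix a b :: "real^'n" assume ab: "cbox a b \<subseteq> \<Omega>"
  have int: "integrable (lebesgue_on (cbox a b)) d"
    using assms(2) ab by (simp add: locally_integrable_def)
  then show "d integrable_on cbox a b"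
    by (rule integrable_on_lebesgue_on) simp
  have "(\<lambda>k. \<integral>x. box_bump k a b x *\<^sub>R d x \<partial>lebesgue_on (cbox a b)) \<longlonglongrightarrow>
      (\<integral>x. indicator (box a b) x *\<^sub>R d x \<partial>lebesgue_on (cbox a b))"
  proof (rule integral_dominated_convergence)
    show "integrable (lebesgue_on (cbox a b)) (\<lambda>x. norm (d x))" using int by simp
    have "box_bump k a b \<in> borel_measurable (lebesgue_on (cbox a b))" for k
    proof (rule continuous_imp_measurable_on_sets_lebesgue)
      show "continuous_on (cbox a b) (box_bump k a b)"
        using smooth_fun_continuous[OF box_bump_smooth] continuous_on_subset by blast
    qed simp
    then show "(\<lambda>x. box_bump k a b x *\<^sub>R d x) \<in> borel_measurable (lebesgue_on (cbox a b))" for k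
      using int by (intro borel_measurable_scaleR) auto
    show "(\<lambda>x. indicator (box a b) x *\<^sub>R d x) \<in> borel_measurable (lebesgue_on (cbox a b))"
    proof (intro borel_measurable_scaleR borel_measurable_indicator)
      show "d \<in> borel_measurable (lebesgue_on (cbox a b))" using int by auto
      show "box a b \<in> sets (lebesgue_on (cbox a b))"
        by (simp add: sets_restrict_space_iff box_subset_cbox)
    qed
    show "AE x in lebesgue_on (cbox a b). (\<lambda>k. box_bump k a b x *\<^sub>R d x) \<longlonglongrightarrow> indicator (box a b) x *\<^sub>R d x"
      by (intro AE_I2 tendsto_scaleR box_bump_tendsto tendsto_const)
    show "AE x in lebesgue_on (cbox a b). norm (box_bump k a b x *\<^sub>R d x) \<le> norm (d x)" for k
      by (intro AE_I2) (simp add: box_bump_range mult_left_le_one_le)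
  qed
  moreover have "(\<integral>x. box_bump k a b x *\<^sub>R d x \<partial>lebesgue_on (cbox a b)) = 0" for k
  proof -
    have "(\<integral>x. box_bump k a b x *\<^sub>R d x \<partial>lebesgue_on (cbox a b)) = (\<integral>x. box_bump k a b x *\<^sub>R d x \<partial>lebesgue_on \<Omega>)"
      by (rule integral_lebesgue_on_subset(1)[symmetric])
        (use assms(1) ab box_bump_outside[of _ a b k] box_subset_cbox[of a b] in auto)
    then show ?thesis using zero[OF box_bump_test_fun[OF ab]] by simp
  qed
  ultimately have "(\<integral>x. indicator (box a b) x *\<^sub>R d x \<partial>lebesgue_on (cbox a b)) = 0"
    by (simp add: LIMSEQ_const_iff)
  moreover have "(\<integral>x. indicator (box a b) x *\<^sub>R d x \<partial>lebesgue_on (cbox a b))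
      = integral\<^sup>L (lebesgue_on (cbox a b)) d"
  proof (rule integral_cong_AE)
    have "{x \<in> cbox a b. \<not> indicator (box a b) x *\<^sub>R d x = d x} \<subseteq> cbox a b - box a b" by auto
    then show "AE x in lebesgue_on (cbox a b). indicator (box a b) x *\<^sub>R d x = d x"
      using negligible_subset[OF negligible_frontier_interval] by (subst AE_lebesgue_on_iff) auto
    show "(\<lambda>x. indicator (box a b) x *\<^sub>R d x) \<in> borel_measurable (lebesgue_on (cbox a b))"
    proof (intro borel_measurable_scaleR borel_measurable_indicator)
      show "d \<in> borel_measurable (lebesgue_on (cbox a b))" using int by auto
      show "box a b \<in> sets (lebesgue_on (cbox a b))"
        by (simp add: sets_restrict_space_iff box_subset_cbox)
    qed
  qed (use int in auto)
  ultimately show "integral (cbox a b) d = 0"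
    using lebesgue_integral_eq_integral[OF int] by simp
qed

lemma has_weak_partial_unique:
  fixes v :: "real^'n \<Rightarrow> 'b::euclidean_space"
  assumes "has_weak_partial \<Omega> i v d1" "has_weak_partial \<Omega> i v d2" "open \<Omega>"
  shows "AE x in lebesgue_on \<Omega>. d1 x = d2 x"
proof -
  have li: "locally_integrable \<Omega> d1" "locally_integrable \<Omega> d2"
    using assms by (auto simp: has_weak_partial_def)
  have "AE x in lebesgue_on \<Omega>. d1 x - d2 x = 0"
  proof (rule AE_zero_if_test_integrals_zero[OF assms(3) locally_integrable_diff[OF li]])
    fix \<psi> :: "real^'n \<Rightarrow> real" assume \<psi>: "\<psi> \<in> test_funs \<Omega>"
    then have "(\<integral>x. \<psi> x *\<^sub>R d1 x \<partial>lebesgue_on \<Omega>) = (\<integral>x. \<psi> x *\<^sub>R d2 x \<partial>lebesgue_on \<Omega>)"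
      using assms(1,2) unfolding has_weak_partial_def by simp
    then show "(\<integral>x. \<psi> x *\<^sub>R (d1 x - d2 x) \<partial>lebesgue_on \<Omega>) = 0"
      using test_fun_integrable(1)[OF \<psi> li(1) assms(3)] test_fun_integrable(1)[OF \<psi> li(2) assms(3)]
      by (simp add: scaleR_diff_right)
  qed
  then show ?thesis by simp
qed

lemma has_weak_partial_diff:
  fixes v w :: "real^'n \<Rightarrow> 'b::euclidean_space"
  assumes "has_weak_partial \<Omega> i v d" "has_weak_partial \<Omega> i w e" "open \<Omega>"
  shows "has_weak_partial \<Omega> i (\<lambda>x. v x - w x) (\<lambda>x. d x - e x)"
proof -
  have li: "locally_integrable \<Omega> v" "locally_integrable \<Omega> w" "locally_integrable \<Omega> d" "locally_integrable \<Omega> e"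
    using assms by (auto simp: has_weak_partial_def)
  show ?thesis
    unfolding has_weak_partial_def
  proof (intro conjI allI impI locally_integrable_diff li)
    fix \<psi> :: "real^'n \<Rightarrow> real" assume \<psi>: "\<psi> \<in> test_funs \<Omega>"
    show "(\<integral>x. frechet_derivative \<psi> (at x) (axis i 1) *\<^sub>R (v x - w x) \<partial>lebesgue_on \<Omega>)
        = - (\<integral>x. \<psi> x *\<^sub>R (d x - e x) \<partial>lebesgue_on \<Omega>)"
      using assms(1,2) \<psi> li unfolding has_weak_partial_def
      by (simp add: scaleR_diff_right test_fun_integrable[OF \<psi> li(1) assms(3)]
        test_fun_integrable[OF \<psi> li(2) assms(3)] test_fun_integrable[OF \<psi> li(3) assms(3)]
        test_fun_integrable[OF \<psi> li(4) assms(3)])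
  qed
qed

lemma has_weak_partial_weak_partial:
  assumes "has_weak_partial \<Omega> i v d"
  shows "has_weak_partial \<Omega> i v (weak_partial \<Omega> i v)"
  unfolding weak_partial_def by (rule someI[of "has_weak_partial \<Omega> i v", OF assms])

lemma weak_partial_AE_eq:
  assumes "has_weak_partial \<Omega> i v d" "open \<Omega>"
  shows "AE x in lebesgue_on \<Omega>. d x = weak_partial \<Omega> i v x"
  using has_weak_partial_unique[OF assms(1) has_weak_partial_weak_partial[OF assms(1)] assms(2)] .

text \<open>The integral of the translates \<open>G(x + t e\<^sub>i)\<close> over a box is constant for small \<open>t\<close> if the box
contains a neighbourhood of the support; its derivative at \<open>t = 0\<close> is the integral of the partial
derivative.\<close>

lemma integral_partial_compact_support:
  fixes G :: "real^'n \<Rightarrow> 'b::euclidean_space"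
  assumes G: "\<And>x. has_partials G P x"
    and cont: "continuous_on UNIV (P i)"
    and S: "compact S" "\<And>x. x \<notin> S \<Longrightarrow> G x = 0"
  obtains a b where "S \<subseteq> cbox a b" "integral (cbox a b) (P i) = 0"
proof -
  have "bounded (\<Union>x\<in>S. cball x 1)"
    using compact_imp_bounded[OF compact_minkowski_sum_cball[OF S(1), of 1]] .
  then obtain a b where ab: "(\<Union>x\<in>S. cball x 1) \<subseteq> cbox a b"
    using bounded_subset_cbox_symmetric by metis
  define c where "c t = (axis i t :: real^'n)" for t
  have "linear (\<lambda>t. axis i t :: real^'n)"
    by (simp add: linear_iff vec_eq_iff axis_def)
  then have bl: "bounded_linear (\<lambda>t. axis i t :: real^'n)"
    by (simp add: linear_conv_bounded_linear)
  have nc: "norm (c t) = \<bar>t\<bar>" for t by (simp add: c_def norm_eq_sqrt_inner inner_axis_axis)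
  have c0: "c 0 = 0" by (simp add: c_def vec_eq_iff axis_def)
  have Sab: "S \<subseteq> cbox a b" using ab centre_in_cball[of _ 1] by (meson UN_I subset_eq zero_le_one)
  have contG: "continuous_on UNIV G" by (rule has_derivative_continuous_on) (use G in auto)
  have const: "integral (cbox a b) (\<lambda>x. G (x + c t)) = integral (cbox a b) G" if "\<bar>t\<bar> \<le> 1" for t
  proof -
    have Sab': "S \<subseteq> cbox (a + c t) (b + c t)"
    proof
      fix y assume "y \<in> S"
      moreover have "y - c t \<in> cball y 1" using that nc[of t] by (simp add: dist_norm)
      ultimately have "y - c t \<in> cbox a b" using ab by blast
      then show "y \<in> cbox (a + c t) (b + c t)" by (simp add: mem_box_cart algebra_simps)
    qed
    have "G integrable_on S'" if "S \<subseteq> S'" "S' = cbox u v" for u v S'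
      using that contG continuous_on_subset integrable_continuous by blast
    then have "(G has_integral integral (cbox (a + c t) (b + c t)) G) (cbox (a + c t) (b + c t))"
      "(G has_integral integral (cbox a b) G) (cbox a b)"
      using Sab Sab' by (auto intro: integrable_integral)
    have out: "G x = 0" if "x \<notin> S'" "S \<subseteq> S'" for x S' using S(2) that by blast
    have U: "(G has_integral integral (cbox (a + c t) (b + c t)) G) UNIV"
      "(G has_integral integral (cbox a b) G) UNIV"
      by (rule has_integral_on_superset[OF _ out[OF _ Sab'] subset_UNIV], fact, assumption)
        (rule has_integral_on_superset[OF _ out[OF _ Sab] subset_UNIV], fact, assumption)
    then have eq: "integral (cbox (a + c t) (b + c t)) G = integral (cbox a b) G"
      using has_integral_unique by blast
    have "(G has_integral integral (cbox (a + c t) (b + c t)) G) (cbox (a + c t) (b + c t))"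
      by (intro integrable_integral integrable_continuous continuous_on_subset[OF contG]) auto
    from has_integral_affinity'[OF this, of 1 "c t"]
    have "((\<lambda>x. G (x + c t)) has_integral integral (cbox (a + c t) (b + c t)) G) (cbox a b)" by simp
    then show ?thesis using eq by (simp add: integral_unique)
  qed
  have "((\<lambda>t. integral (cbox a b) (\<lambda>x. G (x + c t))) has_vector_derivative
      integral (cbox a b) (\<lambda>x. P i (x + c 0))) (at 0 within {-1<..<1})"
  proof (rule leibniz_rule_vector_derivative)
    fix t x
    have "(c has_derivative (\<lambda>h. axis i h)) (at t within {-1<..<1})"
      using bounded_linear_imp_has_derivative[OF bl] by (simp add: c_def[abs_def])
    then have "((\<lambda>t. x + c t) has_derivative (\<lambda>h. axis i h)) (at t within {-1<..<1})"
      by (auto intro!: derivative_eq_intros)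
    from has_derivative_compose[OF this G[of "x + c t"]]
    show "((\<lambda>t. G (x + c t)) has_vector_derivative P i (x + c t)) (at t within {-1<..<1})"
      by (simp add: has_vector_derivative_def sum_axis_scaleR)
  next
    show "(\<lambda>x. G (x + c t)) integrable_on cbox a b" for t
      by (intro integrable_continuous continuous_on_compose2[OF contG] continuous_intros) auto
    have "continuous_on UNIV c" using bl by (simp add: c_def[abs_def] linear_continuous_on)
    then show "continuous_on ({- 1<..<1} \<times> cbox a b) (\<lambda>(t, x). P i (x + c t))"
      unfolding case_prod_beta
      by (intro continuous_on_compose2[OF cont] continuous_on_add continuous_on_snd continuous_on_id
        continuous_on_compose2[of UNIV c _ fst] continuous_on_fst) auto
  qed auto
  then have "((\<lambda>t. integral (cbox a b) G) has_vector_derivative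
      integral (cbox a b) (\<lambda>x. P i (x + c 0))) (at 0 within {-1<..<1})"
    by (rule has_vector_derivative_transform[rotated 2]) (use const in auto)
  then have "((\<lambda>t. integral (cbox a b) G) has_vector_derivative
      integral (cbox a b) (\<lambda>x. P i (x + c 0))) (at 0)"
    by (subst (asm) at_within_open) auto
  then have "integral (cbox a b) (P i) = 0"
    using vector_derivative_unique_at[of "\<lambda>t. integral (cbox a b) G" _ 0 0] c0
    by simp
  then show ?thesis using that Sab by blast
qed

text \<open>Integration by parts against a test function: the product with the test function has compact support,
so the integral of its partial derivative vanishes.\<close>

lemma has_weak_partial_smooth:
  fixes V :: "real^'n \<Rightarrow> 'b::euclidean_space"
  assumes V: "\<And>x. has_partials V P x"
    and cont: "\<And>i. continuous_on UNIV (P i)" and "open \<Omega>"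
  shows "has_weak_partial \<Omega> i V (P i)"
  unfolding has_weak_partial_def
proof (intro conjI allI impI)
  have contV: "continuous_on UNIV V" by (rule has_derivative_continuous_on) (use V in auto)
  show li: "locally_integrable \<Omega> V" "locally_integrable \<Omega> (P i)"
    using contV cont by (auto intro: locally_integrable_continuous)
  fix \<psi> :: "real^'n \<Rightarrow> real" assume \<psi>: "\<psi> \<in> test_funs \<Omega>"
  then have supp: "compact (closure {x. \<psi> x \<noteq> 0})" "closure {x. \<psi> x \<noteq> 0} \<subseteq> \<Omega>" and sm: "smooth_fun \<psi>"
    by (auto simp: test_funs_def)
  let ?S = "closure {x. \<psi> x \<noteq> 0}"
  obtain Q where Q: "\<And>x. has_partials \<psi> Q x"
    "\<And>i. continuous_on UNIV (Q i)" using smooth_fun_partials[OF sm] by blast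
  have cont\<psi>: "continuous_on UNIV \<psi>" by (rule has_derivative_continuous_on) (use Q in auto)
  define R where "R = (\<lambda>i x. Q i x *\<^sub>R V x + \<psi> x *\<^sub>R P i x)"
  have out: "\<psi> x = 0" "Q j x = 0" if "x \<notin> ?S" for x j
    using that closure_subset[of "{x. \<psi> x \<noteq> 0}"]
      partial_zero_outside_support[of \<psi> Q x j, OF Q(1) that] by auto
  have contR: "continuous_on UNIV (R i)" unfolding R_def
    by (intro continuous_intros cont\<psi> contV cont Q)
  have der: "has_partials (\<lambda>x. \<psi> x *\<^sub>R V x) R x" for x
    by (rule has_derivative_eq_rhs[OF has_derivative_scaleR[OF Q(1) V]])
      (simp add: R_def fun_eq_iff scaleR_sum_right scaleR_sum_left sum.distrib algebra_simps)
  have out\<psi>: "\<psi> x *\<^sub>R V x = 0" if "x \<notin> ?S" for x using out(1)[OF that] by simp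
  obtain a b where ab: "?S \<subseteq> cbox a b" "integral (cbox a b) (R i) = 0"
    using integral_partial_compact_support[of "\<lambda>x. \<psi> x *\<^sub>R V x" R i ?S thesis,
        OF der contR supp(1) out\<psi>] .
  have Rout: "R i x = 0" if "x \<notin> ?S" for x by (simp add: R_def out[OF that])
  have Sm: "?S \<in> sets lebesgue" by simp
  have "(\<integral>x. R i x \<partial>lebesgue_on \<Omega>) = (\<integral>x. R i x \<partial>lebesgue_on ?S)"
    by (rule integral_lebesgue_on_subset(1)[OF Sm _ supp(2)]) (use Rout assms(3) in simp_all)
  also have "\<dots> = (\<integral>x. R i x \<partial>lebesgue_on (cbox a b))"
    by (rule integral_lebesgue_on_subset(1)[OF Sm _ ab(1), symmetric]) (use Rout in simp_all)
  also have "\<dots> = integral (cbox a b) (R i)"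
    using locally_integrable_continuous[OF contR, of UNIV]
    by (intro lebesgue_integral_eq_integral) (auto simp: locally_integrable_def)
  finally have "(\<integral>x. R i x \<partial>lebesgue_on \<Omega>) = 0" using ab(2) by simp
  moreover have "(\<integral>x. R i x \<partial>lebesgue_on \<Omega>) =
      (\<integral>x. frechet_derivative \<psi> (at x) (axis i 1) *\<^sub>R V x \<partial>lebesgue_on \<Omega>) + (\<integral>x. \<psi> x *\<^sub>R P i x \<partial>lebesgue_on \<Omega>)"
  proof -
    have "frechet_derivative \<psi> (at x) (axis i 1) = Q i x" for x
      by (rule frechet_derivative_axis[OF Q(1)])
    then show ?thesis unfolding R_def
      using test_fun_integrable(2)[OF \<psi> li(1) assms(3), of i]
        test_fun_integrable(1)[OF \<psi> li(2) assms(3)] by simp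
  qed
  ultimately show "(\<integral>x. frechet_derivative \<psi> (at x) (axis i 1) *\<^sub>R V x \<partial>lebesgue_on \<Omega>)
      = - (\<integral>x. \<psi> x *\<^sub>R P i x \<partial>lebesgue_on \<Omega>)"
    by (simp add: eq_neg_iff_add_eq_0)
qed

section \<open>Lebesgue spaces and Hoelder's inequality\<close>

abbreviation L1_norm :: "'a::euclidean_space set \<Rightarrow> ('a \<Rightarrow> 'b::euclidean_space) \<Rightarrow> real" where
  "L1_norm S f \<equiv> \<integral>x. norm (f x) \<partial>lebesgue_on S"

lemma Lp_space_ereal:
  "f \<in> Lp_space (ereal s) M \<longleftrightarrow> f \<in> borel_measurable M \<and> integrable M (\<lambda>x. norm (f x) powr s)"
  by (simp add: Lp_space_def)

lemma Lp_norm_ereal: "Lp_norm (ereal s) M f = (\<integral>x. norm (f x) powr s \<partial>M) powr (1 / s)"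
  by (simp add: Lp_norm_def)

lemma Lp_space_1: "f \<in> Lp_space 1 M \<longleftrightarrow> integrable M f"
proof -
  have "f \<in> Lp_space 1 M \<longleftrightarrow> f \<in> borel_measurable M \<and> integrable M (\<lambda>x. norm (f x))"
    using Lp_space_ereal[of f 1 M] by (simp add: one_ereal_def)
  also have "\<dots> \<longleftrightarrow> integrable M f"
    using integrable_norm_iff[of f M] by (cases "f \<in> borel_measurable M") auto
  finally show ?thesis .
qed

lemma Lp_norm_1: "Lp_norm 1 M f = (\<integral>x. norm (f x) \<partial>M)"
  using Lp_norm_ereal[of 1 M f] by (simp add: one_ereal_def)

lemma Lp_norm_ereal_nonneg: "0 \<le> Lp_norm (ereal s) M f"
  by (simp add: Lp_norm_ereal)

lemma Lp_norm_infinity_AE: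
  assumes "f \<in> Lp_space \<infinity> M"
  shows "AE x in M. norm (f x) \<le> Lp_norm \<infinity> M f" and "0 \<le> Lp_norm \<infinity> M f"
proof -
  let ?S = "{C. 0 \<le> C \<and> (AE x in M. norm (f x) \<le> C)}"
  obtain C where "AE x in M. norm (f x) \<le> C" using assms by (auto simp: Lp_space_def)
  then have "AE x in M. norm (f x) \<le> max C 0" by eventually_elim auto
  then have "max C 0 \<in> ?S" by simp
  then have ne: "?S \<noteq> {}" by blast
  have eq: "Lp_norm \<infinity> M f = Inf ?S" by (simp add: Lp_norm_def)
  show "0 \<le> Lp_norm \<infinity> M f" unfolding eq using ne by (intro cInf_greatest) auto
  have "AE x in M. norm (f x) \<le> Inf ?S + inverse (Suc k)" for k
  proof -
    have "Inf ?S < Inf ?S + inverse (Suc k)" by simp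
    then obtain C where "C \<in> ?S" "C < Inf ?S + inverse (Suc k)" using cInf_lessD[OF ne] by blast
    then have "AE x in M. norm (f x) \<le> C" "C < Inf ?S + inverse (Suc k)" by auto
    then show ?thesis by (auto elim: eventually_mono)
  qed
  then have "AE x in M. \<forall>k. norm (f x) \<le> Inf ?S + inverse (Suc k)" by (simp add: AE_all_countable)
  then show "AE x in M. norm (f x) \<le> Lp_norm \<infinity> M f"
    unfolding eq
  proof eventually_elim
    case (elim x)
    have "(\<lambda>k. Inf ?S + inverse (real (Suc k))) \<longlonglongrightarrow> Inf ?S + 0"
      by (intro tendsto_intros LIMSEQ_inverse_real_of_nat)
    then show ?case using elim LIMSEQ_le_const[of _ "Inf ?S + 0" "norm (f x)"] by auto
  qed
qed

lemma Lp_space_AE_cong: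
  fixes f :: "'a::euclidean_space \<Rightarrow> 'b::euclidean_space"
  assumes "f \<in> Lp_space s (lebesgue_on S)" "AE x in lebesgue_on S. f x = g x" "S \<in> sets lebesgue"
  shows "g \<in> Lp_space s (lebesgue_on S)" "Lp_norm s (lebesgue_on S) g = Lp_norm s (lebesgue_on S) f"
proof -
  have fm: "f \<in> borel_measurable (lebesgue_on S)" using assms(1) by (simp add: Lp_space_def)
  have gm: "g \<in> borel_measurable (lebesgue_on S)"
    by (rule borel_measurable_lebesgue_on_AE[OF fm assms(2,3)])
  have C: "(AE x in lebesgue_on S. norm (g x) \<le> C) \<longleftrightarrow> (AE x in lebesgue_on S. norm (f x) \<le> C)" for C
    using assms(2) by (auto elim: eventually_elim2)
  have ae: "AE x in lebesgue_on S. norm (g x) powr r = norm (f x) powr r" for r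
    using assms(2) by eventually_elim simp
  have pm: "(\<lambda>x. norm (f x) powr r) \<in> borel_measurable (lebesgue_on S)"
    "(\<lambda>x. norm (g x) powr r) \<in> borel_measurable (lebesgue_on S)" for r
    using fm gm by measurable
  have "integrable (lebesgue_on S) (\<lambda>x. norm (g x) powr r) \<longleftrightarrow> integrable (lebesgue_on S) (\<lambda>x. norm (f x) powr r)" for r
    by (rule integrable_cong_AE[OF pm(2,1) ae])
  then show "g \<in> Lp_space s (lebesgue_on S)"
    using assms(1) gm C by (auto simp: Lp_space_def)
  have "(\<integral>x. norm (g x) powr r \<partial>lebesgue_on S) = (\<integral>x. norm (f x) powr r \<partial>lebesgue_on S)" for r
    by (rule integral_cong_AE[OF pm(2,1) ae])
  then show "Lp_norm s (lebesgue_on S) g = Lp_norm s (lebesgue_on S) f"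
    by (simp add: Lp_norm_def C)
qed

lemma powr_add_le:
  fixes a b s :: real
  assumes "0 \<le> a" "0 \<le> b" "0 \<le> s"
  shows "(a + b) powr s \<le> 2 powr s * (a powr s + b powr s)"
proof -
  have "(a + b) powr s \<le> (2 * max a b) powr s" using assms by (intro powr_mono2) auto
  also have "\<dots> = 2 powr s * max a b powr s" using assms by (simp add: powr_mult)
  also have "\<dots> \<le> 2 powr s * (a powr s + b powr s)" by (intro mult_left_mono) (auto simp: max_def)
  finally show ?thesis .
qed

lemma Lp_space_diff:
  fixes f g :: "'a \<Rightarrow> 'b::euclidean_space"
  assumes "f \<in> Lp_space (ereal s) M" "g \<in> Lp_space (ereal s) M" "0 \<le> s"
  shows "(\<lambda>x. f x - g x) \<in> Lp_space (ereal s) M"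
  unfolding Lp_space_ereal
proof
  have m: "f \<in> borel_measurable M" "g \<in> borel_measurable M"
    and i: "integrable M (\<lambda>x. norm (f x) powr s)" "integrable M (\<lambda>x. norm (g x) powr s)"
    using assms by (auto simp: Lp_space_ereal)
  show "(\<lambda>x. f x - g x) \<in> borel_measurable M" using m by measurable
  show "integrable M (\<lambda>x. norm (f x - g x) powr s)"
  proof (rule Bochner_Integration.integrable_bound)
    show "integrable M (\<lambda>x. 2 powr s * (norm (f x) powr s + norm (g x) powr s))"
      using i by auto
    show "(\<lambda>x. norm (f x - g x) powr s) \<in> borel_measurable M" using m by measurable
    show "AE x in M. norm (norm (f x - g x) powr s) \<le> norm (2 powr s * (norm (f x) powr s + norm (g x) powr s))"
    proof (rule AE_I2)
      fix x
      have "norm (f x - g x) powr s \<le> (norm (f x) + norm (g x)) powr s"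
        using assms(3) by (intro powr_mono2 norm_triangle_ineq4) auto
      also have "\<dots> \<le> 2 powr s * (norm (f x) powr s + norm (g x) powr s)"
        using assms(3) by (intro powr_add_le) auto
      finally show "norm (norm (f x - g x) powr s) \<le> norm (2 powr s * (norm (f x) powr s + norm (g x) powr s))"
        by simp
    qed
  qed
qed

text \<open>Hoelder's inequality against the constant function \<open>1\<close>. Young's inequality is applied to \<open>|f|/A\<close> and
\<open>1\<close>; the choice of \<open>A\<close> makes both resulting terms multiples of the total mass.\<close>

lemma integral_norm_le_Lp_norm:
  fixes f :: "'a \<Rightarrow> 'b::euclidean_space"
  assumes "finite_measure M" "f \<in> Lp_space (ereal s) M" "1 \<le> s"
  shows "integrable M f"
    and "(\<integral>x. norm (f x) \<partial>M) \<le> measure M (space M) powr (1 - 1 / s) * Lp_norm (ereal s) M f"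
proof -
  interpret finite_measure M by fact
  have fm: "f \<in> borel_measurable M" and i: "integrable M (\<lambda>x. norm (f x) powr s)"
    using assms by (auto simp: Lp_space_ereal)
  have int1: "integrable M (\<lambda>x. norm (f x))"
  proof (rule Bochner_Integration.integrable_bound)
    show "integrable M (\<lambda>x. 1 + norm (f x) powr s)" using i by auto
    show "(\<lambda>x. norm (f x)) \<in> borel_measurable M" using fm by measurable
    have "t \<le> 1 + t powr s" if "0 \<le> t" for t :: real
    proof (cases "t \<le> 1")
      case False
      then have "t powr 1 \<le> t powr s" using assms(3) by (intro powr_mono) auto
      then show ?thesis using False by simp
    qed (use powr_ge_zero[of t s] in linarith)
    then show "AE x in M. norm (norm (f x)) \<le> norm (1 + norm (f x) powr s)" by (intro AE_I2) simp
  qed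
  then show int: "integrable M f" using integrable_norm_iff[OF fm] by simp
  define N where "N = Lp_norm (ereal s) M f"
  define \<mu> where "\<mu> = measure M (space M)"
  have Ns: "(\<integral>x. norm (f x) powr s \<partial>M) = N powr s"
    using assms(3) by (simp add: N_def Lp_norm_ereal powr_powr powr_one)
  consider "s = 1" | "\<mu> = 0" | "N = 0" | "s > 1" "\<mu> > 0" "N > 0"
    using assms(3) by (metis N_def \<mu>_def Lp_norm_ereal_nonneg less_eq_real_def measure_nonneg)
  then have "(\<integral>x. norm (f x) \<partial>M) \<le> \<mu> powr (1 - 1 / s) * N"
  proof cases
    case 1
    show ?thesis
    proof (cases "\<mu> = 0")
      case True
      then have "AE x in M. f x = 0" 
        by (intro AE_I'[of "space M"]) (auto simp: \<mu>_def null_sets_def measure_eq_emeasure_eq_ennreal emeasure_eq_measure)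
      then have "(\<integral>x. norm (f x) \<partial>M) = 0"  by (intro integral_eq_zero_AE) auto
      then show ?thesis using True by simp
    next
      case False
      then show ?thesis using 1 Ns Lp_norm_ereal_nonneg[of s M f] by (simp add: \<mu>_def N_def)
    qed
  next
    case 2
    then have "AE x in M. f x = 0" 
      by (intro AE_I'[of "space M"]) (auto simp: \<mu>_def null_sets_def measure_eq_emeasure_eq_ennreal emeasure_eq_measure)
    then have "(\<integral>x. norm (f x) \<partial>M) = 0" by (intro integral_eq_zero_AE) auto
    then show ?thesis using 2 by simp
  next
    case 3
    then have "(\<integral>x. norm (f x) powr s \<partial>M) = 0" using Ns assms(3) by simp
    then have "AE x in M. norm (f x) powr s = 0"
      using integral_nonneg_eq_0_iff_AE[OF i] by auto
    then have "AE x in M. norm (f x) = 0" by eventually_elim auto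
    then have "(\<integral>x. norm (f x) \<partial>M) = 0" by (intro integral_eq_zero_AE) auto
    then show ?thesis using 3 by simp
  next
    case 4
    \<comment> \<open>With this \<open>A\<close> the integral of \<open>(|f|/A) powr s\<close> equals the total mass \<open>\<mu>\<close>.\<close>
    define A where "A = N * \<mu> powr (- (1 / s))"
    have A: "A > 0" using 4 by (simp add: A_def)
    have "(\<mu> powr (- (1 / s))) powr s = inverse \<mu>"
      using 4 by (simp only: powr_powr) (simp add: powr_minus)
    then have As: "A powr s = N powr s * inverse \<mu>" using 4
      by (simp add: A_def powr_mult del: powr_powr)
    have "(\<integral>x. norm (f x) / A \<partial>M) \<le> (\<integral>x. (norm (f x) powr s / A powr s) / s + (1 - 1 / s) \<partial>M)"
    proof (rule integral_mono)
      show "integrable M (\<lambda>x. norm (f x) powr s / A powr s / s + (1 - 1 / s))" using i by auto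
      show "integrable M (\<lambda>x. norm (f x) / A)" using int1 by auto
      fix x
      have "norm (f x) / A * 1 \<le> (norm (f x) / A) powr s / s + 1 powr (s / (s - 1)) / (s / (s - 1))"
        using 4 A by (intro Youngs_inequality) (auto simp: field_simps)
      also have "\<dots> = (norm (f x) powr s / A powr s) / s + (1 - 1 / s)"
        using 4 A by (simp add: powr_divide field_simps)
      finally show "norm (f x) / A \<le> (norm (f x) powr s / A powr s) / s + (1 - 1 / s)" by simp
    qed
    also have "\<dots> = (N powr s / A powr s) / s + \<mu> * (1 - 1 / s)"
      using i by (simp add: Ns \<mu>_def)
    also have "N powr s / A powr s = \<mu>" using 4 by (simp add: As field_simps)
    also have "\<mu> / s + \<mu> * (1 - 1 / s) = \<mu>" by (simp add: field_simps)
    finally have "(\<integral>x. norm (f x) \<partial>M) \<le> A * \<mu>" using A by (simp add: field_simps)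
    also have "A * \<mu> = \<mu> powr (1 - 1 / s) * N"
    proof -
      have "\<mu> powr (1 - 1 / s) = \<mu> powr 1 * \<mu> powr (- (1 / s))"
        using powr_add[of \<mu> 1 "- (1 / s)"] by (simp only: diff_conv_add_uminus)
      then show ?thesis using 4 by (simp add: A_def)
    qed
    finally show ?thesis .
  qed
  then show "(\<integral>x. norm (f x) \<partial>M) \<le> measure M (space M) powr (1 - 1 / s) * Lp_norm (ereal s) M f"
    by (simp add: N_def \<mu>_def)
qed

lemma finite_measure_lebesgue_on: "S \<in> lmeasurable \<Longrightarrow> finite_measure (lebesgue_on S)"
  by (auto simp: fmeasurable_def intro!: finite_measureI simp: emeasure_restrict_space)

lemma conj_exponent_cases:
  assumes "1 \<le> p"
  obtains "p = 1" "conj_exponent p = \<infinity>" | q where "1 < p" "1 < q" "q = p / (p - 1)" "conj_exponent p = ereal q" "1 / p + 1 / q = 1"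
proof (cases "p = 1")
  case False
  then have "1 < p / (p - 1)" "1 / p + 1 / (p / (p - 1)) = 1" using assms by (auto simp: field_simps)
  then show ?thesis using that(2) False assms by (simp add: conj_exponent_def)
qed (use that in \<open>auto simp: conj_exponent_def\<close>)

lemma Lp_space_subset:
  fixes f :: "'a::euclidean_space \<Rightarrow> 'b::euclidean_space"
  assumes "f \<in> Lp_space (ereal s) (lebesgue_on T)" "S \<in> sets lebesgue" "T \<in> sets lebesgue" "S \<subseteq> T" "0 < s"
  shows "f \<in> Lp_space (ereal s) (lebesgue_on S)"
    "Lp_norm (ereal s) (lebesgue_on S) f \<le> Lp_norm (ereal s) (lebesgue_on T) f"
proof -
  have fm: "f \<in> borel_measurable (lebesgue_on T)" and i: "integrable (lebesgue_on T) (\<lambda>x. norm (f x) powr s)"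
    using assms by (auto simp: Lp_space_ereal)
  have fm': "f \<in> borel_measurable (lebesgue_on S)"
    using measurable_restrict_mono[OF fm assms(4)] .
  have i': "integrable (lebesgue_on S) (\<lambda>x. norm (f x) powr s)"
    by (rule integrable_lebesgue_on_mono[OF i assms(2-4)])
  show "f \<in> Lp_space (ereal s) (lebesgue_on S)" using fm' i' by (simp add: Lp_space_ereal)
  have "(\<integral>x. norm (f x) powr s \<partial>lebesgue_on S) \<le> (\<integral>x. norm (f x) powr s \<partial>lebesgue_on T)"
    using assms i i' 
    by (auto simp: integral_restrict_space integrable_restrict_space indicator_def intro!: integral_mono)
  then show "Lp_norm (ereal s) (lebesgue_on S) f \<le> Lp_norm (ereal s) (lebesgue_on T) f"
    using assms(5) by (simp add: Lp_norm_ereal powr_mono2)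
qed

text \<open>Hoelder's inequality in the form in which it is applied to gradients: the factor
\<open>measure E powr (1/p)\<close> becomes \<open>s powr (n/p)\<close> when \<open>E\<close> is a box of size \<open>s\<close>. Also valid for \<open>p = 1\<close>, where
the conjugate exponent is infinite.\<close>

lemma integral_norm_le_conj_Lp_norm:
  fixes f :: "'a::euclidean_space \<Rightarrow> 'b::euclidean_space"
  assumes "1 \<le> p" "f \<in> Lp_space (conj_exponent p) (lebesgue_on \<Omega>)" "E \<in> lmeasurable" "E \<subseteq> \<Omega>"
    "\<Omega> \<in> sets lebesgue"
  shows "integrable (lebesgue_on E) f"
    and "L1_norm E f
      \<le> measure lebesgue E powr (1 / p) * Lp_norm (conj_exponent p) (lebesgue_on \<Omega>) f"
proof -
  interpret E: finite_measure "lebesgue_on E" by (rule finite_measure_lebesgue_on[OF assms(3)])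
  have EL: "E \<in> sets lebesgue" using assms(3) by blast
  have sp: "measure (lebesgue_on E) (space (lebesgue_on E)) = measure lebesgue E"
    using EL by (simp add: measure_restrict_space)
  have "integrable (lebesgue_on E) f \<and> L1_norm E f
      \<le> measure lebesgue E powr (1 / p) * Lp_norm (conj_exponent p) (lebesgue_on \<Omega>) f"
  proof (cases rule: conj_exponent_cases[OF assms(1)])
    case 1
    then have f: "f \<in> Lp_space \<infinity> (lebesgue_on \<Omega>)" using assms(2) by simp
    let ?N = "Lp_norm \<infinity> (lebesgue_on \<Omega>) f"
    have "AE x in lebesgue. x \<in> \<Omega> \<longrightarrow> norm (f x) \<le> ?N"
      using Lp_norm_infinity_AE(1)[OF f] assms(5) by (simp add: AE_restrict_space_iff)
    then have ae: "AE x in lebesgue_on E. norm (f x) \<le> ?N"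
      using assms(4) EL by (auto simp: AE_restrict_space_iff elim: eventually_mono)
    have fm: "f \<in> borel_measurable (lebesgue_on E)"
      by (rule measurable_restrict_mono[OF _ assms(4)]) (use f in \<open>simp add: Lp_space_def\<close>)
    have int: "integrable (lebesgue_on E) f"
      by (rule E.integrable_const_bound[OF ae fm])
    have "L1_norm E f \<le> (\<integral>x. ?N \<partial>lebesgue_on E)"
      by (rule integral_mono_AE) (use int ae in auto)
    then show ?thesis using int sp 1 by simp
  next
    case (2 q)
    have f: "f \<in> Lp_space (ereal q) (lebesgue_on \<Omega>)" using assms(2) 2 by simp
    note sub = Lp_space_subset[OF f EL assms(5,4)]
    have "L1_norm E f
      \<le> measure lebesgue E powr (1 - 1 / q) * Lp_norm (ereal q) (lebesgue_on E) f"
      using integral_norm_le_Lp_norm(2)[OF E.finite_measure_axioms sub(1)] 2 sp by simp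
    also have "\<dots> \<le> measure lebesgue E powr (1 - 1 / q) * Lp_norm (ereal q) (lebesgue_on \<Omega>) f"
      using sub(2) 2 by (intro mult_left_mono) auto
    also have "1 - 1 / q = 1 / p" using 2 by linarith
    finally show ?thesis
      using integral_norm_le_Lp_norm(1)[OF E.finite_measure_axioms sub(1)] 2 by simp
  qed
  then show "integrable (lebesgue_on E) f"
    and "L1_norm E f
      \<le> measure lebesgue E powr (1 / p) * Lp_norm (conj_exponent p) (lebesgue_on \<Omega>) f"
    by auto
qed

text \<open>The integrands of the Stokes bilinear forms are sums of such products, which makes the forms additive.\<close>

lemma integrable_mult_conj_exponent:
  fixes f g :: "'a \<Rightarrow> real"
  assumes "1 \<le> p" "f \<in> Lp_space (ereal p) M" "g \<in> Lp_space (conj_exponent p) M"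
  shows "integrable M (\<lambda>x. f x * g x)"
proof -
  have m[measurable]: "f \<in> borel_measurable M" "g \<in> borel_measurable M"
    using assms by (auto simp: Lp_space_def)
  have i: "integrable M (\<lambda>x. \<bar>f x\<bar> powr p)" using assms(2) by (simp add: Lp_space_ereal)
  show ?thesis
  proof (cases rule: conj_exponent_cases[OF assms(1)])
    case 1
    let ?N = "Lp_norm \<infinity> M g"
    have ae: "AE x in M. norm (g x) \<le> ?N" using Lp_norm_infinity_AE(1) 1 assms(3) by metis
    show ?thesis
    proof (rule Bochner_Integration.integrable_bound)
      show "integrable M (\<lambda>x. \<bar>f x\<bar> powr p * ?N)" using i by auto
      show "AE x in M. norm (f x * g x) \<le> norm (\<bar>f x\<bar> powr p * ?N)"
        using ae by eventually_elim (use 1 in \<open>auto simp: abs_mult intro!: mult_left_mono\<close>)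
    qed measurable
  next
    case (2 q)
    then have j: "integrable M (\<lambda>x. \<bar>g x\<bar> powr q)" using assms(3) by (simp add: Lp_space_ereal)
    show ?thesis
    proof (rule Bochner_Integration.integrable_bound)
      show "integrable M (\<lambda>x. \<bar>f x\<bar> powr p / p + \<bar>g x\<bar> powr q / q)" using i j by auto
      have "\<bar>f x\<bar> * \<bar>g x\<bar> \<le> \<bar>f x\<bar> powr p / p + \<bar>g x\<bar> powr q / q" for x
        using 2 by (intro Youngs_inequality) auto
      then show "AE x in M. norm (f x * g x) \<le> norm (\<bar>f x\<bar> powr p / p + \<bar>g x\<bar> powr q / q)"
        using 2 by (intro AE_I2) (simp add: abs_mult)
    qed measurable
  qed
qed

lemma Lp_space_component:
  fixes f :: "'a \<Rightarrow> real^'m"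
  assumes "f \<in> Lp_space s M" "0 \<le> s"
  shows "(\<lambda>x. f x $ j) \<in> Lp_space s M"
proof -
  have fm[measurable]: "f \<in> borel_measurable M" using assms by (simp add: Lp_space_def)
  have "continuous_on UNIV (\<lambda>x::real^'m. x $ j)" by (intro continuous_intros)
  then have cm: "(\<lambda>x. f x $ j) \<in> borel_measurable M"
    by (rule borel_measurable_continuous_on[OF _ fm])
  show ?thesis
  proof (cases "s = \<infinity>")
    case True
    then obtain C where "AE x in M. norm (f x) \<le> C" using assms by (auto simp: Lp_space_def)
    then have "AE x in M. norm (f x $ j) \<le> C"
      by eventually_elim (simp add: order_trans[OF component_le_norm_cart])
    then show ?thesis using True cm by (auto simp: Lp_space_def)
  next
    case False
    have "integrable M (\<lambda>x. norm (f x $ j) powr real_of_ereal s)"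
    proof (rule Bochner_Integration.integrable_bound)
      show "integrable M (\<lambda>x. norm (f x) powr real_of_ereal s)"
        using assms False by (simp add: Lp_space_def)
      show "(\<lambda>x. norm (f x $ j) powr real_of_ereal s) \<in> borel_measurable M" using cm by measurable
      show "AE x in M. norm (norm (f x $ j) powr real_of_ereal s) \<le> norm (norm (f x) powr real_of_ereal s)"
        using assms(2) by (intro AE_I2) (auto intro!: powr_mono2 component_le_norm_cart real_of_ereal_pos)
    qed
    then show ?thesis using False cm by (simp add: Lp_space_def)
  qed
qed

section \<open>Sobolev functions, zero traces and differences of Stokes solutions\<close>

lemma Lp_space_zero:
  "(\<lambda>x. 0 :: 'b::euclidean_space) \<in> Lp_space s M" "Lp_norm s M (\<lambda>x. 0 :: 'b) = 0"
proof -
  show "(\<lambda>x. 0 :: 'b) \<in> Lp_space s M" by (auto simp: Lp_space_def)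
  have "{C::real. 0 \<le> C \<and> (AE x in M. norm (0::'b) \<le> C)} = {0..}" by auto
  then show "Lp_norm s M (\<lambda>x. 0 :: 'b) = 0" by (simp add: Lp_norm_def)
qed

text \<open>The definition of the Sobolev space asks for some weak partial derivative in the Lebesgue space; by
uniqueness the chosen one has the same properties.\<close>

lemma sobolev_1_iff:
  assumes "open \<Omega>"
  shows "v \<in> sobolev 1 s \<Omega> \<longleftrightarrow> v \<in> Lp_space s (lebesgue_on \<Omega>) \<and>
    (\<forall>i. has_weak_partial \<Omega> i v (weak_partial \<Omega> i v) \<and> weak_partial \<Omega> i v \<in> Lp_space s (lebesgue_on \<Omega>))"
proof -
  have "has_weak_partial \<Omega> i v (weak_partial \<Omega> i v) \<and> weak_partial \<Omega> i v \<in> Lp_space s (lebesgue_on \<Omega>)"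
    if "has_weak_partial \<Omega> i v d" "d \<in> Lp_space s (lebesgue_on \<Omega>)" for i d
    using has_weak_partial_weak_partial[OF that(1)] assms
      Lp_space_AE_cong(1)[OF that(2) weak_partial_AE_eq[OF that(1) assms]] by simp
  then show ?thesis unfolding One_nat_def sobolev.simps mem_Collect_eq by blast
qed

lemma sobolev_norm_1_1:
  "sobolev_norm 1 1 \<Omega> v = L1_norm \<Omega> v
     + (\<Sum>i\<in>UNIV. L1_norm \<Omega> (weak_partial \<Omega> i v))"
  by (simp add: Lp_norm_1 sum_nonneg)

lemma Lp_norm_le_sobolev_norm:
  fixes v :: "real^'n \<Rightarrow> 'b::euclidean_space"
  assumes "1 \<le> p"
  shows "Lp_norm (conj_exponent p) (lebesgue_on \<Omega>) v \<le> sobolev_norm 1 (conj_exponent p) \<Omega> v" (is ?A)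
    and "Lp_norm (conj_exponent p) (lebesgue_on \<Omega>) (weak_partial \<Omega> i v) \<le> sobolev_norm 1 (conj_exponent p) \<Omega> v" (is ?B)
proof -
  have "?A \<and> ?B"
  proof (cases rule: conj_exponent_cases[OF assms])
    case 1
    then show ?thesis by (auto simp: le_max_iff_disj intro!: disjI2 Max_ge)
  next
    case (2 q)
    let ?L = "\<lambda>f :: real^'n \<Rightarrow> 'b. Lp_norm (ereal q) (lebesgue_on \<Omega>) f"
    have root: "a \<le> b powr (1 / q)" if "a powr q \<le> b" "0 \<le> a" for a b
    proof -
      have "(a powr q) powr (1 / q) \<le> b powr (1 / q)" using that 2 by (intro powr_mono2) auto
      then show ?thesis using that 2 by (simp add: powr_powr)
    qed
    have "?L (weak_partial \<Omega> i v) powr q \<le> (\<Sum>i\<in>UNIV. ?L (weak_partial \<Omega> i v) powr q)"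
      by (rule member_le_sum) auto
    then have "?L (weak_partial \<Omega> i v) powr q \<le> ?L v powr q + (\<Sum>i\<in>UNIV. ?L (weak_partial \<Omega> i v) powr q)"
      using powr_ge_zero[of "?L v" q] by linarith
    moreover have "?L v powr q \<le> ?L v powr q + (\<Sum>i\<in>UNIV. ?L (weak_partial \<Omega> i v) powr q)"
      by (simp add: sum_nonneg)
    ultimately have "?L v \<le> (?L v powr q + (\<Sum>i\<in>UNIV. ?L (weak_partial \<Omega> i v) powr q)) powr (1 / q)"
      "?L (weak_partial \<Omega> i v) \<le> (?L v powr q + (\<Sum>i\<in>UNIV. ?L (weak_partial \<Omega> i v) powr q)) powr (1 / q)"
      by (blast intro: root Lp_norm_ereal_nonneg)+
    then show ?thesis by (simp add: 2(4))
  qed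
  then show ?A ?B by auto
qed

lemma sobolev_1_diff:
  fixes v w :: "real^'n \<Rightarrow> 'b::euclidean_space"
  assumes "open \<Omega>" "v \<in> sobolev 1 (ereal s) \<Omega>" "w \<in> sobolev 1 (ereal s) \<Omega>" "0 \<le> s"
  shows "(\<lambda>x. v x - w x) \<in> sobolev 1 (ereal s) \<Omega>"
    and "AE x in lebesgue_on \<Omega>. weak_partial \<Omega> i v x - weak_partial \<Omega> i w x = weak_partial \<Omega> i (\<lambda>x. v x - w x) x"
proof -
  have v: "v \<in> Lp_space (ereal s) (lebesgue_on \<Omega>)" "\<And>i. has_weak_partial \<Omega> i v (weak_partial \<Omega> i v)"
      "\<And>i. weak_partial \<Omega> i v \<in> Lp_space (ereal s) (lebesgue_on \<Omega>)"
    and w: "w \<in> Lp_space (ereal s) (lebesgue_on \<Omega>)" "\<And>i. has_weak_partial \<Omega> i w (weak_partial \<Omega> i w)"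
      "\<And>i. weak_partial \<Omega> i w \<in> Lp_space (ereal s) (lebesgue_on \<Omega>)"
    using assms(2,3) unfolding sobolev_1_iff[OF assms(1)] by auto
  have wp: "has_weak_partial \<Omega> i (\<lambda>x. v x - w x) (\<lambda>x. weak_partial \<Omega> i v x - weak_partial \<Omega> i w x)" for i
    by (rule has_weak_partial_diff[OF v(2) w(2) assms(1)])
  show ae: "AE x in lebesgue_on \<Omega>. weak_partial \<Omega> i v x - weak_partial \<Omega> i w x = weak_partial \<Omega> i (\<lambda>x. v x - w x) x" for i
    by (rule weak_partial_AE_eq[OF wp assms(1)])
  have "weak_partial \<Omega> i (\<lambda>x. v x - w x) \<in> Lp_space (ereal s) (lebesgue_on \<Omega>)" for i
    using Lp_space_AE_cong(1)[OF Lp_space_diff[OF v(3) w(3) assms(4)] ae] assms(1) by simp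
  then show "(\<lambda>x. v x - w x) \<in> sobolev 1 (ereal s) \<Omega>"
    unfolding sobolev_1_iff[OF assms(1)]
    using Lp_space_diff[OF v(1) w(1) assms(4)] has_weak_partial_weak_partial[OF wp] by blast
qed

lemma sobolev_norm_1_1_diff_le:
  fixes v w :: "real^'n \<Rightarrow> 'b::euclidean_space"
  assumes "open \<Omega>" "v \<in> sobolev 1 1 \<Omega>" "w \<in> sobolev 1 1 \<Omega>"
  shows "sobolev_norm 1 1 \<Omega> (\<lambda>x. v x - w x) \<le> sobolev_norm 1 1 \<Omega> v + sobolev_norm 1 1 \<Omega> w"
proof -
  have v: "integrable (lebesgue_on \<Omega>) v" "\<And>i. integrable (lebesgue_on \<Omega>) (weak_partial \<Omega> i v)"
    and w: "integrable (lebesgue_on \<Omega>) w" "\<And>i. integrable (lebesgue_on \<Omega>) (weak_partial \<Omega> i w)"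
    using assms(2,3) unfolding sobolev_1_iff[OF assms(1)] Lp_space_1 by auto
  have tri: "L1_norm \<Omega> (\<lambda>x. f x - g x)
      \<le> L1_norm \<Omega> f + L1_norm \<Omega> g"
    if "integrable (lebesgue_on \<Omega>) f" "integrable (lebesgue_on \<Omega>) g" for f g :: "real^'n \<Rightarrow> 'b"
  proof -
    have "L1_norm \<Omega> (\<lambda>x. f x - g x) \<le> (\<integral>x. norm (f x) + norm (g x) \<partial>lebesgue_on \<Omega>)"
      using that by (intro integral_mono) (auto intro: norm_triangle_ineq4)
    then show ?thesis using that by simp
  qed
  have wp: "L1_norm \<Omega> (\<lambda>x. weak_partial \<Omega> i (\<lambda>x. v x - w x) x)
      = L1_norm \<Omega> (\<lambda>x. weak_partial \<Omega> i v x - weak_partial \<Omega> i w x)" for i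
  proof (rule integral_cong_AE)
    have ae: "AE x in lebesgue_on \<Omega>. weak_partial \<Omega> i v x - weak_partial \<Omega> i w x = weak_partial \<Omega> i (\<lambda>x. v x - w x) x"
      using sobolev_1_diff(2)[OF assms(1), of v 1 w i] assms(2,3) by (simp add: one_ereal_def)
    then show "AE x in lebesgue_on \<Omega>. norm (weak_partial \<Omega> i (\<lambda>x. v x - w x) x)
        = norm (weak_partial \<Omega> i v x - weak_partial \<Omega> i w x)"
      by eventually_elim simp
    have m: "(\<lambda>x. weak_partial \<Omega> i v x - weak_partial \<Omega> i w x) \<in> borel_measurable (lebesgue_on \<Omega>)"
      using v w by (intro borel_measurable_diff) auto
    then show "(\<lambda>x. norm (weak_partial \<Omega> i v x - weak_partial \<Omega> i w x)) \<in> borel_measurable (lebesgue_on \<Omega>)"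
      by measurable
    have "weak_partial \<Omega> i (\<lambda>x. v x - w x) \<in> borel_measurable (lebesgue_on \<Omega>)"
      by (rule borel_measurable_lebesgue_on_AE[OF m ae]) (use assms(1) in simp)
    then show "(\<lambda>x. norm (weak_partial \<Omega> i (\<lambda>x. v x - w x) x)) \<in> borel_measurable (lebesgue_on \<Omega>)"
      by measurable
  qed
  have "(\<Sum>i\<in>UNIV. L1_norm \<Omega> (\<lambda>x. weak_partial \<Omega> i v x - weak_partial \<Omega> i w x))
      \<le> (\<Sum>i\<in>UNIV. L1_norm \<Omega> (weak_partial \<Omega> i v)
            + L1_norm \<Omega> (weak_partial \<Omega> i w))"
    by (intro sum_mono tri v w)
  then show ?thesis
    unfolding sobolev_norm_1_1 wp using tri[OF v(1) w(1)] by (simp add: sum.distrib)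
qed

lemma sobolev_norm_1_1_nonneg: "0 \<le> sobolev_norm 1 1 \<Omega> v"
  unfolding sobolev_norm_1_1 by (intro add_nonneg_nonneg sum_nonneg) auto

lemma smooth_fun_diff:
  fixes f g :: "real^'n \<Rightarrow> 'b::euclidean_space"
  assumes "smooth_fun f" "smooth_fun g"
  shows "smooth_fun (\<lambda>x. f x - g x)"
proof -
  obtain D E where D: "D [] = f" "\<And>\<alpha> x. (D \<alpha> has_derivative (\<lambda>h. \<Sum>i\<in>UNIV. (h $ i) *\<^sub>R D (i # \<alpha>) x)) (at x)"
    and E: "E [] = g" "\<And>\<alpha> x. (E \<alpha> has_derivative (\<lambda>h. \<Sum>i\<in>UNIV. (h $ i) *\<^sub>R E (i # \<alpha>) x)) (at x)"
    using assms unfolding smooth_fun_def by blast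
  show ?thesis unfolding smooth_fun_def
  proof (intro exI[of _ "\<lambda>\<alpha> x. D \<alpha> x - E \<alpha> x"] conjI allI)
    show "((\<lambda>x. D \<alpha> x - E \<alpha> x) has_derivative
        (\<lambda>h. \<Sum>i\<in>UNIV. (h $ i) *\<^sub>R (D (i # \<alpha>) x - E (i # \<alpha>) x))) (at x)" for \<alpha> x
      by (rule has_derivative_eq_rhs[OF has_derivative_diff[OF D(2) E(2)]])
        (simp add: scaleR_diff_right sum_subtractf)
  qed (use D E in auto)
qed

lemma smooth_fun_zero: "smooth_fun (\<lambda>x::real^'n. 0 :: 'b::euclidean_space)"
  unfolding smooth_fun_def by (intro exI[of _ "\<lambda>_ _. 0"]) auto

lemma integrable_continuous_bounded_set:
  fixes f :: "'a::euclidean_space \<Rightarrow> 'b::euclidean_space"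
  assumes "continuous_on UNIV f" "bounded S" "S \<in> sets lebesgue"
  shows "integrable (lebesgue_on S) f"
proof -
  obtain a where a: "S \<subseteq> cbox (-a) a" using bounded_subset_cbox_symmetric[OF assms(2)] by blast
  have "f absolutely_integrable_on cbox (-a) a"
    by (intro absolutely_integrable_continuous continuous_on_subset[OF assms(1)]) auto
  then have "integrable (lebesgue_on (cbox (-a) a)) f"
    by (simp add: integrable_restrict_space set_integrable_def)
  then show ?thesis by (rule integrable_lebesgue_on_mono) (use a assms in auto)
qed

lemma smooth_fun_sobolev_1_1:
  fixes V :: "real^'n \<Rightarrow> 'b::euclidean_space"
  assumes "smooth_fun V" "open \<Omega>" "bounded \<Omega>"
  shows "V \<in> sobolev 1 1 \<Omega>"
proof -
  obtain P where P: "\<And>x. has_partials V P x"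
    "\<And>i. continuous_on UNIV (P i)" using smooth_fun_partials[OF assms(1)] by blast
  have "has_weak_partial \<Omega> i V (P i)" for i by (rule has_weak_partial_smooth[OF P assms(2)])
  moreover have "P i \<in> Lp_space 1 (lebesgue_on \<Omega>)" for i
    unfolding Lp_space_1 by (intro integrable_continuous_bounded_set P assms) (use assms(2) in simp)
  moreover have "V \<in> Lp_space 1 (lebesgue_on \<Omega>)"
    unfolding Lp_space_1
    by (intro integrable_continuous_bounded_set smooth_fun_continuous assms) (use assms(2) in simp)
  ultimately show ?thesis by (auto simp only: One_nat_def sobolev.simps mem_Collect_eq)
qed

lemma sets_hausdorff_measure: "sets (hausdorff_measure m :: 'a::metric_space measure) = sets borel"
  unfolding hausdorff_measure_def using sets.sigma_sets_eq[of "borel :: 'a measure"] by simp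

text \<open>Subtract the approximating sequences; both norms in the definition of the trace are subadditive.\<close>

lemma has_trace_zero_diff:
  fixes v w :: "real^'n \<Rightarrow> 'b::euclidean_space"
  assumes "has_trace \<Omega> v (\<lambda>x. 0)" "has_trace \<Omega> w (\<lambda>x. 0)" "open \<Omega>" "bounded \<Omega>"
  shows "has_trace \<Omega> (\<lambda>x. v x - w x) (\<lambda>x. 0)"
proof -
  let ?H = "hausdorff_measure (CARD('n) - 1) :: (real^'n) measure"
  obtain V W where V: "\<And>k::nat. smooth_fun (V k)" "(\<lambda>k. sobolev_norm 1 1 \<Omega> (\<lambda>x. V k x - v x)) \<longlonglongrightarrow> 0"
      "(\<lambda>k. \<integral>\<^sup>+x\<in>frontier \<Omega>. ennreal (norm (V k x - 0)) \<partial>?H) \<longlonglongrightarrow> 0"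
    and W: "\<And>k::nat. smooth_fun (W k)" "(\<lambda>k. sobolev_norm 1 1 \<Omega> (\<lambda>x. W k x - w x)) \<longlonglongrightarrow> 0"
      "(\<lambda>k. \<integral>\<^sup>+x\<in>frontier \<Omega>. ennreal (norm (W k x - 0)) \<partial>?H) \<longlonglongrightarrow> 0"
    and vw: "v \<in> sobolev 1 1 \<Omega>" "w \<in> sobolev 1 1 \<Omega>"
    using assms(1,2) unfolding has_trace_def by blast
  have d: "(\<lambda>x. f x - g x) \<in> sobolev 1 1 \<Omega>" if "f \<in> sobolev 1 1 \<Omega>" "g \<in> sobolev 1 1 \<Omega>" for f g :: "real^'n \<Rightarrow> 'b"
    using sobolev_1_diff(1)[OF assms(3), of f 1 g] that by (simp add: one_ereal_def)
  have Vv: "(\<lambda>x. V k x - v x) \<in> sobolev 1 1 \<Omega>" "(\<lambda>x. W k x - w x) \<in> sobolev 1 1 \<Omega>" for k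
    by (intro d vw smooth_fun_sobolev_1_1 V W assms)+
  have "(\<lambda>k. sobolev_norm 1 1 \<Omega> (\<lambda>x. V k x - W k x - (v x - w x))) \<longlonglongrightarrow> 0"
  proof (rule tendsto_sandwich[of "\<lambda>k. 0"])
    have "(\<lambda>x. V k x - W k x - (v x - w x)) = (\<lambda>x. (V k x - v x) - (W k x - w x))" for k
      by (simp add: algebra_simps)
    then show "\<forall>\<^sub>F k in sequentially. sobolev_norm 1 1 \<Omega> (\<lambda>x. V k x - W k x - (v x - w x))
        \<le> sobolev_norm 1 1 \<Omega> (\<lambda>x. V k x - v x) + sobolev_norm 1 1 \<Omega> (\<lambda>x. W k x - w x)"
      using sobolev_norm_1_1_diff_le[OF assms(3) Vv] by (intro always_eventually allI) (simp only:)
    show "(\<lambda>k. sobolev_norm 1 1 \<Omega> (\<lambda>x. V k x - v x) + sobolev_norm 1 1 \<Omega> (\<lambda>x. W k x - w x)) \<longlonglongrightarrow> 0"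
      using tendsto_add[OF V(2) W(2)] by (simp only: add_0)
    show "\<forall>\<^sub>F k in sequentially. 0 \<le> sobolev_norm 1 1 \<Omega> (\<lambda>x. V k x - W k x - (v x - w x))"
      by (intro always_eventually allI sobolev_norm_1_1_nonneg)
  qed simp
  moreover have "(\<lambda>k. \<integral>\<^sup>+x\<in>frontier \<Omega>. ennreal (norm (V k x - W k x - 0)) \<partial>?H) \<longlonglongrightarrow> 0"
  proof (rule tendsto_sandwich[of "\<lambda>k. 0"])
    have meas: "(\<lambda>x. ennreal (norm (f x - 0)) * indicator (frontier \<Omega>) x) \<in> borel_measurable ?H"
      if "smooth_fun f" for f :: "real^'n \<Rightarrow> 'b"
    proof -
      have "f \<in> borel_measurable borel"
        by (rule borel_measurable_continuous_onI[OF smooth_fun_continuous[OF that]])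
      then have "(\<lambda>x. ennreal (norm (f x - 0)) * indicator (frontier \<Omega>) x) \<in> borel_measurable borel"
        by measurable
      then show ?thesis using measurable_cong_sets[OF sets_hausdorff_measure refl] by blast
    qed
    have "(\<integral>\<^sup>+x\<in>frontier \<Omega>. ennreal (norm (V k x - W k x - 0)) \<partial>?H)
        \<le> (\<integral>\<^sup>+x. ennreal (norm (V k x - 0)) * indicator (frontier \<Omega>) x + ennreal (norm (W k x - 0)) * indicator (frontier \<Omega>) x \<partial>?H)" for k
      by (intro nn_integral_mono)
        (auto simp: indicator_def norm_triangle_ineq4 simp flip: ennreal_plus intro!: ennreal_leI)
    then show "\<forall>\<^sub>F k in sequentially. (\<integral>\<^sup>+x\<in>frontier \<Omega>. ennreal (norm (V k x - W k x - 0)) \<partial>?H)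
        \<le> (\<integral>\<^sup>+x\<in>frontier \<Omega>. ennreal (norm (V k x - 0)) \<partial>?H) + (\<integral>\<^sup>+x\<in>frontier \<Omega>. ennreal (norm (W k x - 0)) \<partial>?H)"
      using nn_integral_add[OF meas[OF V(1)] meas[OF W(1)]] by simp
    show "(\<lambda>k. (\<integral>\<^sup>+x\<in>frontier \<Omega>. ennreal (norm (V k x - 0)) \<partial>?H) + (\<integral>\<^sup>+x\<in>frontier \<Omega>. ennreal (norm (W k x - 0)) \<partial>?H)) \<longlonglongrightarrow> 0"
      using tendsto_add[OF V(3) W(3)] by (simp only: add_0)
  qed simp_all
  moreover have "\<forall>k. smooth_fun (\<lambda>x. V k x - W k x)" using smooth_fun_diff V(1) W(1) by blast
  ultimately show ?thesis
    unfolding has_trace_def using d[OF vw]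
    by (intro conjI exI[of _ "\<lambda>k x. V k x - W k x"]) auto
qed

lemma sobolev0_diff:
  fixes v w :: "real^'n \<Rightarrow> 'b::euclidean_space"
  assumes "v \<in> sobolev0 (ereal s) \<Omega>" "w \<in> sobolev0 (ereal s) \<Omega>" "open \<Omega>" "bounded \<Omega>" "0 \<le> s"
  shows "(\<lambda>x. v x - w x) \<in> sobolev0 (ereal s) \<Omega>"
  using assms sobolev_1_diff(1) has_trace_zero_diff unfolding sobolev0_def by blast

lemma zero_in_sobolev0:
  fixes \<Omega> :: "(real^'n) set"
  assumes "open \<Omega>"
  shows "(\<lambda>x. 0 :: 'b::euclidean_space) \<in> sobolev0 s \<Omega>" "sobolev_norm 1 s \<Omega> (\<lambda>x. 0 :: 'b) = 0"
proof -
  let ?z = "\<lambda>x :: real^'n. 0 :: 'b"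
  have wp: "has_weak_partial \<Omega> i ?z ?z" for i
    by (rule has_weak_partial_smooth[of _ "\<lambda>i x. 0"]) (use assms in auto)
  have Om: "\<Omega> \<in> sets lebesgue" using assms by simp
  have N: "Lp_norm s (lebesgue_on \<Omega>) (weak_partial \<Omega> i ?z) = 0" for i s
    using Lp_space_AE_cong(2)[OF Lp_space_zero(1) weak_partial_AE_eq[OF wp assms] Om] Lp_space_zero(2) by metis
  have sn: "sobolev_norm 1 s \<Omega> ?z = 0" for s
  proof -
    have "Max (range (\<lambda>i::'n. 0::real)) = 0" by (simp add: image_constant_conv)
    then show ?thesis by (simp add: N Lp_space_zero(2))
  qed
  have s1: "?z \<in> sobolev 1 s \<Omega>" for s
    using wp Lp_space_zero(1) by (auto simp only: One_nat_def sobolev.simps mem_Collect_eq)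
  have "has_trace \<Omega> ?z (\<lambda>x. 0)"
    unfolding has_trace_def
    by (intro conjI s1 exI[of _ "\<lambda>k. ?z"]) (use smooth_fun_zero in \<open>simp_all add: sn del: One_nat_def\<close>)
  then show "?z \<in> sobolev0 s \<Omega>" using s1 by (simp add: sobolev0_def)
  show "sobolev_norm 1 s \<Omega> ?z = 0" by (rule sn)
qed

text \<open>The definition of the trace contains an approximation by functions that are smooth on the whole space.
It is unfolded here into \<open>L\<^sup>1\<close> convergence of the functions and of their classical partial
derivatives, the form in which estimates for smooth functions pass to \<open>v\<close>.\<close>

lemma sobolev0_smooth_approximation:
  fixes v :: "real^'n \<Rightarrow> 'b::euclidean_space"
  assumes "v \<in> sobolev0 s \<Omega>" "open \<Omega>" "bounded \<Omega>"
  obtains V :: "nat \<Rightarrow> real^'n \<Rightarrow> 'b" and P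
  where "\<And>k x. has_partials (V k) (P k) x"
    "\<And>k i. continuous_on UNIV (P k i)"
    "integrable (lebesgue_on \<Omega>) v" "\<And>i. integrable (lebesgue_on \<Omega>) (weak_partial \<Omega> i v)"
    "(\<lambda>k. L1_norm \<Omega> (\<lambda>x. V k x - v x)) \<longlonglongrightarrow> 0"
    "\<And>i. (\<lambda>k. L1_norm \<Omega> (\<lambda>x. P k i x - weak_partial \<Omega> i v x)) \<longlonglongrightarrow> 0"
proof -
  obtain V where V: "\<And>k::nat. smooth_fun (V k)" "(\<lambda>k. sobolev_norm 1 1 \<Omega> (\<lambda>x. V k x - v x)) \<longlonglongrightarrow> 0"
    and v: "v \<in> sobolev 1 1 \<Omega>"
    using assms(1) unfolding sobolev0_def has_trace_def by blast
  have "\<exists>P. (\<forall>x. has_partials (V k) P x) \<and>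
      (\<forall>i. continuous_on UNIV (P i))" for k
    by (rule smooth_fun_partials[OF V(1)[of k]]) (intro exI conjI allI, assumption+)
  then obtain P where "\<forall>k. (\<forall>x. has_partials (V k) (P k) x) \<and>
      (\<forall>i. continuous_on UNIV (P k i))"
    using choice[of "\<lambda>k P. (\<forall>x. has_partials (V k) P x) \<and>
      (\<forall>i. continuous_on UNIV (P i))"] by blast
  then have P: "\<And>k x. has_partials (V k) (P k) x"
    "\<And>k i. continuous_on UNIV (P k i)" by blast+
  have vi: "integrable (lebesgue_on \<Omega>) v" "integrable (lebesgue_on \<Omega>) (weak_partial \<Omega> i v)"
    and wpv: "has_weak_partial \<Omega> i v (weak_partial \<Omega> i v)" for i
    using v unfolding sobolev_1_iff[OF assms(2)] Lp_space_1 by auto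
  have Om: "\<Omega> \<in> sets lebesgue" using assms by simp
  have Pi: "integrable (lebesgue_on \<Omega>) (P k i)" for k i
    by (rule integrable_continuous_bounded_set[OF P(2) assms(3) Om])
  have wpV: "L1_norm \<Omega> (\<lambda>x. weak_partial \<Omega> i (\<lambda>x. V k x - v x) x)
      = L1_norm \<Omega> (\<lambda>x. P k i x - weak_partial \<Omega> i v x)" for k i
  proof -
    have "has_weak_partial \<Omega> i (\<lambda>x. V k x - v x) (\<lambda>x. P k i x - weak_partial \<Omega> i v x)"
      by (intro has_weak_partial_diff has_weak_partial_smooth P wpv assms)
    from weak_partial_AE_eq[OF this assms(2)]
    have "Lp_norm 1 (lebesgue_on \<Omega>) (weak_partial \<Omega> i (\<lambda>x. V k x - v x))
        = Lp_norm 1 (lebesgue_on \<Omega>) (\<lambda>x. P k i x - weak_partial \<Omega> i v x)"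
      by (rule Lp_space_AE_cong(2)[rotated]) (use Om Pi vi in \<open>auto simp: Lp_space_1\<close>)
    then show ?thesis by (simp add: Lp_norm_1)
  qed
  have norm_eq: "sobolev_norm 1 1 \<Omega> (\<lambda>x. V k x - v x) = L1_norm \<Omega> (\<lambda>x. V k x - v x)
     + (\<Sum>i\<in>UNIV. L1_norm \<Omega> (\<lambda>x. P k i x - weak_partial \<Omega> i v x))" for k
    unfolding sobolev_norm_1_1 wpV ..
  have nn: "0 \<le> L1_norm \<Omega> f" for f :: "real^'n \<Rightarrow> 'b" by simp
  have c1: "(\<lambda>k. L1_norm \<Omega> (\<lambda>x. V k x - v x)) \<longlonglongrightarrow> 0"
    by (rule tendsto_sandwich[OF _ _ tendsto_const V(2)])
      (auto simp: norm_eq intro!: always_eventually sum_nonneg simp del: One_nat_def)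
  have c2: "(\<lambda>k. L1_norm \<Omega> (\<lambda>x. P k i x - weak_partial \<Omega> i v x)) \<longlonglongrightarrow> 0" for i
  proof (rule tendsto_sandwich[OF _ _ tendsto_const V(2)])
    show "\<forall>\<^sub>F k in sequentially. L1_norm \<Omega> (\<lambda>x. P k i x - weak_partial \<Omega> i v x)
      \<le> sobolev_norm 1 1 \<Omega> (\<lambda>x. V k x - v x)"
    proof (intro always_eventually allI)
      fix k
      have "L1_norm \<Omega> (\<lambda>x. P k i x - weak_partial \<Omega> i v x)
          \<le> (\<Sum>i\<in>UNIV. L1_norm \<Omega> (\<lambda>x. P k i x - weak_partial \<Omega> i v x))"
        by (rule member_le_sum) auto
      then show "L1_norm \<Omega> (\<lambda>x. P k i x - weak_partial \<Omega> i v x)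
          \<le> sobolev_norm 1 1 \<Omega> (\<lambda>x. V k x - v x)"
        unfolding norm_eq using nn[of "\<lambda>x. V k x - v x"] by linarith
    qed
  qed simp
  show ?thesis by (rule that[OF P vi c1 c2])
qed

lemma Lp_space_sum2:
  fixes f g :: "'a \<Rightarrow> 'b::euclidean_space"
  assumes "1 \<le> p" "f \<in> Lp_space (ereal p) M" "g \<in> Lp_space (ereal p) M"
  shows "(\<lambda>x. f x + g x) \<in> Lp_space (ereal p) M"
proof -
  have "(\<lambda>x. - g x) \<in> Lp_space (ereal p) M" using assms by (simp add: Lp_space_ereal)
  from Lp_space_diff[OF assms(2) this] show ?thesis using assms(1) by simp
qed

lemma conj_exponent_nonneg: "1 \<le> p \<Longrightarrow> 0 \<le> conj_exponent p"
  by (auto simp: conj_exponent_def)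

lemma weak_partial_component_Lp:
  fixes v :: "real^'n \<Rightarrow> real^'n"
  assumes "v \<in> sobolev 1 s \<Omega>" "open \<Omega>" "0 \<le> s"
  shows "(\<lambda>x. weak_partial \<Omega> i v x $ j) \<in> Lp_space s (lebesgue_on \<Omega>)"
  using assms(1) Lp_space_component[OF _ assms(3)] unfolding sobolev_1_iff[OF assms(2)] by blast

text \<open>The Stokes problem is linear. What has to be checked is that each form is an integral of an integrable
function and that the chosen weak derivatives of the difference agree almost everywhere with the
differences of the chosen ones.\<close>

lemma stokes_weak_solution_diff:
  fixes u w :: "real^'n \<Rightarrow> real^'n"
  assumes "stokes_weak_solution \<nu> p \<Omega> g u \<pi>" "stokes_weak_solution \<nu> p \<Omega> h w \<rho>"
    "open \<Omega>" "bounded \<Omega>" "1 \<le> p"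
  shows "stokes_weak_solution \<nu> p \<Omega> (\<lambda>v. g v - h v) (\<lambda>x. u x - w x) (\<lambda>x. \<pi> x - \<rho> x)"
proof -
  have u: "u \<in> sobolev0 (ereal p) \<Omega>" "\<pi> \<in> Lp0_space (ereal p) \<Omega>"
      "\<And>v. v \<in> sobolev0 (conj_exponent p) \<Omega> \<Longrightarrow> stokes_a \<nu> \<Omega> u v + stokes_b \<Omega> \<pi> v = g v"
      "\<And>q. q \<in> Lp0_space (conj_exponent p) \<Omega> \<Longrightarrow> stokes_b \<Omega> q u = 0"
    and w: "w \<in> sobolev0 (ereal p) \<Omega>" "\<rho> \<in> Lp0_space (ereal p) \<Omega>"
      "\<And>v. v \<in> sobolev0 (conj_exponent p) \<Omega> \<Longrightarrow> stokes_a \<nu> \<Omega> w v + stokes_b \<Omega> \<rho> v = h v"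
      "\<And>q. q \<in> Lp0_space (conj_exponent p) \<Omega> \<Longrightarrow> stokes_b \<Omega> q w = 0"
    using assms(1,2) unfolding stokes_weak_solution_def by blast+
  have p0: "0 \<le> p" using assms(5) by simp
  have us: "u \<in> sobolev 1 (ereal p) \<Omega>" "w \<in> sobolev 1 (ereal p) \<Omega>"
    using u(1) w(1) by (simp_all add: sobolev0_def)
  have \<pi>: "\<pi> \<in> Lp_space (ereal p) (lebesgue_on \<Omega>)" "(\<integral>x. \<pi> x \<partial>lebesgue_on \<Omega>) = 0"
    and \<rho>: "\<rho> \<in> Lp_space (ereal p) (lebesgue_on \<Omega>)" "(\<integral>x. \<rho> x \<partial>lebesgue_on \<Omega>) = 0"
    using u(2) w(2) by (auto simp: Lp0_space_def)
  have fin: "finite_measure (lebesgue_on \<Omega>)"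
    using assms(3,4) by (intro finite_measure_lebesgue_on lmeasurable_open) auto
  let ?d = "\<lambda>x. u x - w x"
  let ?wp = "\<lambda>i v x j. weak_partial \<Omega> i v x $ j"
  have uL: "(\<lambda>x. ?wp i u x j) \<in> Lp_space (ereal p) (lebesgue_on \<Omega>)"
    "(\<lambda>x. ?wp i w x j) \<in> Lp_space (ereal p) (lebesgue_on \<Omega>)" 
    "(\<lambda>x. ?wp i ?d x j) \<in> Lp_space (ereal p) (lebesgue_on \<Omega>)" for i j
    using weak_partial_component_Lp[OF _ assms(3), of _ "ereal p"] us p0
      sobolev_1_diff(1)[OF assms(3) us p0] by auto
  have "AE x in lebesgue_on \<Omega>. \<forall>i. weak_partial \<Omega> i u x - weak_partial \<Omega> i w x = weak_partial \<Omega> i ?d x"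
    using sobolev_1_diff(2)[OF assms(3) us p0] by (intro eventually_all_finite) auto
  then have ae: "AE x in lebesgue_on \<Omega>. \<forall>i j. ?wp i ?d x j = ?wp i u x j - ?wp i w x j"
    by eventually_elim (metis vector_minus_component)
  have mul: "integrable (lebesgue_on \<Omega>) (\<lambda>x. f x * g x)" 
    if "f \<in> Lp_space (ereal p) (lebesgue_on \<Omega>)" "g \<in> Lp_space (conj_exponent p) (lebesgue_on \<Omega>)"
    for f g :: "real^'n \<Rightarrow> real"
    using integrable_mult_conj_exponent[OF assms(5) that] .
  have A: "stokes_a \<nu> \<Omega> ?d v = stokes_a \<nu> \<Omega> u v - stokes_a \<nu> \<Omega> w v"
    and B: "stokes_b \<Omega> (\<lambda>x. \<pi> x - \<rho> x) v = stokes_b \<Omega> \<pi> v - stokes_b \<Omega> \<rho> v"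
    if v: "v \<in> sobolev0 (conj_exponent p) \<Omega>" for v
  proof -
    have vL: "(\<lambda>x. ?wp i v x j) \<in> Lp_space (conj_exponent p) (lebesgue_on \<Omega>)" for i j
      using weak_partial_component_Lp[OF _ assms(3) conj_exponent_nonneg[OF assms(5)]] v
      by (auto simp: sobolev0_def)
    let ?E = "\<lambda>z x. \<Sum>i\<in>UNIV. \<Sum>j\<in>UNIV. (?wp i z x j + ?wp j z x i) * (?wp i v x j + ?wp j v x i)"
    have E: "integrable (lebesgue_on \<Omega>) (?E z)"
      if "\<And>i j. (\<lambda>x. ?wp i z x j) \<in> Lp_space (ereal p) (lebesgue_on \<Omega>)" for z
      unfolding distrib_left
      by (intro Bochner_Integration.integrable_sum Bochner_Integration.integrable_add mul
          Lp_space_sum2 that vL assms(5))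
    have "(\<integral>x. ?E ?d x \<partial>lebesgue_on \<Omega>) = (\<integral>x. ?E u x - ?E w x \<partial>lebesgue_on \<Omega>)"
    proof (rule integral_cong_AE)
      show "AE x in lebesgue_on \<Omega>. ?E ?d x = ?E u x - ?E w x"
        using ae
      proof eventually_elim
        case (elim x)
        show ?case unfolding elim[rule_format] by (simp flip: sum_subtractf add: algebra_simps)
      qed
    qed (use E uL in auto)
    also have "\<dots> = (\<integral>x. ?E u x \<partial>lebesgue_on \<Omega>) - (\<integral>x. ?E w x \<partial>lebesgue_on \<Omega>)"
      by (intro Bochner_Integration.integral_diff E uL)
    finally show "stokes_a \<nu> \<Omega> ?d v = stokes_a \<nu> \<Omega> u v - stokes_a \<nu> \<Omega> w v"
      unfolding stokes_a_def by (simp add: right_diff_distrib)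
    have i: "integrable (lebesgue_on \<Omega>) (\<lambda>x. \<pi> x * (\<Sum>i\<in>UNIV. ?wp i v x i))"
      "integrable (lebesgue_on \<Omega>) (\<lambda>x. \<rho> x * (\<Sum>i\<in>UNIV. ?wp i v x i))"
      unfolding sum_distrib_left by (intro Bochner_Integration.integrable_sum mul \<pi> \<rho> vL)+
    show "stokes_b \<Omega> (\<lambda>x. \<pi> x - \<rho> x) v = stokes_b \<Omega> \<pi> v - stokes_b \<Omega> \<rho> v"
      unfolding stokes_b_def using i by (simp add: left_diff_distrib)
  qed
  have C: "stokes_b \<Omega> q ?d = 0" if q: "q \<in> Lp0_space (conj_exponent p) \<Omega>" for q
  proof -
    have qL: "q \<in> Lp_space (conj_exponent p) (lebesgue_on \<Omega>)" using q by (simp add: Lp0_space_def)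
    have i: "integrable (lebesgue_on \<Omega>) (\<lambda>x. q x * (\<Sum>i\<in>UNIV. ?wp i z x i))"
      if "\<And>i j. (\<lambda>x. ?wp i z x j) \<in> Lp_space (ereal p) (lebesgue_on \<Omega>)" for z
      unfolding sum_distrib_left
      by (subst mult.commute) (intro Bochner_Integration.integrable_sum mul qL that)
    have "(\<integral>x. q x * (\<Sum>i\<in>UNIV. ?wp i ?d x i) \<partial>lebesgue_on \<Omega>)
        = (\<integral>x. q x * (\<Sum>i\<in>UNIV. ?wp i u x i) - q x * (\<Sum>i\<in>UNIV. ?wp i w x i) \<partial>lebesgue_on \<Omega>)"
    proof (rule integral_cong_AE)
      show "AE x in lebesgue_on \<Omega>. q x * (\<Sum>i\<in>UNIV. ?wp i ?d x i)
          = q x * (\<Sum>i\<in>UNIV. ?wp i u x i) - q x * (\<Sum>i\<in>UNIV. ?wp i w x i)"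
        using ae
      proof eventually_elim
        case (elim x)
        show ?case unfolding elim[rule_format] by (simp add: sum_subtractf right_diff_distrib)
      qed
    qed (use i uL in auto)
    also have "\<dots> = (\<integral>x. q x * (\<Sum>i\<in>UNIV. ?wp i u x i) \<partial>lebesgue_on \<Omega>)
        - (\<integral>x. q x * (\<Sum>i\<in>UNIV. ?wp i w x i) \<partial>lebesgue_on \<Omega>)"
      by (intro Bochner_Integration.integral_diff i uL)
    finally show ?thesis using u(4)[OF q] w(4)[OF q] unfolding stokes_b_def by simp
  qed
  have "(\<lambda>x. \<pi> x - \<rho> x) \<in> Lp0_space (ereal p) \<Omega>"
    unfolding Lp0_space_def
    using Lp_space_diff[OF \<pi>(1) \<rho>(1) p0] \<pi>(2) \<rho>(2)
      integral_norm_le_Lp_norm(1)[OF fin \<pi>(1) assms(5)] integral_norm_le_Lp_norm(1)[OF fin \<rho>(1) assms(5)]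
    by simp
  moreover have "stokes_a \<nu> \<Omega> ?d v + stokes_b \<Omega> (\<lambda>x. \<pi> x - \<rho> x) v = g v - h v"
    if "v \<in> sobolev0 (conj_exponent p) \<Omega>" for v
    using A[OF that] B[OF that] u(3)[OF that] w(3)[OF that] by linarith
  ultimately show ?thesis
    unfolding stokes_weak_solution_def
    using sobolev0_diff[OF u(1) w(1) assms(3,4) p0] C by blast
qed

section \<open>Averages over dilated boxes\<close>

text \<open>For a kernel \<open>k\<close> of mass \<open>1\<close> this is the average of \<open>v\<close> at scale \<open>s\<close> about \<open>x\<close>. The variable
is scaled so that the domain of integration does not depend on \<open>s\<close>, as differentiation in \<open>s\<close> under the
integral sign requires.\<close>

definition kernel_avg ::
    "(real^'n \<Rightarrow> real) \<Rightarrow> real^'n \<Rightarrow> real^'n \<Rightarrow> (real^'n \<Rightarrow> 'b::euclidean_space) \<Rightarrow> real^'n \<Rightarrow> real \<Rightarrow> 'b" where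
  "kernel_avg k a b v x s = integral (cbox a b) (\<lambda>z. k z *\<^sub>R v (x + s *\<^sub>R z))"

abbreviation dilated_box :: "real^'n \<Rightarrow> real^'n \<Rightarrow> real^'n \<Rightarrow> real \<Rightarrow> (real^'n) set" where
  "dilated_box a b x s \<equiv> cbox (x + s *\<^sub>R a) (x + s *\<^sub>R b)"

lemma mem_dilated_box: "z \<in> cbox a b \<Longrightarrow> 0 < s \<Longrightarrow> x + s *\<^sub>R z \<in> dilated_box a b x s"
  by (simp add: mem_box_cart)

lemma integrable_lebesgue_on_cbox_iff:
  fixes f :: "'a::euclidean_space \<Rightarrow> 'b::euclidean_space"
  shows "integrable (lebesgue_on (cbox a b)) f \<longleftrightarrow> f absolutely_integrable_on cbox a b"
  by (simp add: integrable_restrict_space set_integrable_def)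

lemma integral_norm_lebesgue_on_mono:
  fixes f :: "'a::euclidean_space \<Rightarrow> 'b::euclidean_space"
  assumes "integrable (lebesgue_on T) f" "S \<subseteq> T" "T \<in> sets lebesgue" "S \<in> sets lebesgue"
  shows "L1_norm S f \<le> L1_norm T f"
proof -
  have "integrable (lebesgue_on T) (\<lambda>x. norm (f x))" "integrable (lebesgue_on S) (\<lambda>x. norm (f x))"
    using assms integrable_lebesgue_on_mono[OF assms(1,4,3,2)] by auto
  then show ?thesis using assms(2-4)
    by (auto simp: integral_restrict_space integrable_restrict_space indicator_def intro!: integral_mono)
qed

lemma has_integral_dilation:
  fixes f :: "real^'n \<Rightarrow> 'b::euclidean_space"
  assumes "(f has_integral I) (dilated_box a b x s)" "0 < s"
  shows "((\<lambda>z. f (x + s *\<^sub>R z)) has_integral (I /\<^sub>R s ^ CARD('n))) (cbox a b)"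
proof -
  have "((\<lambda>z. f (s *\<^sub>R z + x)) has_integral (I /\<^sub>R s ^ DIM(real^'n)))
      (cbox ((x + s *\<^sub>R a - x) /\<^sub>R s) ((x + s *\<^sub>R b - x) /\<^sub>R s))"
    by (rule has_integral_affinity'[OF assms])
  then show ?thesis using assms(2) by (simp add: add.commute)
qed

lemma absolutely_integrable_dilation:
  fixes f :: "real^'n \<Rightarrow> 'b::euclidean_space"
  assumes "f absolutely_integrable_on dilated_box a b x s" "0 < s"
  shows "(\<lambda>z. f (x + s *\<^sub>R z)) absolutely_integrable_on cbox a b"
    and "integral (cbox a b) (\<lambda>z. norm (f (x + s *\<^sub>R z)))
      = integral (dilated_box a b x s) (\<lambda>y. norm (f y)) / s ^ CARD('n)"
proof -
  have f: "(f has_integral integral (dilated_box a b x s) f) (dilated_box a b x s)"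
    and nf: "((\<lambda>y. norm (f y)) has_integral integral (dilated_box a b x s) (\<lambda>y. norm (f y))) (dilated_box a b x s)"
    using assms(1) by (auto simp: absolutely_integrable_on_def intro: integrable_integral)
  show "(\<lambda>z. f (x + s *\<^sub>R z)) absolutely_integrable_on cbox a b"
    using has_integral_dilation[OF f assms(2)] has_integral_dilation[OF nf assms(2)]
    by (auto simp: absolutely_integrable_on_def integrable_on_def)
  show "integral (cbox a b) (\<lambda>z. norm (f (x + s *\<^sub>R z)))
      = integral (dilated_box a b x s) (\<lambda>y. norm (f y)) / s ^ CARD('n)"
    using integral_unique[OF has_integral_dilation[OF nf assms(2)]] by (simp add: divide_inverse mult.commute)
qed

lemma content_dilated_box:
  fixes a b x :: "real^'n"
  assumes "0 < s"
  shows "measure lebesgue (dilated_box a b x s) = s ^ CARD('n) * measure lborel (cbox a b)"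
proof -
  have "((\<lambda>y. 1) has_integral measure lborel (dilated_box a b x s)) (dilated_box a b x s)"
    using has_integral_const[of "1::real"] by simp
  from has_integral_dilation[OF this assms]
  have "measure lborel (cbox a b) = measure lborel (dilated_box a b x s) /\<^sub>R s ^ CARD('n)"
    by (rule has_integral_unique[rotated]) (use has_integral_const[of "1::real" a b] in simp)
  then show ?thesis using assms by (simp add: field_simps)
qed

lemma dilated_box_subset_cball:
  fixes a b x :: "real^'n" and L s :: real
  assumes "\<And>z i. z \<in> cbox a b \<Longrightarrow> \<bar>z $ i\<bar> \<le> L" "0 < s"
  shows "dilated_box a b x s \<subseteq> cball x (s * (CARD('n) * L))"
proof
  fix y assume y: "y \<in> dilated_box a b x s"
  define z where "z = (y - x) /\<^sub>R s"
  have yz: "y = x + s *\<^sub>R z" using assms(2) by (simp add: z_def)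
  then have "z \<in> cbox a b" using y assms(2) by (simp add: mem_box_cart)
  then have "\<bar>z $ i\<bar> \<le> L" for i using assms(1) by blast
  then have "(\<Sum>i\<in>UNIV. \<bar>z $ i\<bar>) \<le> CARD('n) * L" 
    using sum_bounded_above[of "UNIV :: 'n set" "\<lambda>i. \<bar>z $ i\<bar>" L] by simp
  then have "norm z \<le> CARD('n) * L" using norm_le_l1_cart[of z] by linarith
  then show "y \<in> cball x (s * (CARD('n) * L))" using assms(2) by (simp add: yz dist_norm)
qed

text \<open>For fixed \<open>s > 0\<close> the average depends continuously on \<open>v\<close> in the \<open>L\<^sup>1\<close> norm. This allows passing to
limits of smooth functions, at the price of the factor \<open>s\<^sup>-\<^sup>n\<close>.\<close>

lemma kernel_avg_bound:
  fixes f :: "real^'n \<Rightarrow> 'b::euclidean_space"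
  assumes "integrable (lebesgue_on \<Omega>) f" "\<Omega> \<in> sets lebesgue" "dilated_box a b x s \<subseteq> \<Omega>" "0 < s"
    and "continuous_on (cbox a b) k" "\<And>z. z \<in> cbox a b \<Longrightarrow> \<bar>k z\<bar> \<le> B" "0 \<le> B"
  shows "(\<lambda>z. k z *\<^sub>R f (x + s *\<^sub>R z)) absolutely_integrable_on cbox a b"
    and "norm (kernel_avg k a b f x s) \<le> B / s ^ CARD('n) * L1_norm (dilated_box a b x s) f"
    and "norm (kernel_avg k a b f x s) \<le> B / s ^ CARD('n) * L1_norm \<Omega> f"
proof -
  have fQ: "integrable (lebesgue_on (dilated_box a b x s)) f"
    by (rule integrable_lebesgue_on_mono[OF assms(1) _ assms(2,3)]) simp
  note d = absolutely_integrable_dilation[OF fQ[unfolded integrable_lebesgue_on_cbox_iff] assms(4)]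
  have bil: "bilinear (\<lambda>(r::real) (v::'b). r *\<^sub>R v)" by (simp add: bilinear_def linear_iff algebra_simps)
  show ai: "(\<lambda>z. k z *\<^sub>R f (x + s *\<^sub>R z)) absolutely_integrable_on cbox a b"
    using assms(6)
    by (intro absolutely_integrable_bounded_measurable_product[OF bil _ _ _ d(1)]
        continuous_imp_measurable_on_sets_lebesgue assms(5)) (auto intro!: boundedI[of _ B])
  have "norm (kernel_avg k a b f x s) \<le> integral (cbox a b) (\<lambda>z. B * norm (f (x + s *\<^sub>R z)))"
    unfolding kernel_avg_def
  proof (rule Henstock_Kurzweil_Integration.integral_norm_bound_integral)
    show "(\<lambda>z. k z *\<^sub>R f (x + s *\<^sub>R z)) integrable_on cbox a b"
      using ai by (simp add: absolutely_integrable_on_def)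
    show "(\<lambda>z. B * norm (f (x + s *\<^sub>R z))) integrable_on cbox a b"
      using d(1) by (intro integrable_on_mult_right) (simp add: absolutely_integrable_on_def)
    show "norm (k z *\<^sub>R f (x + s *\<^sub>R z)) \<le> B * norm (f (x + s *\<^sub>R z))" if "z \<in> cbox a b" for z
      using assms(6)[OF that] by (simp add: mult_right_mono)
  qed
  also have "\<dots> = B / s ^ CARD('n) * integral (dilated_box a b x s) (\<lambda>y. norm (f y))"
    by (simp add: d(2))
  also have "integral (dilated_box a b x s) (\<lambda>y. norm (f y)) = L1_norm (dilated_box a b x s) f"
    by (rule lebesgue_integral_eq_integral[symmetric]) (use fQ in auto)
  finally show *: "norm (kernel_avg k a b f x s) \<le> B / s ^ CARD('n) * L1_norm (dilated_box a b x s) f" .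
  have "L1_norm (dilated_box a b x s) f \<le> L1_norm \<Omega> f"
    by (intro integral_norm_lebesgue_on_mono assms) simp
  then have "B / s ^ CARD('n) * L1_norm (dilated_box a b x s) f
      \<le> B / s ^ CARD('n) * L1_norm \<Omega> f"
    using assms(4,7) by (intro mult_left_mono) auto
  with * show "norm (kernel_avg k a b f x s) \<le> B / s ^ CARD('n) * L1_norm \<Omega> f"
    by linarith
qed

lemma kernel_avg_diff:
  fixes f g :: "real^'n \<Rightarrow> 'b::euclidean_space"
  assumes "integrable (lebesgue_on \<Omega>) f" "integrable (lebesgue_on \<Omega>) g" "\<Omega> \<in> sets lebesgue"
    "dilated_box a b x s \<subseteq> \<Omega>" "0 < s"
    and "continuous_on (cbox a b) k" "\<And>z. z \<in> cbox a b \<Longrightarrow> \<bar>k z\<bar> \<le> B" "0 \<le> B"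
  shows "kernel_avg k a b (\<lambda>y. f y - g y) x s = kernel_avg k a b f x s - kernel_avg k a b g x s"
  unfolding kernel_avg_def scaleR_diff_right
  using kernel_avg_bound(1)[OF assms(1,3-8)] kernel_avg_bound(1)[OF assms(2,3-8)]
  by (intro Henstock_Kurzweil_Integration.integral_diff) (simp_all add: absolutely_integrable_on_def)

lemma kernel_avg_has_vector_derivative:
  fixes V :: "real^'n \<Rightarrow> 'b::euclidean_space"
  assumes V: "\<And>x. has_partials V P x"
    and P: "\<And>i. continuous_on UNIV (P i)" and k: "continuous_on (cbox a b) k"
  shows "((\<lambda>s. kernel_avg k a b V x s) has_vector_derivative
    integral (cbox a b) (\<lambda>z. k z *\<^sub>R (\<Sum>i\<in>UNIV. (z $ i) *\<^sub>R P i (x + s *\<^sub>R z)))) (at s)"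
proof -
  have V': "continuous_on UNIV V" by (rule has_derivative_continuous_on) (use V in auto)
  have "((\<lambda>s. integral (cbox a b) (\<lambda>z. k z *\<^sub>R V (x + s *\<^sub>R z))) has_vector_derivative
    integral (cbox a b) (\<lambda>z. k z *\<^sub>R (\<Sum>i\<in>UNIV. (z $ i) *\<^sub>R P i (x + s *\<^sub>R z)))) (at s within UNIV)"
  proof (rule leibniz_rule_vector_derivative)
    fix s z
    have "((\<lambda>s. x + s *\<^sub>R z) has_derivative (\<lambda>h. h *\<^sub>R z)) (at s)"
      by (auto intro!: derivative_eq_intros)
    from has_derivative_compose[OF this V]
    have "((\<lambda>s. V (x + s *\<^sub>R z)) has_derivative (\<lambda>h. \<Sum>i\<in>UNIV. ((h *\<^sub>R z) $ i) *\<^sub>R P i (x + s *\<^sub>R z))) (at s)" .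
    then have "((\<lambda>s. V (x + s *\<^sub>R z)) has_vector_derivative (\<Sum>i\<in>UNIV. (z $ i) *\<^sub>R P i (x + s *\<^sub>R z))) (at s)"
      by (simp add: has_vector_derivative_def scaleR_sum_right)
    then have "((\<lambda>s. k z *\<^sub>R V (x + s *\<^sub>R z)) has_vector_derivative
        k z *\<^sub>R (\<Sum>i\<in>UNIV. (z $ i) *\<^sub>R P i (x + s *\<^sub>R z))) (at s)"
      using has_vector_derivative_scaleR[OF DERIV_const, of "\<lambda>s. V (x + s *\<^sub>R z)" _ s UNIV "k z"] by simp
    then show "((\<lambda>s. k z *\<^sub>R V (x + s *\<^sub>R z)) has_vector_derivative
        k z *\<^sub>R (\<Sum>i\<in>UNIV. (z $ i) *\<^sub>R P i (x + s *\<^sub>R z))) (at s within UNIV)" by simp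
  next
    show "(\<lambda>z. k z *\<^sub>R V (x + s *\<^sub>R z)) integrable_on cbox a b" for s
      by (intro integrable_continuous continuous_on_scaleR k continuous_on_compose2[OF V'] continuous_intros) auto
    show "continuous_on (UNIV \<times> cbox a b)
        (\<lambda>(s, z). k z *\<^sub>R (\<Sum>i\<in>UNIV. (z $ i) *\<^sub>R P i (x + s *\<^sub>R z)))"
      unfolding case_prod_beta
      by (intro continuous_on_scaleR continuous_on_sum continuous_on_compose2[OF k] continuous_on_compose2[OF P]
          continuous_intros) auto
  qed auto
  then show ?thesis by (simp add: kernel_avg_def)
qed

text \<open>A function \<open>v\<close> with derivatives \<open>d\<close> that is a limit in \<open>W\<^sup>1\<^sup>,\<^sup>1(\<Omega>)\<close> of \<open>C\<^sup>1\<close> functions \<open>V\<close>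
with partial derivatives \<open>P\<close>. The bound \<open>growth\<close> is what Hoelder's inequality gives for
derivatives whose norms in the conjugate Lebesgue space add up to at most \<open>N\<close>, and \<open>\<alpha>\<close> is the
resulting Hoelder exponent.\<close>

locale w11_limit =
  fixes \<Omega> :: "(real^'n) set" and v :: "real^'n \<Rightarrow> 'b::euclidean_space" and d :: "'n \<Rightarrow> real^'n \<Rightarrow> 'b"
    and V :: "nat \<Rightarrow> real^'n \<Rightarrow> 'b" and P :: "nat \<Rightarrow> 'n \<Rightarrow> real^'n \<Rightarrow> 'b"
    and p N \<alpha> :: real
  assumes open_dom: "open \<Omega>" and bounded_dom: "bounded \<Omega>"
    and V_deriv: "\<And>j x. has_partials (V j) (P j) x"
    and P_cont: "\<And>j i. continuous_on UNIV (P j i)"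
    and v_int: "integrable (lebesgue_on \<Omega>) v" and d_int: "\<And>i. integrable (lebesgue_on \<Omega>) (d i)"
    and V_lim: "(\<lambda>j. L1_norm \<Omega> (\<lambda>x. V j x - v x)) \<longlonglongrightarrow> 0"
    and P_lim: "\<And>i. (\<lambda>j. L1_norm \<Omega> (\<lambda>x. P j i x - d i x)) \<longlonglongrightarrow> 0"
    and p_pos: "0 < p" and N_nonneg: "0 \<le> N"
    and \<alpha>_def: "\<alpha> = 1 - real CARD('n) + real CARD('n) / p" and \<alpha>_pos: "0 < \<alpha>"
    and growth: "\<And>E. E \<in> lmeasurable \<Longrightarrow> E \<subseteq> \<Omega> \<Longrightarrow>
      (\<Sum>i\<in>UNIV. L1_norm E (d i)) \<le> measure lebesgue E powr (1 / p) * N"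
begin

lemma meas_dom: "\<Omega> \<in> sets lebesgue" using open_dom by simp

lemma V_cont: "continuous_on UNIV (V j)"
  by (rule has_derivative_continuous_on) (use V_deriv in auto)

lemma V_int: "integrable (lebesgue_on \<Omega>) (V j)"
  by (rule integrable_continuous_bounded_set[OF V_cont bounded_dom meas_dom])

lemma P_int: "integrable (lebesgue_on \<Omega>) (P j i)"
  by (rule integrable_continuous_bounded_set[OF P_cont bounded_dom meas_dom])

text \<open>The integral of \<open>|d|\<close> over a box of size \<open>s\<close> is of order \<open>s powr (n/p)\<close>, and the substitution divides by
\<open>s\<^sup>n\<close>; this leaves the exponent \<open>\<alpha> - 1\<close>. The second summand is the error of the approximation.\<close>

lemma integral_partial_dilated_box_le:
  assumes "dilated_box a b x s \<subseteq> \<Omega>" "0 < s"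
  shows "(\<Sum>i\<in>UNIV. integral (cbox a b) (\<lambda>z. norm (P j i (x + s *\<^sub>R z))))
    \<le> measure lborel (cbox a b) powr (1 / p) * N * s powr (\<alpha> - 1)
      + (\<Sum>i\<in>UNIV. L1_norm \<Omega> (\<lambda>y. P j i y - d i y)) / s ^ CARD('n)"
proof -
  let ?Q = "dilated_box a b x s"
  have sub: "integrable (lebesgue_on ?Q) f" if "integrable (lebesgue_on \<Omega>) f" for f :: "real^'n \<Rightarrow> 'b"
    by (rule integrable_lebesgue_on_mono[OF that _ meas_dom assms(1)]) simp
  have "integral (cbox a b) (\<lambda>z. norm (P j i (x + s *\<^sub>R z)))
     \<le> L1_norm ?Q (d i) / s ^ CARD('n)
       + L1_norm \<Omega> (\<lambda>y. P j i y - d i y) / s ^ CARD('n)" for i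
  proof -
    have "integral (cbox a b) (\<lambda>z. norm (P j i (x + s *\<^sub>R z)))
        = integral ?Q (\<lambda>y. norm (P j i y)) / s ^ CARD('n)"
      using absolutely_integrable_dilation(2) sub[OF P_int] assms(2) integrable_lebesgue_on_cbox_iff by blast
    also have "integral ?Q (\<lambda>y. norm (P j i y)) = L1_norm ?Q (P j i)"
      by (rule lebesgue_integral_eq_integral[symmetric]) (use sub[OF P_int] in auto)
    also have "\<dots> \<le> (\<integral>y. norm (d i y) + norm (P j i y - d i y) \<partial>lebesgue_on ?Q)"
      using sub[OF P_int[of j i]] sub[OF d_int[of i]] norm_triangle_sub
      by (intro integral_mono) (auto simp: add.commute)
    also have "\<dots> = L1_norm ?Q (d i) + L1_norm ?Q (\<lambda>y. P j i y - d i y)"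
      using sub[OF P_int[of j i]] sub[OF d_int[of i]] by simp
    also have "L1_norm ?Q (\<lambda>y. P j i y - d i y) \<le> L1_norm \<Omega> (\<lambda>y. P j i y - d i y)"
      using P_int d_int by (intro integral_norm_lebesgue_on_mono assms meas_dom) auto
    finally show ?thesis using assms(2) by (simp add: add_divide_distrib[symmetric] divide_right_mono)
  qed
  then have "(\<Sum>i\<in>UNIV. integral (cbox a b) (\<lambda>z. norm (P j i (x + s *\<^sub>R z))))
    \<le> (\<Sum>i\<in>UNIV. L1_norm ?Q (d i) / s ^ CARD('n)
       + L1_norm \<Omega> (\<lambda>y. P j i y - d i y) / s ^ CARD('n))"
    by (rule sum_mono)
  also have "\<dots> = (\<Sum>i\<in>UNIV. L1_norm ?Q (d i)) / s ^ CARD('n)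
      + (\<Sum>i\<in>UNIV. L1_norm \<Omega> (\<lambda>y. P j i y - d i y)) / s ^ CARD('n)"
    by (simp add: sum.distrib sum_divide_distrib)
  also have "(\<Sum>i\<in>UNIV. L1_norm ?Q (d i)) / s ^ CARD('n)
      \<le> (measure lebesgue ?Q powr (1 / p) * N) / s ^ CARD('n)"
    using assms growth[of ?Q] by (intro divide_right_mono) auto
  also have "(measure lebesgue ?Q powr (1 / p) * N) / s ^ CARD('n)
      = measure lborel (cbox a b) powr (1 / p) * N * s powr (\<alpha> - 1)"
  proof -
    have "measure lebesgue ?Q powr (1 / p) = s powr (real CARD('n) / p) * measure lborel (cbox a b) powr (1 / p)"
      unfolding content_dilated_box[OF assms(2)]
      using assms(2) by (simp add: powr_mult powr_powr flip: powr_realpow)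
    moreover have "s powr (\<alpha> - 1) = s powr (real CARD('n) / p) / s ^ CARD('n)"
      using assms(2) by (simp add: \<alpha>_def powr_diff flip: powr_realpow)
    ultimately show ?thesis by simp
  qed
  finally show ?thesis by simp
qed

text \<open>The heart of the argument. For the \<open>C\<^sup>1\<close> function \<open>V j\<close> the average is differentiable in \<open>s\<close>, and its derivative
is bounded by that of \<open>C * s powr \<alpha>\<close> up to a constant multiple of \<open>\<eta> j\<close>; the mean value inequality
integrates this from \<open>r\<close> to \<open>t\<close>. As \<open>r > 0\<close> is fixed, the error terms disappear in the limit.\<close>

lemma kernel_avg_increment:
  assumes k: "continuous_on (cbox a b) k" "\<And>z. z \<in> cbox a b \<Longrightarrow> \<bar>k z\<bar> \<le> B" "0 \<le> B"
    and L: "\<And>z i. z \<in> cbox a b \<Longrightarrow> \<bar>z $ i\<bar> \<le> L" "0 \<le> L"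
    and r: "0 < r" "r < t" "\<And>s. r \<le> s \<Longrightarrow> s \<le> t \<Longrightarrow> dilated_box a b x s \<subseteq> \<Omega>"
  defines "C \<equiv> B * L * (measure lborel (cbox a b) powr (1 / p) * N) / \<alpha>"
  shows "norm (kernel_avg k a b v x t - kernel_avg k a b v x r) \<le> C * (t powr \<alpha> - r powr \<alpha>)"
proof -
  define \<eta> where "\<eta> j = (\<Sum>i\<in>UNIV. L1_norm \<Omega> (\<lambda>y. P j i y - d i y))" for j
  define H where "H = measure lborel (cbox a b) powr (1 / p) * N"
  have \<eta>0: "0 \<le> \<eta> j" for j by (simp add: \<eta>_def sum_nonneg)
  have \<eta>: "\<eta> \<longlonglongrightarrow> 0" unfolding \<eta>_def using tendsto_sum[of UNIV, OF P_lim] by simp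
  have step: "norm (kernel_avg k a b (V j) x t - kernel_avg k a b (V j) x r)
      \<le> C * (t powr \<alpha> - r powr \<alpha>) + B * L * \<eta> j / r ^ CARD('n) * (t - r)" for j
  proof -
    \<comment> \<open>The derivative of the majorant bounds that of the average on \<open>[r, t]\<close>, where
      \<open>s\<^sup>-\<^sup>n \<le> r\<^sup>-\<^sup>n\<close>.\<close>
    let ?\<phi> = "\<lambda>s. C * s powr \<alpha> + B * L * \<eta> j / r ^ CARD('n) * s"
    let ?D = "\<lambda>s. integral (cbox a b) (\<lambda>z. k z *\<^sub>R (\<Sum>i\<in>UNIV. (z $ i) *\<^sub>R P j i (x + s *\<^sub>R z)))"
    have "norm (kernel_avg k a b (V j) x t - kernel_avg k a b (V j) x r) \<le> ?\<phi> t - ?\<phi> r"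
    proof (rule differentiable_bound_general[OF r(2)])
      have der: "((\<lambda>s. kernel_avg k a b (V j) x s) has_vector_derivative ?D s) (at s)" for s
        by (rule kernel_avg_has_vector_derivative[OF V_deriv P_cont k(1)])
      then show "\<And>s. r < s \<Longrightarrow> s < t \<Longrightarrow> ((\<lambda>s. kernel_avg k a b (V j) x s) has_vector_derivative ?D s) (at s)" .
      show "continuous_on {r..t} (\<lambda>s. kernel_avg k a b (V j) x s)"
        by (intro continuous_at_imp_continuous_on ballI has_vector_derivative_continuous[OF der])
      show "continuous_on {r..t} ?\<phi>" using r by (auto intro!: continuous_intros)
      fix s assume s: "r < s" "s < t"
      have "((\<lambda>s. C * s powr \<alpha> + B * L * \<eta> j / r ^ CARD('n) * s) has_real_derivative
          (B * L * H * s powr (\<alpha> - 1) + B * L * \<eta> j / r ^ CARD('n))) (at s)"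
        using s r \<alpha>_pos by (auto intro!: derivative_eq_intros simp: C_def H_def)
      then show "(?\<phi> has_vector_derivative
          (B * L * H * s powr (\<alpha> - 1) + B * L * \<eta> j / r ^ CARD('n))) (at s)"
        by (simp add: has_real_derivative_iff_has_vector_derivative)
      have s0: "0 < s" using s r by simp
      have ci: "(\<lambda>z. norm (P j i (x + s *\<^sub>R z))) integrable_on cbox a b" for i
        by (intro integrable_continuous continuous_on_norm continuous_on_compose2[OF P_cont] continuous_intros) auto
      have "norm (?D s) \<le> integral (cbox a b) (\<lambda>z. \<Sum>i\<in>UNIV. B * L * norm (P j i (x + s *\<^sub>R z)))"
      proof (rule Henstock_Kurzweil_Integration.integral_norm_bound_integral)
        show "(\<lambda>z. k z *\<^sub>R (\<Sum>i\<in>UNIV. (z $ i) *\<^sub>R P j i (x + s *\<^sub>R z))) integrable_on cbox a b"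
          by (intro integrable_continuous continuous_on_scaleR continuous_on_sum k continuous_on_compose2[OF P_cont]
              continuous_intros) auto
        show "(\<lambda>z. \<Sum>i\<in>UNIV. B * L * norm (P j i (x + s *\<^sub>R z))) integrable_on cbox a b"
          by (intro integrable_sum integrable_on_mult_right ci) auto
        fix z assume z: "z \<in> cbox a b"
        have "norm (k z *\<^sub>R (\<Sum>i\<in>UNIV. (z $ i) *\<^sub>R P j i (x + s *\<^sub>R z)))
            \<le> \<bar>k z\<bar> * (\<Sum>i\<in>UNIV. norm ((z $ i) *\<^sub>R P j i (x + s *\<^sub>R z)))"
          by (subst norm_scaleR) (intro mult_left_mono norm_sum abs_ge_zero)
        also have "\<dots> \<le> B * (\<Sum>i\<in>UNIV. L * norm (P j i (x + s *\<^sub>R z)))"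
          using k(2)[OF z] k(3) L(1)[OF z]
          by (intro mult_mono sum_mono sum_nonneg) (auto intro!: mult_right_mono)
        finally show "norm (k z *\<^sub>R (\<Sum>i\<in>UNIV. (z $ i) *\<^sub>R P j i (x + s *\<^sub>R z)))
            \<le> (\<Sum>i\<in>UNIV. B * L * norm (P j i (x + s *\<^sub>R z)))"
          by (simp add: sum_distrib_left mult.assoc)
      qed
      also have "\<dots> = (\<Sum>i\<in>UNIV. B * L * integral (cbox a b) (\<lambda>z. norm (P j i (x + s *\<^sub>R z))))"
        using ci by (subst Henstock_Kurzweil_Integration.integral_sum) (auto intro: integrable_on_mult_right)
      also have "\<dots> = B * L * (\<Sum>i\<in>UNIV. integral (cbox a b) (\<lambda>z. norm (P j i (x + s *\<^sub>R z))))"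
        by (simp add: sum_distrib_left)
      also have "\<dots> \<le> B * L * (H * s powr (\<alpha> - 1) + \<eta> j / s ^ CARD('n))"
        using integral_partial_dilated_box_le[OF r(3) s0, of j] s k(3) L(2)
        by (intro mult_left_mono) (auto simp: H_def \<eta>_def)
      also have "\<dots> \<le> B * L * (H * s powr (\<alpha> - 1) + \<eta> j / r ^ CARD('n))"
        using s r(1) k(3) L(2) \<eta>0[of j]
        by (intro mult_left_mono add_left_mono divide_left_mono power_mono mult_nonneg_nonneg mult_pos_pos) auto
      finally show "norm (?D s) \<le> B * L * H * s powr (\<alpha> - 1) + B * L * \<eta> j / r ^ CARD('n)"
        by (simp add: algebra_simps)
    qed
    then show ?thesis by (simp only: right_diff_distrib)
  qed
  have lim: "(\<lambda>j. kernel_avg k a b (V j) x s) \<longlonglongrightarrow> kernel_avg k a b v x s" if s: "r \<le> s" "s \<le> t" for s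
  proof (rule LIM_zero_cancel, rule Lim_null_comparison)
    have s0: "0 < s" using s r by simp
    show "\<forall>\<^sub>F j in sequentially. norm (kernel_avg k a b (V j) x s - kernel_avg k a b v x s)
        \<le> B / s ^ CARD('n) * L1_norm \<Omega> (\<lambda>x. V j x - v x)"
    proof (intro always_eventually allI)
      fix j
      have "kernel_avg k a b (\<lambda>y. V j y - v y) x s = kernel_avg k a b (V j) x s - kernel_avg k a b v x s"
        by (rule kernel_avg_diff[OF V_int v_int meas_dom r(3)[OF s] s0 k])
      then show "norm (kernel_avg k a b (V j) x s - kernel_avg k a b v x s)
        \<le> B / s ^ CARD('n) * L1_norm \<Omega> (\<lambda>x. V j x - v x)"
        using kernel_avg_bound(3)[OF Bochner_Integration.integrable_diff[OF V_int v_int] meas_dom r(3)[OF s] s0 k, of j] by simp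
    qed
    show "(\<lambda>j. B / s ^ CARD('n) * L1_norm \<Omega> (\<lambda>x. V j x - v x)) \<longlonglongrightarrow> 0"
      using tendsto_mult_left[OF V_lim, of "B / s ^ CARD('n)"] by simp
  qed
  have "(\<lambda>j. norm (kernel_avg k a b (V j) x t - kernel_avg k a b (V j) x r))
      \<longlonglongrightarrow> norm (kernel_avg k a b v x t - kernel_avg k a b v x r)"
    using r by (intro tendsto_intros lim) auto
  moreover have "(\<lambda>j. C * (t powr \<alpha> - r powr \<alpha>) + B * L * \<eta> j / r ^ CARD('n) * (t - r))
      \<longlonglongrightarrow> C * (t powr \<alpha> - r powr \<alpha>) + B * L * 0 / r ^ CARD('n) * (t - r)"
    using r(1) by (intro tendsto_intros \<eta>) auto
  ultimately have "norm (kernel_avg k a b v x t - kernel_avg k a b v x r)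
      \<le> C * (t powr \<alpha> - r powr \<alpha>) + B * L * 0 / r ^ CARD('n) * (t - r)"
    by (rule LIMSEQ_le) (use step in auto)
  then show ?thesis by simp
qed

end

section \<open>Hoelder estimates and continuous representatives\<close>

lemma unit_cube_component: "z \<in> cbox 0 (One :: real^'n) \<Longrightarrow> \<bar>z $ i\<bar> \<le> 1"
proof -
  assume z: "z \<in> cbox 0 (One :: real^'n)"
  have b: "axis i 1 \<in> (Basis :: (real^'n) set)" by (auto simp: Basis_vec_def)
  then have "0 \<le> z \<bullet> axis i 1" "z \<bullet> axis i 1 \<le> One \<bullet> (axis i 1 :: real^'n)"
    using z by (auto simp: mem_box)
  moreover have "One \<bullet> (axis i 1 :: real^'n) = 1" using b by simp
  moreover have "z \<bullet> axis i 1 = z $ i" by (simp add: inner_axis)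
  ultimately show ?thesis by simp
qed

context w11_limit begin

lemma kernel_avg_minus_limit:
  assumes k: "continuous_on (cbox a b) k" "\<And>z. z \<in> cbox a b \<Longrightarrow> \<bar>k z\<bar> \<le> B" "0 \<le> B"
    and L: "\<And>z i. z \<in> cbox a b \<Longrightarrow> \<bar>z $ i\<bar> \<le> L" "0 \<le> L"
    and t: "0 < t" "\<And>s. 0 < s \<Longrightarrow> s \<le> t \<Longrightarrow> dilated_box a b x s \<subseteq> \<Omega>"
    and r: "\<And>j. 0 < r j" "r \<longlonglongrightarrow> 0" "(\<lambda>j. kernel_avg k a b v x (r j)) \<longlonglongrightarrow> l"
  shows "norm (kernel_avg k a b v x t - l)
    \<le> B * L * (measure lborel (cbox a b) powr (1 / p) * N) / \<alpha> * t powr \<alpha>"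
proof -
  obtain J where J: "\<And>j. J \<le> j \<Longrightarrow> r j < t"
    using order_tendstoD(2)[OF r(2) t(1)] unfolding eventually_sequentially by blast
  show ?thesis
  proof (rule Lim_bounded[of "\<lambda>j. norm (kernel_avg k a b v x t - kernel_avg k a b v x (r j))"])
    show "(\<lambda>j. norm (kernel_avg k a b v x t - kernel_avg k a b v x (r j)))
        \<longlonglongrightarrow> norm (kernel_avg k a b v x t - l)"
      by (intro tendsto_intros r)
    show "\<forall>j\<ge>J. norm (kernel_avg k a b v x t - kernel_avg k a b v x (r j))
        \<le> B * L * (measure lborel (cbox a b) powr (1 / p) * N) / \<alpha> * t powr \<alpha>"
    proof (intro allI impI)
      fix j assume j: "J \<le> j"
      let ?C = "B * L * (measure lborel (cbox a b) powr (1 / p) * N) / \<alpha>"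
      have "norm (kernel_avg k a b v x t - kernel_avg k a b v x (r j)) \<le> ?C * (t powr \<alpha> - r j powr \<alpha>)"
        by (rule kernel_avg_increment[OF k L r(1) J[OF j]]) (use t(2) r(1)[of j] in auto)
      also have "\<dots> \<le> ?C * t powr \<alpha>"
        using k(3) L(2) N_nonneg \<alpha>_pos by (intro mult_left_mono) auto
      finally show "norm (kernel_avg k a b v x t - kernel_avg k a b v x (r j)) \<le> ?C * t powr \<alpha>" .
    qed
  qed
qed

lemma continuous_on_unit_cube_avg:
  assumes "0 < s" "\<And>x. x \<in> S \<Longrightarrow> dilated_box 0 One x s \<subseteq> \<Omega>"
  shows "continuous_on S (\<lambda>x. kernel_avg (\<lambda>_. 1) 0 One v x s)"
proof (rule uniform_limit_theorem)
  let ?A = "\<lambda>v x. kernel_avg (\<lambda>_. 1) 0 One v x s"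
  show "\<forall>\<^sub>F j in sequentially. continuous_on S (?A (V j))"
  proof (intro always_eventually allI)
    fix j
    have "continuous_on (S \<times> cbox 0 One) (\<lambda>(x, z). V j (x + s *\<^sub>R z))"
      unfolding case_prod_beta by (intro continuous_on_compose2[OF V_cont] continuous_intros) auto
    then show "continuous_on S (?A (V j))"
      unfolding kernel_avg_def by (simp add: integral_continuous_on_param)
  qed
  show "uniform_limit S (\<lambda>j. ?A (V j)) (?A v) sequentially"
  proof (rule uniform_limitI)
    fix e :: real assume "0 < e"
    have "(\<lambda>j. 1 / s ^ CARD('n) * L1_norm \<Omega> (\<lambda>x. V j x - v x)) \<longlonglongrightarrow> 0"
      using tendsto_mult_left[OF V_lim, of "1 / s ^ CARD('n)"] by simp
    from order_tendstoD(2)[OF this \<open>0 < e\<close>]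
    show "\<forall>\<^sub>F j in sequentially. \<forall>x\<in>S. dist (?A (V j) x) (?A v x) < e"
    proof eventually_elim
      case (elim j)
      show ?case
      proof
        fix x assume x: "x \<in> S"
        have "?A (\<lambda>y. V j y - v y) x = ?A (V j) x - ?A v x"
          by (rule kernel_avg_diff[OF V_int v_int meas_dom assms(2)[OF x] assms(1), of _ 1]) auto
        moreover have "norm (?A (\<lambda>y. V j y - v y) x) \<le> 1 / s ^ CARD('n) * L1_norm \<Omega> (\<lambda>x. V j x - v x)"
          by (rule kernel_avg_bound(3)[OF Bochner_Integration.integrable_diff[OF V_int v_int] meas_dom
                assms(2)[OF x] assms(1), of _ 1]) auto
        ultimately show "dist (?A (V j) x) (?A v x) < e" using elim by (simp add: dist_norm)
      qed
    qed
  qed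
qed simp

text \<open>Lebesgue's differentiation theorem for cubes with corner at \<open>x\<close>, applied to \<open>v\<close> continued by \<open>0\<close>.\<close>

lemma unit_cube_avg_tendsto_AE:
  "AE x in lebesgue_on \<Omega>. (\<lambda>j. kernel_avg (\<lambda>_. 1) 0 One v x (inverse (real (Suc j)))) \<longlonglongrightarrow> v x"
proof -
  define f where "f x = (if x \<in> \<Omega> then v x else 0)" for x
  have "v integrable_on \<Omega>" by (rule integrable_on_lebesgue_on[OF v_int meas_dom])
  then have "f integrable_on UNIV" unfolding f_def using integrable_restrict_UNIV by blast
  then have "f integrable_on cbox u w" for u w by (rule integrable_on_subcbox) simp
  then obtain Z where Z: "negligible Z" and avg: "\<And>x e. \<lbrakk>x \<notin> Z; 0 < e\<rbrakk> \<Longrightarrow>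
      \<exists>\<delta>>0. \<forall>h. 0 < h \<and> h < \<delta> \<longrightarrow>
        norm (integral (cbox x (x + h *\<^sub>R One)) f /\<^sub>R h ^ DIM(real^'n) - f x) < e"
    using integrable_ccontinuous_explicit[of f] by blast
  have "(\<lambda>j. kernel_avg (\<lambda>_. 1) 0 One v x (inverse (real (Suc j)))) \<longlonglongrightarrow> v x" if x: "x \<in> \<Omega>" "x \<notin> Z" for x
  proof -
    let ?h = "\<lambda>j. inverse (real (Suc j))"
    obtain \<rho> where \<rho>: "0 < \<rho>" "cball x \<rho> \<subseteq> \<Omega>" using open_dom x(1) open_contains_cball by blast
    have eq: "kernel_avg (\<lambda>_. 1) 0 One v x h = integral (cbox x (x + h *\<^sub>R One)) f /\<^sub>R h ^ DIM(real^'n)"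
      if h: "0 < h" "h * (real CARD('n) * 1) \<le> \<rho>" for h :: real
    proof -
      have "dilated_box 0 One x h \<subseteq> cball x (h * (real CARD('n) * 1))"
        by (rule dilated_box_subset_cball[OF unit_cube_component h(1)])
      also have "\<dots> \<subseteq> cball x \<rho>" using h(2) by (rule subset_cball)
      finally have sub: "dilated_box 0 One x h \<subseteq> \<Omega>" using \<rho>(2) by blast
      have "integrable (lebesgue_on (dilated_box 0 One x h)) v"
        by (rule integrable_lebesgue_on_mono[OF v_int _ meas_dom sub]) simp
      then have "v integrable_on dilated_box 0 One x h" by (rule integrable_on_lebesgue_on) simp
      from has_integral_dilation[OF integrable_integral[OF this] h(1)]
      have "kernel_avg (\<lambda>_. 1) 0 One v x h = integral (dilated_box 0 One x h) v /\<^sub>R h ^ CARD('n)"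
        unfolding kernel_avg_def by (simp add: integral_unique)
      also have "integral (dilated_box 0 One x h) v = integral (dilated_box 0 One x h) f"
        by (rule integral_cong) (use sub in \<open>auto simp: f_def\<close>)
      finally show ?thesis by simp
    qed
    show ?thesis
    proof (rule LIMSEQ_I)
      fix e :: real assume "0 < e"
      from avg[OF x(2) this] obtain \<delta> where \<delta>: "0 < \<delta>" "\<And>h. 0 < h \<Longrightarrow> h < \<delta> \<Longrightarrow>
        norm (integral (cbox x (x + h *\<^sub>R One)) f /\<^sub>R h ^ DIM(real^'n) - f x) < e" by blast
      have "0 < min \<delta> (\<rho> / CARD('n))" using \<delta>(1) \<rho>(1) by simp
      from order_tendstoD(2)[OF LIMSEQ_inverse_real_of_nat this]
      obtain J where J: "\<And>j. J \<le> j \<Longrightarrow> ?h j < min \<delta> (\<rho> / CARD('n))"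
        unfolding eventually_sequentially by blast
      show "\<exists>J. \<forall>j\<ge>J. norm (kernel_avg (\<lambda>_. 1) 0 One v x (?h j) - v x) < e"
      proof (intro exI allI impI)
        fix j assume j: "J \<le> j"
        have "?h j * (real CARD('n) * 1) \<le> \<rho>" using J[OF j] by (simp add: field_simps)
        then show "norm (kernel_avg (\<lambda>_. 1) 0 One v x (?h j) - v x) < e"
          using eq[of "?h j"] \<delta>(2)[of "?h j"] J[OF j] x(1) by (simp add: f_def)
      qed
    qed
  qed
  then have "{x \<in> \<Omega>. \<not> (\<lambda>j. kernel_avg (\<lambda>_. 1) 0 One v x (inverse (real (Suc j)))) \<longlonglongrightarrow> v x} \<subseteq> Z" by blast
  then show ?thesis using Z negligible_subset meas_dom by (subst AE_lebesgue_on_iff) blast+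
qed

text \<open>The averages of \<open>v\<close> over cubes of side \<open>1/(j+1)\<close> are continuous in the corner and converge uniformly near
every point, at the rate \<open>C * (1/(j+1)) powr \<alpha>\<close>. Their limit is continuous and agrees with \<open>v\<close> almost
everywhere.\<close>

lemma continuous_representative_exists:
  "\<exists>w. continuous_on \<Omega> w \<and> (AE x in lebesgue_on \<Omega>. w x = v x)"
proof -
  let ?h = "\<lambda>j. inverse (real (Suc j))"
  let ?A = "\<lambda>x s. kernel_avg (\<lambda>_. 1) 0 One v x s"
  define C where "C = 1 * 1 * (measure lborel (cbox 0 (One::real^'n)) powr (1 / p) * N) / \<alpha>"
  have C0: "0 \<le> C" using N_nonneg \<alpha>_pos by (simp add: C_def)
  define w where "w x = lim (\<lambda>j. ?A x (?h j))" for x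
  have h_small: "\<exists>J. \<forall>j\<ge>J. ?h j < \<delta>" if "0 < \<delta>" for \<delta>
    using order_tendstoD(2)[OF LIMSEQ_inverse_real_of_nat that] unfolding eventually_sequentially .
  have local: "continuous_on (ball y \<rho>) w"
    if \<rho>: "0 < \<rho>" "cball y (2 * \<rho>) \<subseteq> \<Omega>" for y \<rho>
  proof -
    \<comment> \<open>A cube of side \<open>s\<close> lies in the ball of radius \<open>n s\<close> about any of its corners.\<close>
    define s0 where "s0 = \<rho> / CARD('n)"
    have s0: "0 < s0" using \<rho>(1) by (simp add: s0_def)
    have box: "dilated_box 0 One x s \<subseteq> \<Omega>" if "x \<in> ball y \<rho>" "0 < s" "s \<le> s0" for x s
    proof -
      have "dilated_box 0 One x s \<subseteq> cball x (s * (real CARD('n) * 1))"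
        by (rule dilated_box_subset_cball[OF unit_cube_component that(2)])
      also have "\<dots> \<subseteq> cball x \<rho>" using that(3) by (intro subset_cball) (simp add: s0_def field_simps)
      also have "\<dots> \<subseteq> cball y (2 * \<rho>)"
      proof
        fix z assume "z \<in> cball x \<rho>"
        then show "z \<in> cball y (2 * \<rho>)" using that(1) dist_triangle[of y z x] by simp
      qed
      finally show ?thesis using \<rho>(2) by blast
    qed
    have incr: "norm (?A x t - ?A x r) \<le> C * t powr \<alpha>" if "x \<in> ball y \<rho>" "0 < r" "r \<le> t" "t \<le> s0" for x r t
    proof (cases "r = t")
      case False
      then have "norm (?A x t - ?A x r) \<le> C * (t powr \<alpha> - r powr \<alpha>)"
        unfolding C_def using that
        by (intro kernel_avg_increment unit_cube_component box) auto
      also have "\<dots> \<le> C * t powr \<alpha>" using C0 by (intro mult_left_mono) auto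
      finally show ?thesis .
    qed (use C0 in simp)
    have powr_lim: "(\<lambda>j. C * ?h j powr \<alpha>) \<longlonglongrightarrow> 0"
    proof -
      have "(\<lambda>j. C * ?h j powr \<alpha>) \<longlonglongrightarrow> C * 0 powr \<alpha>"
        using \<alpha>_pos by (intro tendsto_mult_left tendsto_powr2 LIMSEQ_inverse_real_of_nat tendsto_const) auto
      then show ?thesis by simp
    qed
    obtain J0 where J0: "\<And>j. J0 \<le> j \<Longrightarrow> ?h j < s0" using h_small[OF s0] by blast
    have hmono: "?h j \<le> ?h i" if "i \<le> j" for i j using that by (simp add: le_imp_inverse_le)
    have conv: "(\<lambda>j. ?A x (?h j)) \<longlonglongrightarrow> w x" if x: "x \<in> ball y \<rho>" for x
    proof -
      have "Cauchy (\<lambda>j. ?A x (?h j))"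
      proof (rule CauchyI')
        fix e :: real assume "0 < e"
        from order_tendstoD(2)[OF powr_lim this]
        obtain J1 where J1: "\<And>j. J1 \<le> j \<Longrightarrow> C * ?h j powr \<alpha> < e" unfolding eventually_sequentially by blast
        show "\<exists>M. \<forall>m\<ge>M. \<forall>n>m. dist (?A x (?h m)) (?A x (?h n)) < e"
        proof (intro exI[of _ "max J0 J1"] allI impI)
          fix m n assume mn: "max J0 J1 \<le> m" "m < n"
          have "norm (?A x (?h m) - ?A x (?h n)) \<le> C * ?h m powr \<alpha>"
            using mn J0[of m] by (intro incr x hmono) auto
          then show "dist (?A x (?h m)) (?A x (?h n)) < e"
            using J1[of m] mn(1) by (simp add: dist_norm)
        qed
      qed
      then show ?thesis
        unfolding w_def by (simp add: Cauchy_convergent convergent_LIMSEQ_iff[symmetric])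
    qed
    have unif: "uniform_limit (ball y \<rho>) (\<lambda>j x. ?A x (?h j)) w sequentially"
    proof (rule uniform_limitI)
      fix e :: real assume "0 < e"
      have "\<forall>\<^sub>F j in sequentially. J0 \<le> j" by (rule eventually_ge_at_top)
      with order_tendstoD(2)[OF powr_lim \<open>0 < e\<close>]
      show "\<forall>\<^sub>F j in sequentially. \<forall>x\<in>ball y \<rho>. dist (?A x (?h j)) (w x) < e"
      proof eventually_elim
        case (elim j)
        show ?case
        proof
          fix x assume x: "x \<in> ball y \<rho>"
          have "norm (?A x (?h j) - w x) \<le> C * ?h j powr \<alpha>"
            unfolding C_def
            by (rule kernel_avg_minus_limit[OF _ _ _ unit_cube_component _ _ _ _ LIMSEQ_inverse_real_of_nat conv[OF x]])
              (use box[OF x] J0[OF elim(2)] in auto)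
          then show "dist (?A x (?h j)) (w x) < e" using elim(1) by (simp add: dist_norm)
        qed
      qed
    qed
    show ?thesis
    proof (rule uniform_limit_theorem[OF _ unif])
      have "continuous_on (ball y \<rho>) (\<lambda>x. ?A x (?h j))" if "J0 \<le> j" for j
        by (rule continuous_on_unit_cube_avg) (use box J0[OF that] in auto)
      then show "\<forall>\<^sub>F j in sequentially. continuous_on (ball y \<rho>) (\<lambda>x. ?A x (?h j))"
        unfolding eventually_sequentially by blast
    qed simp
  qed
  have "continuous_on \<Omega> w"
  proof (rule continuous_at_imp_continuous_on, rule ballI)
    fix y assume "y \<in> \<Omega>"
    then obtain e where e: "0 < e" "cball y e \<subseteq> \<Omega>" using open_dom open_contains_cball by blast
    then have "continuous_on (ball y (e / 2)) w" using local[of "e / 2" y] by simp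
    then show "isCont w y" using e(1) by (simp add: continuous_on_eq_continuous_at)
  qed
  moreover have "AE x in lebesgue_on \<Omega>. w x = v x"
    using unit_cube_avg_tendsto_AE by eventually_elim (simp add: w_def limI)
  ultimately show ?thesis by blast
qed

text \<open>The averages do not distinguish \<open>v\<close> from its continuous representative \<open>w\<close>, and those of \<open>w\<close> converge
to \<open>w x\<close> because the kernel has mass \<open>1\<close>. Hence the estimate for the increments extends down to scale \<open>0\<close>.\<close>

lemma kernel_avg_minus_continuous_representative:
  assumes w: "continuous_on \<Omega> w" "AE x in lebesgue_on \<Omega>. w x = v x"
    and k: "continuous_on (cbox a b) k" "\<And>z. z \<in> cbox a b \<Longrightarrow> \<bar>k z\<bar> \<le> B" "0 \<le> B"
    and k1: "integral (cbox a b) k = 1"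
    and L: "\<And>z i. z \<in> cbox a b \<Longrightarrow> \<bar>z $ i\<bar> \<le> L" "0 \<le> L"
    and t: "0 < t" "\<And>s. 0 < s \<Longrightarrow> s \<le> t \<Longrightarrow> dilated_box a b x s \<subseteq> \<Omega>" and x: "x \<in> \<Omega>"
  shows "norm (kernel_avg k a b v x t - w x)
    \<le> B * L * (measure lborel (cbox a b) powr (1 / p) * N) / \<alpha> * t powr \<alpha>"
proof -
  define r where "r j = t * inverse (real (Suc j))" for j
  have r0: "0 < r j" "r j \<le> t" for j
    using t(1) by (auto simp: r_def field_simps)
  have rlim: "r \<longlonglongrightarrow> 0"
    using tendsto_mult_left[OF LIMSEQ_inverse_real_of_nat, of t] by (simp add: r_def[abs_def])
  have wm: "w \<in> borel_measurable (lebesgue_on \<Omega>)"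
    by (rule continuous_imp_measurable_on_sets_lebesgue[OF w(1) meas_dom])
  have wint: "integrable (lebesgue_on \<Omega>) w"
    using Bochner_Integration.integrable_cong_AE[OF wm _ w(2)] v_int by auto
  have avg_eq: "kernel_avg k a b v x (r j) = kernel_avg k a b w x (r j)" for j
  proof -
    have "L1_norm \<Omega> (\<lambda>y. w y - v y) = 0"
      using w(2) by (intro integral_eq_zero_AE) (auto elim: eventually_mono)
    then have "norm (kernel_avg k a b (\<lambda>y. w y - v y) x (r j)) \<le> 0"
      using kernel_avg_bound(3)[OF Bochner_Integration.integrable_diff[OF wint v_int] meas_dom t(2)[OF r0[of j]] r0(1)[of j] k]
      by simp
    moreover have "kernel_avg k a b (\<lambda>y. w y - v y) x (r j) = kernel_avg k a b w x (r j) - kernel_avg k a b v x (r j)"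
      by (rule kernel_avg_diff[OF wint v_int meas_dom t(2)[OF r0] r0(1) k])
    ultimately show ?thesis by simp
  qed
  have "(\<lambda>j. integral (cbox a b) (\<lambda>z. k z *\<^sub>R w (x + r j *\<^sub>R z))) \<longlonglongrightarrow> integral (cbox a b) (\<lambda>z. k z *\<^sub>R w x)"
  proof -
    have cont: "continuous_on (cbox a b) (\<lambda>z. k z *\<^sub>R w (x + r j *\<^sub>R z))" for j
    proof (intro continuous_on_scaleR k continuous_on_compose2[OF w(1)] continuous_intros)
      show "(\<lambda>z. x + r j *\<^sub>R z) ` cbox a b \<subseteq> \<Omega>"
        using mem_dilated_box[OF _ r0(1)] t(2)[OF r0] by blast
    qed
    have unif: "uniform_limit (cbox a b) (\<lambda>j z. k z *\<^sub>R w (x + r j *\<^sub>R z)) (\<lambda>z. k z *\<^sub>R w x) sequentially"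
    proof (rule uniform_limitI)
      fix e :: real assume e: "0 < e"
      have "isCont w x" using w(1) x open_dom by (simp add: continuous_on_eq_continuous_at)
      moreover have "0 < e / (B + 1)" using e k(3) by simp
      ultimately obtain \<delta> where \<delta>: "0 < \<delta>" "\<And>y. dist y x < \<delta> \<Longrightarrow> dist (w y) (w x) < e / (B + 1)"
        unfolding continuous_at_eps_delta by blast
      have "(\<lambda>j. r j * (CARD('n) * L)) \<longlonglongrightarrow> 0"
        using tendsto_mult_right[OF rlim, of "CARD('n) * L"] by simp
      from order_tendstoD(2)[OF this \<delta>(1)]
      show "\<forall>\<^sub>F j in sequentially. \<forall>z\<in>cbox a b. dist (k z *\<^sub>R w (x + r j *\<^sub>R z)) (k z *\<^sub>R w x) < e"
      proof eventually_elim
        case (elim j)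
        show ?case
        proof
          fix z assume z: "z \<in> cbox a b"
          have "x + r j *\<^sub>R z \<in> cball x (r j * (CARD('n) * L))"
            using mem_dilated_box[OF z r0(1)] dilated_box_subset_cball[OF L(1) r0(1)] by blast
          then have "dist (x + r j *\<^sub>R z) x < \<delta>" using elim by (simp add: dist_commute)
          then have "norm (w (x + r j *\<^sub>R z) - w x) < e / (B + 1)" using \<delta>(2) by (simp add: dist_norm)
          then have "\<bar>k z\<bar> * norm (w (x + r j *\<^sub>R z) - w x) \<le> B * (e / (B + 1))"
            using k(2)[OF z] k(3) by (intro mult_mono) auto
          also have "\<dots> < e" using e k(3) by (simp add: field_simps)
          finally show "dist (k z *\<^sub>R w (x + r j *\<^sub>R z)) (k z *\<^sub>R w x) < e"
            by (simp add: dist_norm flip: scaleR_diff_right)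
        qed
      qed
    qed
    obtain I' J' where IJ: "\<And>j. ((\<lambda>z. k z *\<^sub>R w (x + r j *\<^sub>R z)) has_integral I' j) (cbox a b)"
        "((\<lambda>z. k z *\<^sub>R w x) has_integral J') (cbox a b)" "I' \<longlonglongrightarrow> J'"
      using uniform_limit_integral_cbox[OF unif cont trivial_limit_sequentially] by blast
    have "I' = (\<lambda>j. integral (cbox a b) (\<lambda>z. k z *\<^sub>R w (x + r j *\<^sub>R z)))"
      using integral_unique[OF IJ(1)] by (intro ext) simp
    then show ?thesis using IJ(3) integral_unique[OF IJ(2)] by simp
  qed
  moreover have "integral (cbox a b) (\<lambda>z. k z *\<^sub>R w x) = w x"
  proof -
    have "(k has_integral 1) (cbox a b)"
      using integrable_integral[OF integrable_continuous[OF k(1)]] k1 by simp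
    from has_integral_scaleR_left[OF this, of "w x"] show ?thesis by (simp add: integral_unique)
  qed
  ultimately have "(\<lambda>j. kernel_avg k a b v x (r j)) \<longlonglongrightarrow> w x"
    unfolding avg_eq by (simp add: kernel_avg_def)
  from kernel_avg_minus_limit[OF k L t r0(1) rlim this] show ?thesis by simp
qed

end

section \<open>The regularized delta function\<close>

lemma continuous_rep_eq:
  fixes v :: "real^'n \<Rightarrow> 'b::euclidean_space"
  assumes "open \<Omega>" "continuous_on \<Omega> w" "AE x in lebesgue_on \<Omega>. w x = v x"
  shows "continuous_on \<Omega> (continuous_rep \<Omega> v)" "AE x in lebesgue_on \<Omega>. continuous_rep \<Omega> v x = v x"
    and "\<And>x. x \<in> \<Omega> \<Longrightarrow> continuous_rep \<Omega> v x = w x"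
proof -
  have *: "continuous_on \<Omega> (continuous_rep \<Omega> v) \<and> (AE x in lebesgue_on \<Omega>. continuous_rep \<Omega> v x = v x)"
    unfolding continuous_rep_def by (rule someI[of _ w]) (use assms in blast)
  then show c: "continuous_on \<Omega> (continuous_rep \<Omega> v)" and ae: "AE x in lebesgue_on \<Omega>. continuous_rep \<Omega> v x = v x"
    by auto
  let ?S = "{x \<in> \<Omega>. continuous_rep \<Omega> v x - w x \<in> - {0}}"
  have "open ?S"
    using continuous_open_preimage[OF continuous_on_diff[OF c assms(2)] assms(1), of "- {0}"]
    by (simp add: vimage_def Int_def conj_commute open_Compl)
  moreover have "AE x in lebesgue_on \<Omega>. continuous_rep \<Omega> v x = w x"
    using ae assms(3) by eventually_elim simp
  then have "negligible ?S" using assms(1) by (simp add: AE_lebesgue_on_iff)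
  ultimately have "?S = {}" using open_not_negligible by blast
  then show "\<And>x. x \<in> \<Omega> \<Longrightarrow> continuous_rep \<Omega> v x = w x" by auto
qed

definition product_kernel :: "(real \<Rightarrow> real) \<Rightarrow> real^'n \<Rightarrow> real" where
  "product_kernel \<phi> z = (\<Prod>i\<in>UNIV. \<phi> (z $ i))"

lemma regularized_delta_eq:
  "regularized_delta \<phi> \<epsilon> (x :: real^'n) = product_kernel \<phi> (x /\<^sub>R \<epsilon>) / \<epsilon> ^ CARD('n)"
  by (simp add: regularized_delta_def product_kernel_def divide_inverse mult.commute)

text \<open>Lebesgue measure on the space is the product of Lebesgue measures on the coordinate axes.\<close>

lemma integral_product_kernel:
  assumes "integrable lborel \<phi>"
  shows "integral\<^sup>L lborel (product_kernel \<phi> :: real^'n \<Rightarrow> real) = (\<integral>s. \<phi> s \<partial>lborel) ^ CARD('n)"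
proof -
  interpret product_sigma_finite "\<lambda>_ :: real^'n. lborel :: real measure" by standard
  have m: "(\<lambda>f. \<Sum>b\<in>Basis. f b *\<^sub>R b) \<in> measurable (\<Pi>\<^sub>M b\<in>(Basis :: (real^'n) set). lborel) (borel :: (real^'n) measure)"
    by measurable
  have [measurable]: "\<phi> \<in> borel_measurable borel" using assms by auto
  have "continuous_on UNIV (\<lambda>z::real^'n. z $ i)" for i by (intro continuous_intros)
  then have [measurable]: "(\<lambda>z::real^'n. z $ i) \<in> borel_measurable borel" for i
    by (rule borel_measurable_continuous_onI)
  have km: "(product_kernel \<phi> :: real^'n \<Rightarrow> real) \<in> borel_measurable borel"
    unfolding product_kernel_def[abs_def] by measurable
  have "integral\<^sup>L lborel (product_kernel \<phi> :: real^'n \<Rightarrow> real)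
      = (\<integral>f. product_kernel \<phi> (\<Sum>b\<in>Basis. f b *\<^sub>R (b :: real^'n)) \<partial>(\<Pi>\<^sub>M b\<in>Basis. lborel))"
    by (subst lborel_eq) (rule integral_distr[OF m km])
  also have "\<dots> = (\<integral>f. (\<Prod>b\<in>Basis. \<phi> (f b)) \<partial>(\<Pi>\<^sub>M b\<in>(Basis :: (real^'n) set). lborel))"
  proof (rule Bochner_Integration.integral_cong[OF refl])
    fix f :: "real^'n \<Rightarrow> real"
    have B: "(Basis :: (real^'n) set) = range (\<lambda>i. axis i 1)" by (auto simp: Basis_vec_def)
    have inj: "inj (\<lambda>i. axis i 1 :: real^'n)" by (auto simp: inj_on_def axis_eq_axis)
    have "(\<Sum>b\<in>Basis. f b *\<^sub>R (b :: real^'n)) $ i = f (axis i 1)" for i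
    proof -
      have b: "axis i 1 \<in> (Basis :: (real^'n) set)" by (auto simp: B)
      have "(\<Sum>b\<in>Basis. f b *\<^sub>R (b :: real^'n)) \<bullet> axis i 1 = f (axis i 1)"
        using b by (simp add: inner_sum_left_Basis)
      then show ?thesis by (simp add: inner_axis)
    qed
    then show "product_kernel \<phi> (\<Sum>b\<in>Basis. f b *\<^sub>R (b :: real^'n)) = (\<Prod>b\<in>Basis. \<phi> (f b))"
      unfolding product_kernel_def B by (simp add: prod.reindex[OF inj])
  qed
  also have "\<dots> = (\<Prod>b\<in>(Basis :: (real^'n) set). \<integral>s. \<phi> s \<partial>lborel)"
    by (rule product_integral_prod) (use assms in auto)
  finally show ?thesis by simp
qed

text \<open>A bound that holds almost everywhere fails only on an open null set if the function is continuous.\<close>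

lemma Lp_norm_infinity_bound_continuous:
  fixes \<phi> :: "'a::euclidean_space \<Rightarrow> 'b::euclidean_space"
  assumes "continuous_on UNIV \<phi>" "\<phi> \<in> Lp_space \<infinity> lborel"
  shows "norm (\<phi> s) \<le> Lp_norm \<infinity> lborel \<phi>"
proof -
  let ?S = "{s. Lp_norm \<infinity> lborel \<phi> < norm (\<phi> s)}"
  have op: "open ?S" using assms(1) by (intro open_Collect_less continuous_intros)
  have "AE s in lborel. s \<notin> ?S"
    using Lp_norm_infinity_AE(1)[OF assms(2)] by eventually_elim auto
  then have "?S \<in> null_sets lborel" using op by (simp add: AE_iff_null_sets)
  then have "negligible ?S" using null_sets_completionI by (auto simp: negligible_iff_null_sets)
  then have "?S = {}" using open_not_negligible[OF op] by blast
  then show ?thesis by (meson Collect_empty_eq not_le)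
qed

lemma compactly_supported_continuous:
  fixes \<phi> :: "real \<Rightarrow> real"
  assumes "continuous_on UNIV \<phi>" "closure {s. \<phi> s \<noteq> 0} \<subseteq> {-K<..<K}"
  shows "integrable lborel \<phi>" "\<phi> \<in> Lp_space \<infinity> lborel" "\<And>s. \<not> (-K < s \<and> s < K) \<Longrightarrow> \<phi> s = 0"
proof -
  show out: "\<And>s. \<not> (-K < s \<and> s < K) \<Longrightarrow> \<phi> s = 0"
    using assms(2) closure_subset[of "{s. \<phi> s \<noteq> 0}"] by auto
  have "integrable lborel (\<lambda>s. indicator {-K..K} s *\<^sub>R \<phi> s)"
    by (intro borel_integrable_compact continuous_on_subset[OF assms(1)]) auto
  also have "(\<lambda>s. indicator {-K..K} s *\<^sub>R \<phi> s) = \<phi>"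
  proof
    fix s show "indicator {-K..K} s *\<^sub>R \<phi> s = \<phi> s" using out[of s] by (cases "s \<in> {-K..K}") auto
  qed
  finally show int: "integrable lborel \<phi>" .
  have "bounded (\<phi> ` {-K..K})"
    by (intro compact_imp_bounded compact_continuous_image continuous_on_subset[OF assms(1)]) auto
  then obtain C where "\<forall>y\<in>\<phi> ` {-K..K}. norm y \<le> C" unfolding bounded_iff by blast
  then have C: "norm (\<phi> s) \<le> C" if "s \<in> {-K..K}" for s using that by blast
  have "norm (\<phi> s) \<le> max C 0" for s using C[of s] out[of s] by (cases "s \<in> {-K..K}") auto
  then have "AE s in lborel. norm (\<phi> s) \<le> max C 0" by (intro AE_I2)
  then show "\<phi> \<in> Lp_space \<infinity> lborel" using int by (auto simp: Lp_space_def)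
qed

text \<open>Fubini's theorem moves the regularization from the force to the test function: with
\<open>\<kappa> x \<theta> = \<delta>\<^sup>\<epsilon>(x - X \<theta>)\<close> the left-hand side is the regularized force paired with \<open>v\<close>.\<close>

lemma integral_kernel_pairing:
  fixes F :: "'t \<Rightarrow> 'c::euclidean_space" and v :: "'x \<Rightarrow> 'c" and \<kappa> :: "'x \<Rightarrow> 't \<Rightarrow> real"
  assumes "sigma_finite_measure M1" "sigma_finite_measure M2"
    and v: "integrable M1 v" and F: "integrable M2 F"
    and \<kappa>[measurable]: "case_prod \<kappa> \<in> borel_measurable (M1 \<Otimes>\<^sub>M M2)"
    and bound: "\<And>x \<theta>. \<bar>\<kappa> x \<theta>\<bar> \<le> B"
  shows "integrable M1 (\<lambda>x. (\<integral>\<theta>. \<kappa> x \<theta> *\<^sub>R F \<theta> \<partial>M2) \<bullet> v x)" (is ?A)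
    and "integrable M2 (\<lambda>\<theta>. F \<theta> \<bullet> (\<integral>x. \<kappa> x \<theta> *\<^sub>R v x \<partial>M1))" (is ?B)
    and "(\<integral>x. (\<integral>\<theta>. \<kappa> x \<theta> *\<^sub>R F \<theta> \<partial>M2) \<bullet> v x \<partial>M1) = (\<integral>\<theta>. F \<theta> \<bullet> (\<integral>x. \<kappa> x \<theta> *\<^sub>R v x \<partial>M1) \<partial>M2)" (is ?C)
proof -
  interpret M1: sigma_finite_measure M1 by fact
  interpret M2: sigma_finite_measure M2 by fact
  interpret pair_sigma_finite M1 M2 ..
  have [measurable]: "v \<in> borel_measurable M1" "F \<in> borel_measurable M2" using v F by auto
  have prod: "integrable (M1 \<Otimes>\<^sub>M M2) (\<lambda>(x, \<theta>). norm (v x) * norm (F \<theta>))"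
  proof (rule Fubini_integrable)
    show "integrable M1 (\<lambda>x. \<integral>\<theta>. norm (case (x, \<theta>) of (x, \<theta>) \<Rightarrow> norm (v x) * norm (F \<theta>)) \<partial>M2)"
      using v by simp
    show "AE x in M1. integrable M2 (\<lambda>\<theta>. case (x, \<theta>) of (x, \<theta>) \<Rightarrow> norm (v x) * norm (F \<theta>))"
      using F by simp
  qed measurable
  have "integrable (M1 \<Otimes>\<^sub>M M2) (\<lambda>(x, \<theta>). \<kappa> x \<theta> * (F \<theta> \<bullet> v x))"
  proof (rule Bochner_Integration.integrable_bound)
    show "integrable (M1 \<Otimes>\<^sub>M M2) (\<lambda>z. B * (case z of (x, \<theta>) \<Rightarrow> norm (v x) * norm (F \<theta>)))"
      using prod by (rule integrable_mult_right)
    show "(\<lambda>(x, \<theta>). \<kappa> x \<theta> * (F \<theta> \<bullet> v x)) \<in> borel_measurable (M1 \<Otimes>\<^sub>M M2)" by measurable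
    have "\<bar>\<kappa> x \<theta> * (F \<theta> \<bullet> v x)\<bar> \<le> \<bar>B * (norm (v x) * norm (F \<theta>))\<bar>" for x \<theta>
    proof -
      have "0 \<le> B" using bound[of x \<theta>] by linarith
      have "\<bar>\<kappa> x \<theta> * (F \<theta> \<bullet> v x)\<bar> = \<bar>\<kappa> x \<theta>\<bar> * \<bar>F \<theta> \<bullet> v x\<bar>" by (rule abs_mult)
      also have "\<dots> \<le> B * (norm (F \<theta>) * norm (v x))"
        using bound[of x \<theta>] \<open>0 \<le> B\<close> by (intro mult_mono Cauchy_Schwarz_ineq2) auto
      finally show ?thesis using \<open>0 \<le> B\<close> by (simp add: mult.commute abs_mult)
    qed
    then show "AE z in M1 \<Otimes>\<^sub>M M2. norm (case z of (x, \<theta>) \<Rightarrow> \<kappa> x \<theta> * (F \<theta> \<bullet> v x))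
        \<le> norm (B * (case z of (x, \<theta>) \<Rightarrow> norm (v x) * norm (F \<theta>)))"
      by (intro AE_I2) (auto split: prod.split)
  qed
  then have I: "integrable (M1 \<Otimes>\<^sub>M M2) (case_prod (\<lambda>x \<theta>. \<kappa> x \<theta> * (F \<theta> \<bullet> v x)))" by simp
  have sec: "(\<lambda>\<theta>. \<kappa> x \<theta>) \<in> borel_measurable M2" if "x \<in> space M1" for x
    using measurable_compose[OF measurable_Pair1'[OF that] \<kappa>] by simp
  have sec': "(\<lambda>x. \<kappa> x \<theta>) \<in> borel_measurable M1" if "\<theta> \<in> space M2" for \<theta>
    using measurable_compose[OF measurable_Pair2'[OF that] \<kappa>] by simp
  have in1: "(\<integral>\<theta>. \<kappa> x \<theta> * (F \<theta> \<bullet> v x) \<partial>M2) = (\<integral>\<theta>. \<kappa> x \<theta> *\<^sub>R F \<theta> \<partial>M2) \<bullet> v x" if "x \<in> space M1" for x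
  proof -
    have "integrable M2 (\<lambda>\<theta>. \<kappa> x \<theta> *\<^sub>R F \<theta>)"
    proof (rule Bochner_Integration.integrable_bound)
      show "integrable M2 (\<lambda>\<theta>. B *\<^sub>R F \<theta>)" using F by simp
      show "(\<lambda>\<theta>. \<kappa> x \<theta> *\<^sub>R F \<theta>) \<in> borel_measurable M2" using sec[OF that] by measurable
      show "AE \<theta> in M2. norm (\<kappa> x \<theta> *\<^sub>R F \<theta>) \<le> norm (B *\<^sub>R F \<theta>)"
        using bound[of x] by (intro AE_I2) (auto intro!: mult_right_mono order_trans[OF bound])
    qed
    from integral_inner_left[OF this, of "v x"] show ?thesis by simp
  qed
  have in2: "(\<integral>x. \<kappa> x \<theta> * (F \<theta> \<bullet> v x) \<partial>M1) = F \<theta> \<bullet> (\<integral>x. \<kappa> x \<theta> *\<^sub>R v x \<partial>M1)" if "\<theta> \<in> space M2" for \<theta>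
  proof -
    have "integrable M1 (\<lambda>x. \<kappa> x \<theta> *\<^sub>R v x)"
    proof (rule Bochner_Integration.integrable_bound)
      show "integrable M1 (\<lambda>x. B *\<^sub>R v x)" using v by simp
      show "(\<lambda>x. \<kappa> x \<theta> *\<^sub>R v x) \<in> borel_measurable M1" using sec'[OF that] by measurable
      show "AE x in M1. norm (\<kappa> x \<theta> *\<^sub>R v x) \<le> norm (B *\<^sub>R v x)"
        by (intro AE_I2) (auto intro!: mult_right_mono order_trans[OF bound])
    qed
    from integral_inner_right[OF this, of "F \<theta>"] show ?thesis by simp
  qed
  have "integrable M1 (\<lambda>x. \<integral>\<theta>. \<kappa> x \<theta> * (F \<theta> \<bullet> v x) \<partial>M2)" using integrable_fst[OF I] .
  then show ?A using in1 by (subst (asm) Bochner_Integration.integrable_cong[OF refl in1]) auto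
  have "integrable M2 (\<lambda>\<theta>. \<integral>x. \<kappa> x \<theta> * (F \<theta> \<bullet> v x) \<partial>M1)" using integrable_snd[OF I] .
  then show ?B by (subst (asm) Bochner_Integration.integrable_cong[OF refl in2]) auto
  have "(\<integral>x. (\<integral>\<theta>. \<kappa> x \<theta> *\<^sub>R F \<theta> \<partial>M2) \<bullet> v x \<partial>M1) = (\<integral>x. (\<integral>\<theta>. \<kappa> x \<theta> * (F \<theta> \<bullet> v x) \<partial>M2) \<partial>M1)"
    by (rule Bochner_Integration.integral_cong[OF refl in1[symmetric]])
  also have "\<dots> = (\<integral>\<theta>. (\<integral>x. \<kappa> x \<theta> * (F \<theta> \<bullet> v x) \<partial>M1) \<partial>M2)"
    using Fubini_integral[OF I] by simp
  also have "\<dots> = (\<integral>\<theta>. F \<theta> \<bullet> (\<integral>x. \<kappa> x \<theta> *\<^sub>R v x \<partial>M1) \<partial>M2)"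
    by (rule Bochner_Integration.integral_cong[OF refl in2])
  finally show ?C .
qed

section \<open>The mollification error of a Sobolev function\<close>

lemma sobolev_norm_nonneg:
  fixes v :: "real^'n \<Rightarrow> 'b::euclidean_space"
  assumes "1 \<le> p" "v \<in> Lp_space (conj_exponent p) (lebesgue_on \<Omega>)"
  shows "0 \<le> sobolev_norm 1 (conj_exponent p) \<Omega> v"
proof -
  have "0 \<le> Lp_norm (conj_exponent p) (lebesgue_on \<Omega>) v"
  proof (cases rule: conj_exponent_cases[OF assms(1)])
    case 1
    then show ?thesis using Lp_norm_infinity_AE(2) assms(2) by metis
  next
    case (2 q)
    then show ?thesis using Lp_norm_ereal_nonneg by metis
  qed
  then show ?thesis using Lp_norm_le_sobolev_norm(1)[OF assms(1)] order_trans by blast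
qed

text \<open>The gradient bound carries a factor \<open>n\<close>, because each of the \<open>n\<close> partial derivatives is estimated
separately by the full Sobolev norm.\<close>

lemma sobolev0_w11_limit:
  fixes v :: "real^'n \<Rightarrow> 'b::euclidean_space"
  assumes "v \<in> sobolev0 (conj_exponent p) \<Omega>" "open \<Omega>" "bounded \<Omega>" "1 \<le> p"
    "0 < 1 - real CARD('n) + real CARD('n) / p"
  obtains V P where "w11_limit \<Omega> v (\<lambda>i. weak_partial \<Omega> i v) V P p
    (CARD('n) * sobolev_norm 1 (conj_exponent p) \<Omega> v) (1 - real CARD('n) + real CARD('n) / p)"
proof -
  have v1: "v \<in> sobolev 1 (conj_exponent p) \<Omega>" using assms(1) by (simp add: sobolev0_def)
  have vL: "v \<in> Lp_space (conj_exponent p) (lebesgue_on \<Omega>)"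
    "\<And>i. weak_partial \<Omega> i v \<in> Lp_space (conj_exponent p) (lebesgue_on \<Omega>)"
    using v1 unfolding sobolev_1_iff[OF assms(2)] by auto
  have Om: "\<Omega> \<in> sets lebesgue" using assms(2) by simp
  let ?S = "sobolev_norm 1 (conj_exponent p) \<Omega> v"
  have S0: "0 \<le> ?S" by (rule sobolev_norm_nonneg[OF assms(4) vL(1)])
  have growth: "(\<Sum>i\<in>UNIV. L1_norm E (weak_partial \<Omega> i v))
      \<le> measure lebesgue E powr (1 / p) * (CARD('n) * ?S)" if "E \<in> lmeasurable" "E \<subseteq> \<Omega>" for E
  proof -
    have "L1_norm E (weak_partial \<Omega> i v) \<le> measure lebesgue E powr (1 / p) * ?S" for i
    proof -
      have "L1_norm E (weak_partial \<Omega> i v)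
          \<le> measure lebesgue E powr (1 / p) * Lp_norm (conj_exponent p) (lebesgue_on \<Omega>) (weak_partial \<Omega> i v)"
        by (rule integral_norm_le_conj_Lp_norm(2)[OF assms(4) vL(2) that Om])
      also have "\<dots> \<le> measure lebesgue E powr (1 / p) * ?S"
        by (intro mult_left_mono Lp_norm_le_sobolev_norm(2)[OF assms(4)]) auto
      finally show ?thesis .
    qed
    then have "(\<Sum>i\<in>UNIV. L1_norm E (weak_partial \<Omega> i v))
        \<le> (\<Sum>i\<in>(UNIV::'n set). measure lebesgue E powr (1 / p) * ?S)" by (intro sum_mono)
    then show ?thesis by (simp add: algebra_simps)
  qed
  show ?thesis
  proof (rule sobolev0_smooth_approximation[OF assms(1-3)])
    fix V :: "nat \<Rightarrow> real^'n \<Rightarrow> 'b" and P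
    assume VP: "\<And>k x. has_partials (V k) (P k) x"
      "\<And>k i. continuous_on UNIV (P k i)"
      "integrable (lebesgue_on \<Omega>) v" "\<And>i. integrable (lebesgue_on \<Omega>) (weak_partial \<Omega> i v)"
      "(\<lambda>k. L1_norm \<Omega> (\<lambda>x. V k x - v x)) \<longlonglongrightarrow> 0"
      "\<And>i. (\<lambda>k. L1_norm \<Omega> (\<lambda>x. P k i x - weak_partial \<Omega> i v x)) \<longlonglongrightarrow> 0"
    have "w11_limit \<Omega> v (\<lambda>i. weak_partial \<Omega> i v) V P p (CARD('n) * ?S) (1 - real CARD('n) + real CARD('n) / p)"
      by standard (use VP growth S0 assms in auto)
    then show ?thesis by (rule that)
  qed
qed

lemma sobolev0_integrable:
  fixes v :: "real^'n \<Rightarrow> 'b::euclidean_space"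
  assumes "v \<in> sobolev0 s \<Omega>" "open \<Omega>"
  shows "integrable (lebesgue_on \<Omega>) v"
  using assms(1) unfolding sobolev0_def has_trace_def sobolev_1_iff[OF assms(2)] Lp_space_1 by blast

lemma continuous_rep_sobolev0:
  fixes v :: "real^'n \<Rightarrow> 'b::euclidean_space"
  assumes "v \<in> sobolev0 (conj_exponent p) \<Omega>" "open \<Omega>" "bounded \<Omega>" "1 \<le> p"
    "0 < 1 - real CARD('n) + real CARD('n) / p"
  shows "continuous_on \<Omega> (continuous_rep \<Omega> v)" "AE x in lebesgue_on \<Omega>. continuous_rep \<Omega> v x = v x"
proof -
  obtain V P where "w11_limit \<Omega> v (\<lambda>i. weak_partial \<Omega> i v) V P p
    (CARD('n) * sobolev_norm 1 (conj_exponent p) \<Omega> v) (1 - real CARD('n) + real CARD('n) / p)"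
    by (rule sobolev0_w11_limit[OF assms])
  from w11_limit.continuous_representative_exists[OF this]
  show "continuous_on \<Omega> (continuous_rep \<Omega> v)" "AE x in lebesgue_on \<Omega>. continuous_rep \<Omega> v x = v x"
    using continuous_rep_eq(1,2)[OF assms(2)] by blast+
qed

locale mollifier =
  fixes \<phi> :: "real \<Rightarrow> real" and K M :: real
  assumes cont: "continuous_on UNIV \<phi>" and supp: "closure {s. \<phi> s \<noteq> 0} \<subseteq> {-K<..<K}"
    and mass: "(\<integral>s. \<phi> s \<partial>lborel) = 1" and sup_norm: "Lp_norm \<infinity> lborel \<phi> = M" and K_pos: "0 < K"
begin

lemma M_nonneg: "0 \<le> M"
  using Lp_norm_infinity_AE(2)[OF compactly_supported_continuous(2)[OF cont supp]] sup_norm by simp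

lemma product_kernel_bound: "\<bar>product_kernel \<phi> (z :: real^'n)\<bar> \<le> M ^ CARD('n)"
proof -
  have "\<bar>\<phi> s\<bar> \<le> M" for s
    using Lp_norm_infinity_bound_continuous[OF cont compactly_supported_continuous(2)[OF cont supp]] sup_norm by simp
  then have "(\<Prod>i\<in>UNIV. \<bar>\<phi> (z $ i)\<bar>) \<le> (\<Prod>i\<in>(UNIV::'n set). M)" by (intro prod_mono) auto
  then show ?thesis by (simp add: product_kernel_def abs_prod)
qed

lemma product_kernel_continuous: "continuous_on S (product_kernel \<phi> :: real^'n \<Rightarrow> real)"
  unfolding product_kernel_def[abs_def]
  by (intro continuous_on_prod continuous_on_compose2[OF cont] continuous_intros) auto

lemma product_kernel_support:
  fixes z :: "real^'n"
  assumes "z \<notin> cbox (- vec K) (vec K)"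
  shows "product_kernel \<phi> z = 0"
proof -
  obtain i where "\<not> (-K \<le> z $ i \<and> z $ i \<le> K)" using assms by (auto simp: mem_box_cart)
  then have "\<not> (-K < z $ i \<and> z $ i < K)" by linarith
  then have "\<phi> (z $ i) = 0" by (rule compactly_supported_continuous(3)[OF cont supp])
  then show ?thesis unfolding product_kernel_def by (metis UNIV_I finite prod_zero)
qed

lemma integral_product_kernel_cbox:
  "integral (cbox (- vec K) (vec K)) (product_kernel \<phi> :: real^'n \<Rightarrow> real) = 1"
proof -
  let ?k = "product_kernel \<phi> :: real^'n \<Rightarrow> real" and ?Q = "cbox (- vec K) (vec K) :: (real^'n) set"
  have "integrable lborel (\<lambda>z. indicator ?Q z *\<^sub>R ?k z)"
    by (intro borel_integrable_compact product_kernel_continuous) auto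
  moreover have "(\<lambda>z. indicator ?Q z *\<^sub>R ?k z) = ?k"
    by (rule ext) (use product_kernel_support in \<open>auto simp: indicator_def\<close>)
  ultimately have int: "integrable lborel ?k" by simp
  have "integral\<^sup>L lborel ?k = 1"
    using integral_product_kernel[OF compactly_supported_continuous(1)[OF cont supp], where 'n = 'n] mass by simp
  then have "(?k has_integral 1) UNIV" using has_integral_integral_lborel[OF int] by simp
  then have "((\<lambda>z. if z \<in> ?Q then ?k z else 0) has_integral 1) UNIV"
    by (rule has_integral_eq[rotated]) (simp add: product_kernel_support)
  then have "(?k has_integral 1) ?Q" by (simp only: has_integral_restrict_UNIV)
  then show ?thesis by (rule integral_unique)
qed

lemma regularized_delta_bound:
  assumes "0 < \<epsilon>"
  shows "\<bar>regularized_delta \<phi> \<epsilon> (x :: real^'n)\<bar> \<le> M ^ CARD('n) / \<epsilon> ^ CARD('n)"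
  using assms product_kernel_bound[of "x /\<^sub>R \<epsilon>"] by (simp add: regularized_delta_eq divide_right_mono)

lemma regularized_delta_continuous:
  assumes "0 < \<epsilon>"
  shows "continuous_on S (regularized_delta \<phi> \<epsilon> :: real^'n \<Rightarrow> real)"
  unfolding regularized_delta_eq[abs_def] using assms
  by (intro continuous_intros continuous_on_compose2[OF product_kernel_continuous]) auto

text \<open>The crude bound that takes over when the support of the mollifier may leave \<open>\<Omega>\<close>.\<close>

lemma regularized_delta_integral_bound:
  fixes v :: "real^'n \<Rightarrow> 'b::euclidean_space"
  assumes "integrable (lebesgue_on \<Omega>) v" "0 < \<epsilon>" "\<Omega> \<in> sets lebesgue"
  shows "norm (\<integral>x. regularized_delta \<phi> \<epsilon> (x - y) *\<^sub>R v x \<partial>lebesgue_on \<Omega>)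
    \<le> M ^ CARD('n) / \<epsilon> ^ CARD('n) * L1_norm \<Omega> v"
proof -
  define c where "c = M ^ CARD('n) / \<epsilon> ^ CARD('n)"
  have c0: "0 \<le> c" using M_nonneg assms(2) by (simp add: c_def)
  have b: "norm (regularized_delta \<phi> \<epsilon> (x - y) *\<^sub>R v x) \<le> c * norm (v x)" for x
    using regularized_delta_bound[OF assms(2), of "x - y"] by (simp add: c_def[symmetric] mult_right_mono)
  have dm: "(\<lambda>x. regularized_delta \<phi> \<epsilon> (x - y)) \<in> borel_measurable (lebesgue_on \<Omega>)"
    by (intro continuous_imp_measurable_on_sets_lebesgue assms continuous_on_compose2[OF regularized_delta_continuous]
        continuous_intros) auto
  have "integrable (lebesgue_on \<Omega>) (\<lambda>x. regularized_delta \<phi> \<epsilon> (x - y) *\<^sub>R v x)"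
  proof (rule Bochner_Integration.integrable_bound)
    show "integrable (lebesgue_on \<Omega>) (\<lambda>x. c *\<^sub>R v x)" using assms(1) by simp
    show "(\<lambda>x. regularized_delta \<phi> \<epsilon> (x - y) *\<^sub>R v x) \<in> borel_measurable (lebesgue_on \<Omega>)"
      using dm assms(1) by (intro borel_measurable_scaleR) auto
    have "norm (c *\<^sub>R v x) = c * norm (v x)" for x using c0 by simp
    then show "AE x in lebesgue_on \<Omega>. norm (regularized_delta \<phi> \<epsilon> (x - y) *\<^sub>R v x) \<le> norm (c *\<^sub>R v x)"
      using b by (intro AE_I2) (simp only:)
  qed
  then have "norm (\<integral>x. regularized_delta \<phi> \<epsilon> (x - y) *\<^sub>R v x \<partial>lebesgue_on \<Omega>)
      \<le> (\<integral>x. c * norm (v x) \<partial>lebesgue_on \<Omega>)"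
    by (rule Bochner_Integration.integral_norm_bound_integral) (use assms b in auto)
  then show ?thesis by (simp add: c_def)
qed

lemma regularized_delta_integral_eq_kernel_avg:
  fixes v :: "real^'n \<Rightarrow> 'b::euclidean_space"
  assumes "integrable (lebesgue_on \<Omega>) v" "0 < \<epsilon>" "\<Omega> \<in> sets lebesgue"
    "dilated_box (- vec K) (vec K) y \<epsilon> \<subseteq> \<Omega>"
  shows "(\<integral>x. regularized_delta \<phi> \<epsilon> (x - y) *\<^sub>R v x \<partial>lebesgue_on \<Omega>)
    = kernel_avg (product_kernel \<phi>) (- vec K) (vec K) v y \<epsilon>"
proof -
  let ?Q = "dilated_box (- vec K) (vec K) y \<epsilon>"
  let ?f = "\<lambda>x. product_kernel \<phi> ((x - y) /\<^sub>R \<epsilon>) *\<^sub>R v x"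
  have out: "?f x = 0" if "x \<notin> ?Q" for x
  proof -
    have "x = y + \<epsilon> *\<^sub>R ((x - y) /\<^sub>R \<epsilon>)" using assms(2) by simp
    then have "(x - y) /\<^sub>R \<epsilon> \<notin> cbox (- vec K) (vec K)" using that mem_dilated_box[OF _ assms(2)] by metis
    then show ?thesis by (simp add: product_kernel_support)
  qed
  have vQ: "v absolutely_integrable_on ?Q"
    using integrable_lebesgue_on_mono[OF assms(1) _ assms(3,4)] by (simp add: integrable_lebesgue_on_cbox_iff)
  have bil: "bilinear (\<lambda>(r::real) (v::'b). r *\<^sub>R v)" by (simp add: bilinear_def linear_iff algebra_simps)
  have "?f absolutely_integrable_on ?Q"
  proof (rule absolutely_integrable_bounded_measurable_product[OF bil _ _ _ vQ])
    show "(\<lambda>x. product_kernel \<phi> ((x - y) /\<^sub>R \<epsilon>)) \<in> borel_measurable (lebesgue_on ?Q)"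
      by (intro continuous_imp_measurable_on_sets_lebesgue continuous_on_compose2[OF product_kernel_continuous]
          continuous_intros) auto
    show "bounded ((\<lambda>x. product_kernel \<phi> ((x - y) /\<^sub>R \<epsilon>)) ` ?Q)"
      by (rule boundedI[of _ "M ^ CARD('n)"]) (auto simp: product_kernel_bound)
  qed simp
  then have fQ: "integrable (lebesgue_on ?Q) ?f" by (simp add: integrable_lebesgue_on_cbox_iff)
  have "(\<integral>x. regularized_delta \<phi> \<epsilon> (x - y) *\<^sub>R v x \<partial>lebesgue_on \<Omega>)
      = (\<integral>x. inverse (\<epsilon> ^ CARD('n)) *\<^sub>R ?f x \<partial>lebesgue_on \<Omega>)"
    by (simp add: regularized_delta_eq divide_inverse mult.commute)
  also have "\<dots> = (\<integral>x. ?f x \<partial>lebesgue_on \<Omega>) /\<^sub>R \<epsilon> ^ CARD('n)"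
    using assms(2) by (subst integral_scaleR_right) auto
  also have "(\<integral>x. ?f x \<partial>lebesgue_on \<Omega>) = (\<integral>x. ?f x \<partial>lebesgue_on ?Q)"
    by (rule integral_lebesgue_on_subset(1)) (use assms out in auto)
  also have "\<dots> = integral ?Q ?f" by (rule lebesgue_integral_eq_integral[OF fQ]) simp
  also have "integral ?Q ?f /\<^sub>R \<epsilon> ^ CARD('n)
      = integral (cbox (- vec K) (vec K)) (\<lambda>z. ?f (y + \<epsilon> *\<^sub>R z))"
    by (rule integral_unique[symmetric], rule has_integral_dilation[OF integrable_integral assms(2)])
      (rule integrable_on_lebesgue_on[OF fQ], simp)
  also have "\<dots> = kernel_avg (product_kernel \<phi>) (- vec K) (vec K) v y \<epsilon>"
    using assms(2) by (simp add: kernel_avg_def)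
  finally show ?thesis .
qed

end

text \<open>The first summand is the constant of the estimate for \<open>\<epsilon> \<le> \<epsilon>0\<close>. The second one is the sup bound of the
two mollifications at scales \<open>\<epsilon>0\<close> and \<open>\<epsilon> > \<epsilon>0\<close>, divided by \<open>\<epsilon>0 powr \<alpha>\<close> so that it can be
multiplied by the larger number \<open>\<epsilon> powr \<alpha>\<close>.\<close>

definition mollification_constant :: "(real^'n) set \<Rightarrow> real \<Rightarrow> real \<Rightarrow> real \<Rightarrow> real \<Rightarrow> real" where
  "mollification_constant \<Omega> p K M \<epsilon>0 = (let n = CARD('n); \<alpha> = 1 - real n + real n / p in
     M ^ n * K * (measure lborel (cbox (- vec K) (vec K) :: (real^'n) set) powr (1 / p) * n) / \<alpha>
     + 2 * M ^ n * measure lebesgue \<Omega> powr (1 / p) / (\<epsilon>0 ^ n * \<epsilon>0 powr \<alpha>))"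

text \<open>For \<open>\<epsilon> \<le> \<epsilon>0\<close> the dilated support of the mollifier lies in \<open>\<Omega>\<close> and the average estimate applies. For
larger \<open>\<epsilon>\<close> the value of the continuous representative is compared with the mollification at scale
\<open>\<epsilon>0\<close>, and both mollifications are bounded crudely.\<close>

lemma (in mollifier) continuous_rep_minus_mollification:
  fixes v :: "real^'n \<Rightarrow> 'b::euclidean_space" and p :: real
  defines "\<alpha> \<equiv> 1 - real CARD('n) + real CARD('n) / p"
  assumes v: "v \<in> sobolev0 (conj_exponent p) \<Omega>" and Om: "open \<Omega>" "bounded \<Omega>" and p: "1 \<le> p" "0 < \<alpha>"
    and \<epsilon>0: "0 < \<epsilon>0" "cball y (\<epsilon>0 * (real CARD('n) * K)) \<subseteq> \<Omega>" and "0 < \<epsilon>"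
  shows "norm (continuous_rep \<Omega> v y - (\<integral>x. regularized_delta \<phi> \<epsilon> (x - y) *\<^sub>R v x \<partial>lebesgue_on \<Omega>))
    \<le> mollification_constant \<Omega> p K M \<epsilon>0 * sobolev_norm 1 (conj_exponent p) \<Omega> v * \<epsilon> powr \<alpha>"
proof -
  let ?S = "sobolev_norm 1 (conj_exponent p) \<Omega> v" and ?Q = "cbox (- vec K) (vec K) :: (real^'n) set"
  let ?w = "continuous_rep \<Omega> v y"
  let ?h = "\<lambda>\<epsilon>. \<integral>x. regularized_delta \<phi> \<epsilon> (x - y) *\<^sub>R v x \<partial>lebesgue_on \<Omega>"
  define C1 where "C1 = M ^ CARD('n) * K * (measure lborel ?Q powr (1 / p) * CARD('n)) / \<alpha>"
  define C2 where "C2 = 2 * M ^ CARD('n) * measure lebesgue \<Omega> powr (1 / p) / (\<epsilon>0 ^ CARD('n) * \<epsilon>0 powr \<alpha>)"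
  have C: "mollification_constant \<Omega> p K M \<epsilon>0 = C1 + C2"
    by (simp add: mollification_constant_def C1_def C2_def \<alpha>_def Let_def)
  have C0: "0 \<le> C1" "0 \<le> C2" using M_nonneg K_pos p \<epsilon>0 by (auto simp: C1_def C2_def)
  have OmL: "\<Omega> \<in> sets lebesgue" and OmM: "\<Omega> \<in> lmeasurable"
    using Om by (auto intro: lmeasurable_open)
  have vL: "v \<in> Lp_space (conj_exponent p) (lebesgue_on \<Omega>)"
    using v unfolding sobolev0_def sobolev_1_iff[OF Om(1)] by blast
  have S0: "0 \<le> ?S" by (rule sobolev_norm_nonneg[OF p(1) vL])
  have vint: "integrable (lebesgue_on \<Omega>) v" by (rule sobolev0_integrable[OF v Om(1)])
  have comp: "\<bar>z $ i\<bar> \<le> K" if "z \<in> ?Q" for z i using that by (auto simp: mem_box_cart abs_le_iff minus_le_iff)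
  have box: "dilated_box (- vec K) (vec K) y s \<subseteq> \<Omega>" if s: "0 < s" "s \<le> \<epsilon>0" for s
  proof -
    have "dilated_box (- vec K) (vec K) y s \<subseteq> cball y (s * (real CARD('n) * K))"
      by (rule dilated_box_subset_cball[OF comp s(1)])
    also have "\<dots> \<subseteq> cball y (\<epsilon>0 * (real CARD('n) * K))"
      using s K_pos by (intro subset_cball mult_right_mono) auto
    finally show ?thesis using \<epsilon>0(2) by blast
  qed
  have yOm: "y \<in> \<Omega>" using \<epsilon>0 K_pos centre_in_cball[of y "\<epsilon>0 * (real CARD('n) * K)"] by auto
  note p' = p(2)[unfolded \<alpha>_def]
  obtain V P where lim: "w11_limit \<Omega> v (\<lambda>i. weak_partial \<Omega> i v) V P p
    (CARD('n) * ?S) (1 - real CARD('n) + real CARD('n) / p)"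
    by (rule sobolev0_w11_limit[OF v Om p(1) p'])
  have small: "norm (?w - ?h \<epsilon>) \<le> C1 * ?S * \<epsilon> powr \<alpha>" if \<epsilon>: "0 < \<epsilon>" "\<epsilon> \<le> \<epsilon>0" for \<epsilon>
  proof -
    have "norm (kernel_avg (product_kernel \<phi>) (- vec K) (vec K) v y \<epsilon> - ?w)
      \<le> M ^ CARD('n) * K * (measure lborel ?Q powr (1 / p) * (CARD('n) * ?S)) / (1 - real CARD('n) + real CARD('n) / p)
          * \<epsilon> powr (1 - real CARD('n) + real CARD('n) / p)"
      by (rule w11_limit.kernel_avg_minus_continuous_representative[OF lim
            continuous_rep_sobolev0[OF v Om p(1) p'] product_kernel_continuous product_kernel_bound _
            integral_product_kernel_cbox comp _ \<epsilon>(1) box yOm])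
        (use M_nonneg K_pos \<epsilon> in auto)
    also have "\<dots> = C1 * ?S * \<epsilon> powr \<alpha>" by (simp add: C1_def \<alpha>_def)
    also have "kernel_avg (product_kernel \<phi>) (- vec K) (vec K) v y \<epsilon> = ?h \<epsilon>"
      by (rule regularized_delta_integral_eq_kernel_avg[OF vint \<epsilon>(1) OmL box[OF \<epsilon>], symmetric])
    finally show ?thesis by (simp add: norm_minus_commute)
  qed
  show ?thesis
  proof (cases "\<epsilon> \<le> \<epsilon>0")
    case True
    have "norm (?w - ?h \<epsilon>) \<le> C1 * ?S * \<epsilon> powr \<alpha>" by (rule small[OF \<open>0 < \<epsilon>\<close> True])
    also have "\<dots> \<le> (C1 + C2) * ?S * \<epsilon> powr \<alpha>"
      using C0 S0 by (intro mult_right_mono) auto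
    finally show ?thesis unfolding C .
  next
    case False
    have vle: "L1_norm \<Omega> v \<le> measure lebesgue \<Omega> powr (1 / p) * ?S"
      by (rule order_trans[OF integral_norm_le_conj_Lp_norm(2)[OF p(1) vL OmM order_refl OmL]])
        (intro mult_left_mono Lp_norm_le_sobolev_norm(1)[OF p(1)], simp)
    have hb: "norm (?h s) \<le> M ^ CARD('n) / \<epsilon>0 ^ CARD('n) * (measure lebesgue \<Omega> powr (1 / p) * ?S)"
      if s: "\<epsilon>0 \<le> s" for s
    proof -
      have s0: "0 < s" using s \<epsilon>0(1) by linarith
      have "norm (?h s) \<le> M ^ CARD('n) / s ^ CARD('n) * L1_norm \<Omega> v"
        by (rule regularized_delta_integral_bound[OF vint s0 OmL])
      also have "\<dots> \<le> M ^ CARD('n) / \<epsilon>0 ^ CARD('n) * (measure lebesgue \<Omega> powr (1 / p) * ?S)"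
        using M_nonneg \<epsilon>0(1) s s0
        by (intro mult_mono divide_left_mono power_mono vle mult_pos_pos) auto
      finally show ?thesis .
    qed
    have "norm (?w - ?h \<epsilon>) \<le> norm (?w - ?h \<epsilon>0) + (norm (?h \<epsilon>0) + norm (?h \<epsilon>))"
      using norm_triangle_ineq[of "?w - ?h \<epsilon>0" "?h \<epsilon>0 - ?h \<epsilon>"] norm_triangle_ineq4[of "?h \<epsilon>0" "?h \<epsilon>"] by simp
    also have "\<dots> \<le> C1 * ?S * \<epsilon>0 powr \<alpha> + 2 * (M ^ CARD('n) / \<epsilon>0 ^ CARD('n) * (measure lebesgue \<Omega> powr (1 / p) * ?S))"
      unfolding mult_2 using False
      by (intro add_mono small[OF \<epsilon>0(1) order_refl] hb) auto
    also have "\<dots> = (C1 + C2) * ?S * \<epsilon>0 powr \<alpha>"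
      using \<epsilon>0(1) by (simp add: C2_def field_simps)
    also have "\<dots> \<le> (C1 + C2) * ?S * \<epsilon> powr \<alpha>"
      using C0 S0 False \<epsilon>0(1) p(2) by (intro mult_left_mono powr_mono2) auto
    finally show ?thesis unfolding C .
  qed
qed

section \<open>Convergence of the regularized immersed boundary force\<close>

lemma polyhedral_domain_open_bounded:
  assumes "polyhedral_domain \<Omega>"
  shows "open \<Omega>" "bounded \<Omega>"
proof -
  obtain \<P> where P: "finite \<P>" "\<forall>P\<in>\<P>. polytope P" "\<Omega> = interior (\<Union>\<P>)"
    using assms unfolding polyhedral_domain_def by blast
  then have "bounded (\<Union>\<P>)" using polytope_imp_bounded by (intro bounded_Union) auto
  then show "open \<Omega>" "bounded \<Omega>"
    using P(3) by (auto intro: bounded_subset[OF _ interior_subset])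
qed

text \<open>A ball that meets both \<open>\<Omega>\<close> and its complement is connected and therefore meets the frontier.\<close>

lemma cball_subset_if_setdist_frontier:
  fixes S \<Omega> :: "'a::euclidean_space set"
  assumes "y \<in> S" "S \<subseteq> \<Omega>" "0 \<le> \<rho>" "\<rho> < setdist S (frontier \<Omega>)"
  shows "cball y \<rho> \<subseteq> \<Omega>"
proof (rule ccontr)
  assume "\<not> cball y \<rho> \<subseteq> \<Omega>"
  then have "cball y \<rho> - \<Omega> \<noteq> {}" by blast
  moreover have "y \<in> cball y \<rho>" "y \<in> \<Omega>" using assms by auto
  then have "cball y \<rho> \<inter> \<Omega> \<noteq> {}" by blast
  ultimately have "cball y \<rho> \<inter> frontier \<Omega> \<noteq> {}"
    using connected_Int_frontier[OF convex_connected[OF convex_cball]] by blast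
  then obtain z where "z \<in> cball y \<rho>" "z \<in> frontier \<Omega>" by blast
  then have "setdist S (frontier \<Omega>) \<le> \<rho>"
    using setdist_le_dist[OF assms(1), of z "frontier \<Omega>"] by simp
  then show False using assms(4) by simp
qed

text \<open>The continuous representative is chosen by Hilbert's operator; that it is nevertheless linear in the
function follows from its uniqueness on an open set.\<close>

lemma continuous_rep_sobolev0_linear:
  fixes v w :: "real^'n \<Rightarrow> 'b::euclidean_space"
  assumes v: "v \<in> sobolev0 (conj_exponent p) \<Omega>" and w: "w \<in> sobolev0 (conj_exponent p) \<Omega>"
    and Om: "open \<Omega>" "bounded \<Omega>" "1 \<le> p" "0 < 1 - real CARD('n) + real CARD('n) / p" and "x \<in> \<Omega>"
  shows "continuous_rep \<Omega> (\<lambda>x. v x + w x) x = continuous_rep \<Omega> v x + continuous_rep \<Omega> w x"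
    and "continuous_rep \<Omega> (\<lambda>x. c *\<^sub>R v x) x = c *\<^sub>R continuous_rep \<Omega> v x"
proof -
  note rv = continuous_rep_sobolev0[OF v Om] and rw = continuous_rep_sobolev0[OF w Om]
  have "AE x in lebesgue_on \<Omega>. continuous_rep \<Omega> v x + continuous_rep \<Omega> w x = v x + w x"
    using rv(2) rw(2) by eventually_elim simp
  then show "continuous_rep \<Omega> (\<lambda>x. v x + w x) x = continuous_rep \<Omega> v x + continuous_rep \<Omega> w x"
    by (rule continuous_rep_eq(3)[OF Om(1) continuous_on_add[OF rv(1) rw(1)] _ \<open>x \<in> \<Omega>\<close>])
  have "AE x in lebesgue_on \<Omega>. c *\<^sub>R continuous_rep \<Omega> v x = c *\<^sub>R v x"
    using rv(2) by eventually_elim simp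
  then show "continuous_rep \<Omega> (\<lambda>x. c *\<^sub>R v x) x = c *\<^sub>R continuous_rep \<Omega> v x"
    by (rule continuous_rep_eq(3)[OF Om(1) continuous_on_scaleR[OF continuous_on_const rv(1)] _ \<open>x \<in> \<Omega>\<close>])
qed

text \<open>The difference of the two functionals integrates \<open>F\<close> against the mollification error of \<open>v\<close> along the
immersed boundary. This bounds it by the Sobolev norm of \<open>v\<close> with the expected power of \<open>\<epsilon>\<close>, and
shows in particular that it belongs to the dual space.\<close>

lemma (in mollifier) force_minus_regularized_force:
  fixes \<Omega> :: "(real^'n) set" and \<Theta> :: "(real^'m) set" and X F :: "real^'m \<Rightarrow> real^'n" and p \<epsilon> :: real
  defines "\<alpha> \<equiv> 1 - real CARD('n) + real CARD('n) / p"
  defines "g \<equiv> \<lambda>v. force_functional \<Omega> \<Theta> X F v - fun_functional \<Omega> (regularized_force \<Theta> X F \<phi> \<epsilon>) v"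
  assumes Om: "open \<Omega>" "bounded \<Omega>" and p: "1 \<le> p" "0 < \<alpha>"
    and \<epsilon>0: "0 < \<epsilon>0" "\<And>\<theta>. \<theta> \<in> \<Theta> \<Longrightarrow> cball (X \<theta>) (\<epsilon>0 * (real CARD('n) * K)) \<subseteq> \<Omega>"
    and \<epsilon>: "0 < \<epsilon>" and \<Theta>: "\<Theta> \<in> lmeasurable" and X: "continuous_on \<Theta> X"
    and F: "integrable (lebesgue_on \<Theta>) F"
  shows "\<And>v. v \<in> sobolev0 (conj_exponent p) \<Omega> \<Longrightarrow>
      \<bar>g v\<bar> \<le> mollification_constant \<Omega> p K M \<epsilon>0 * L1_norm \<Theta> F * \<epsilon> powr \<alpha>
        * sobolev_norm 1 (conj_exponent p) \<Omega> v"
    and "g \<in> dual_sobolev p \<Omega>"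
proof -
  let ?V = "sobolev0 (conj_exponent p) \<Omega> :: (real^'n \<Rightarrow> real^'n) set"
  let ?rep = "continuous_rep \<Omega> :: (real^'n \<Rightarrow> real^'n) \<Rightarrow> _"
  let ?S = "\<lambda>v :: real^'n \<Rightarrow> real^'n. sobolev_norm 1 (conj_exponent p) \<Omega> v"
  let ?C = "mollification_constant \<Omega> p K M \<epsilon>0"
  define h where "h v \<theta> = (\<integral>x. regularized_delta \<phi> \<epsilon> (x - X \<theta>) *\<^sub>R v x \<partial>lebesgue_on \<Omega>)"
    for v :: "real^'n \<Rightarrow> real^'n" and \<theta>
  note p' = p(2)[unfolded \<alpha>_def]
  have OmM: "\<Omega> \<in> lmeasurable" and OmL: "\<Omega> \<in> sets lebesgue" and \<Theta>L: "\<Theta> \<in> sets lebesgue"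
    using Om \<Theta> by (auto intro: lmeasurable_open)
  interpret O: finite_measure "lebesgue_on \<Omega>" by (rule finite_measure_lebesgue_on[OF OmM])
  interpret T: finite_measure "lebesgue_on \<Theta>" by (rule finite_measure_lebesgue_on[OF \<Theta>])
  have XOm: "X \<theta> \<in> \<Omega>" if "\<theta> \<in> \<Theta>" for \<theta>
    using \<epsilon>0(1) \<epsilon>0(2)[OF that] K_pos centre_in_cball[of "X \<theta>" "\<epsilon>0 * (real CARD('n) * K)"] by auto
  have Xm: "X \<in> borel_measurable (lebesgue_on \<Theta>)"
    by (rule continuous_imp_measurable_on_sets_lebesgue[OF X \<Theta>L])
  have Fm: "F \<in> borel_measurable (lebesgue_on \<Theta>)" using F by auto
  have idm: "(\<lambda>x. x) \<in> borel_measurable (lebesgue_on \<Omega>)"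
    by (rule continuous_imp_measurable_on_sets_lebesgue[OF continuous_on_id OmL])
  have \<delta>m: "(regularized_delta \<phi> \<epsilon> :: real^'n \<Rightarrow> real) \<in> borel_measurable borel"
    by (rule borel_measurable_continuous_onI[OF regularized_delta_continuous[OF \<epsilon>]])
  have \<kappa>: "case_prod (\<lambda>x \<theta>. regularized_delta \<phi> \<epsilon> (x - X \<theta>))
      \<in> borel_measurable (lebesgue_on \<Omega> \<Otimes>\<^sub>M lebesgue_on \<Theta>)"
  proof -
    have "(\<lambda>z. fst z - X (snd z)) \<in> borel_measurable (lebesgue_on \<Omega> \<Otimes>\<^sub>M lebesgue_on \<Theta>)"
      by (intro borel_measurable_diff measurable_compose[OF measurable_fst idm] measurable_compose[OF measurable_snd Xm])
    from measurable_compose[OF this \<delta>m] show ?thesis by (simp add: case_prod_beta)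
  qed
  have v: "integrable (lebesgue_on \<Omega>) v" if "v \<in> ?V" for v by (rule sobolev0_integrable[OF that Om(1)])
  have pair: "integrable (lebesgue_on \<Omega>) (\<lambda>x. regularized_force \<Theta> X F \<phi> \<epsilon> x \<bullet> v x)"
    "integrable (lebesgue_on \<Theta>) (\<lambda>\<theta>. F \<theta> \<bullet> h v \<theta>)"
    "fun_functional \<Omega> (regularized_force \<Theta> X F \<phi> \<epsilon>) v = (\<integral>\<theta>. F \<theta> \<bullet> h v \<theta> \<partial>lebesgue_on \<Theta>)"
    if "v \<in> ?V" for v
    using integral_kernel_pairing[OF O.sigma_finite_measure_axioms T.sigma_finite_measure_axioms v[OF that] F \<kappa>
        regularized_delta_bound[OF \<epsilon>]]
    by (simp_all add: regularized_force_def fun_functional_def h_def)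
  have err: "norm (?rep v (X \<theta>) - h v \<theta>) \<le> ?C * ?S v * \<epsilon> powr \<alpha>" if "v \<in> ?V" "\<theta> \<in> \<Theta>" for v \<theta>
    unfolding h_def \<alpha>_def
    by (rule continuous_rep_minus_mollification[OF that(1) Om p(1) p' \<epsilon>0(1) \<epsilon>0(2)[OF that(2)] \<epsilon>])
  have force: "integrable (lebesgue_on \<Theta>) (\<lambda>\<theta>. F \<theta> \<bullet> ?rep v (X \<theta>))" if vV: "v \<in> ?V" for v
  proof -
    define D where "D = ?C * ?S v * \<epsilon> powr \<alpha>
      + M ^ CARD('n) / \<epsilon> ^ CARD('n) * L1_norm \<Omega> v"
    have D: "norm (?rep v (X \<theta>)) \<le> D" if "\<theta> \<in> \<Theta>" for \<theta>
      using err[OF vV that] regularized_delta_integral_bound[OF v[OF vV] \<epsilon> OmL, of "X \<theta>"]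
        norm_triangle_sub[of "?rep v (X \<theta>)" "h v \<theta>"]
      unfolding D_def h_def by linarith
    have "continuous_on \<Theta> (\<lambda>\<theta>. ?rep v (X \<theta>))"
      using XOm by (intro continuous_on_compose2[OF continuous_rep_sobolev0(1)[OF vV Om p(1) p'] X]) auto
    then have rm: "(\<lambda>\<theta>. ?rep v (X \<theta>)) \<in> borel_measurable (lebesgue_on \<Theta>)"
      by (rule continuous_imp_measurable_on_sets_lebesgue[OF _ \<Theta>L])
    show ?thesis
    proof (rule Bochner_Integration.integrable_bound)
      show "integrable (lebesgue_on \<Theta>) (\<lambda>\<theta>. D * norm (F \<theta>))" using F by simp
      show "(\<lambda>\<theta>. F \<theta> \<bullet> ?rep v (X \<theta>)) \<in> borel_measurable (lebesgue_on \<Theta>)"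
        using Fm rm by (rule borel_measurable_inner)
      show "AE \<theta> in lebesgue_on \<Theta>. norm (F \<theta> \<bullet> ?rep v (X \<theta>)) \<le> norm (D * norm (F \<theta>))"
      proof (rule AE_I2)
        fix \<theta> assume "\<theta> \<in> space (lebesgue_on \<Theta>)"
        then have "norm (?rep v (X \<theta>)) \<le> D" using D by simp
        then have "norm (F \<theta>) * norm (?rep v (X \<theta>)) \<le> norm (F \<theta>) * D" by (rule mult_left_mono) simp
        then show "norm (F \<theta> \<bullet> ?rep v (X \<theta>)) \<le> norm (D * norm (F \<theta>))"
          using Cauchy_Schwarz_ineq2[of "F \<theta>" "?rep v (X \<theta>)"] by (simp add: mult.commute)
      qed
    qed
  qed
  show bound: "\<bar>g v\<bar> \<le> ?C * L1_norm \<Theta> F * \<epsilon> powr \<alpha> * ?S v" if vV: "v \<in> ?V" for v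
  proof -
    have "g v = (\<integral>\<theta>. F \<theta> \<bullet> (?rep v (X \<theta>) - h v \<theta>) \<partial>lebesgue_on \<Theta>)"
      unfolding g_def force_functional_def pair(3)[OF vV] inner_diff_right
      by (rule Bochner_Integration.integral_diff[symmetric, OF force[OF vV] pair(2)[OF vV]])
    also have "\<bar>\<dots>\<bar> \<le> (\<integral>\<theta>. (?C * ?S v * \<epsilon> powr \<alpha>) * norm (F \<theta>) \<partial>lebesgue_on \<Theta>)"
      unfolding real_norm_def[symmetric]
    proof (rule Bochner_Integration.integral_norm_bound_integral)
      show "integrable (lebesgue_on \<Theta>) (\<lambda>\<theta>. F \<theta> \<bullet> (?rep v (X \<theta>) - h v \<theta>))"
        unfolding inner_diff_right by (rule Bochner_Integration.integrable_diff[OF force[OF vV] pair(2)[OF vV]])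
      show "integrable (lebesgue_on \<Theta>) (\<lambda>\<theta>. (?C * ?S v * \<epsilon> powr \<alpha>) * norm (F \<theta>))" using F by simp
      fix \<theta> assume "\<theta> \<in> space (lebesgue_on \<Theta>)"
      then have "norm (?rep v (X \<theta>) - h v \<theta>) \<le> ?C * ?S v * \<epsilon> powr \<alpha>" using err[OF vV] by simp
      then have "norm (F \<theta>) * norm (?rep v (X \<theta>) - h v \<theta>) \<le> norm (F \<theta>) * (?C * ?S v * \<epsilon> powr \<alpha>)"
        by (rule mult_left_mono) simp
      then show "norm (F \<theta> \<bullet> (?rep v (X \<theta>) - h v \<theta>)) \<le> (?C * ?S v * \<epsilon> powr \<alpha>) * norm (F \<theta>)"
        using Cauchy_Schwarz_ineq2[of "F \<theta>" "?rep v (X \<theta>) - h v \<theta>"] by (simp add: mult.commute)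
    qed
    also have "\<dots> = (?C * ?S v * \<epsilon> powr \<alpha>) * L1_norm \<Theta> F" by simp
    finally show ?thesis by (simp add: ac_simps)
  qed
  have add: "g (\<lambda>x. v x + w x) = g v + g w" if vw: "v \<in> ?V" "w \<in> ?V" for v w
  proof -
    have "force_functional \<Omega> \<Theta> X F (\<lambda>x. v x + w x)
        = (\<integral>\<theta>. F \<theta> \<bullet> ?rep v (X \<theta>) + F \<theta> \<bullet> ?rep w (X \<theta>) \<partial>lebesgue_on \<Theta>)"
      unfolding force_functional_def
      using continuous_rep_sobolev0_linear(1)[OF vw Om p(1) p'] XOm
      by (intro Bochner_Integration.integral_cong) (auto simp: inner_add_right)
    then have "force_functional \<Omega> \<Theta> X F (\<lambda>x. v x + w x) = force_functional \<Omega> \<Theta> X F v + force_functional \<Omega> \<Theta> X F w"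
      using force vw by (simp add: force_functional_def)
    moreover have "fun_functional \<Omega> (regularized_force \<Theta> X F \<phi> \<epsilon>) (\<lambda>x. v x + w x)
        = fun_functional \<Omega> (regularized_force \<Theta> X F \<phi> \<epsilon>) v + fun_functional \<Omega> (regularized_force \<Theta> X F \<phi> \<epsilon>) w"
      unfolding fun_functional_def inner_add_right
      by (rule Bochner_Integration.integral_add[OF pair(1)[OF vw(1)] pair(1)[OF vw(2)]])
    ultimately show ?thesis by (simp add: g_def)
  qed
  have scale: "g (\<lambda>x. c *\<^sub>R v x) = c * g v" if vV: "v \<in> ?V" for v c
  proof -
    have "force_functional \<Omega> \<Theta> X F (\<lambda>x. c *\<^sub>R v x) = (\<integral>\<theta>. c * (F \<theta> \<bullet> ?rep v (X \<theta>)) \<partial>lebesgue_on \<Theta>)"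
      unfolding force_functional_def
      using continuous_rep_sobolev0_linear(2)[OF vV vV Om p(1) p'] XOm
      by (intro Bochner_Integration.integral_cong) auto
    then show ?thesis by (simp add: g_def force_functional_def fun_functional_def right_diff_distrib)
  qed
  show "g \<in> dual_sobolev p \<Omega>"
    unfolding dual_sobolev_def mem_Collect_eq using add scale bound by blast
qed

theorem proposition9:
  fixes \<Omega> \<Omega>0 \<Omega>1 :: "(real^'n) set"
    and \<Theta> :: "(real^'m) set"
    and X :: "real^'m \<Rightarrow> real^'n"
    and \<nu> p K M :: real
  assumes "CARD('n) \<in> {2, 3}" and "CARD('m) = CARD('n) - 1"
    and "polyhedral_domain \<Omega>"
    and "immersed_boundary \<Omega> \<Omega>0 \<Omega>1 \<Theta> X"
    and "\<nu> > 0"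
    and "1 \<le> p" and "p < real CARD('n) / (real CARD('n) - 1)"
    and "stokes_regularity \<nu> p \<Omega>"
    and "K > 0"
  shows "\<exists>C>0. \<forall>\<phi> :: real \<Rightarrow> real. \<forall>F \<epsilon> u \<pi> u\<epsilon> \<pi>\<epsilon>.
    continuous_on UNIV \<phi> \<longrightarrow> closure {s. \<phi> s \<noteq> 0} \<subseteq> {-K<..<K} \<longrightarrow>
    (\<integral>s. \<phi> s \<partial>lborel) = 1 \<longrightarrow> Lp_norm \<infinity> lborel \<phi> = M \<longrightarrow>
    F \<in> Lp_space (ereal p) (lebesgue_on \<Theta>) \<longrightarrow> \<epsilon> > 0 \<longrightarrow>
    stokes_weak_solution \<nu> p \<Omega> (force_functional \<Omega> \<Theta> X F) u \<pi> \<longrightarrow>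
    stokes_weak_solution \<nu> p \<Omega> (fun_functional \<Omega> (regularized_force \<Theta> X F \<phi> \<epsilon>)) u\<epsilon> \<pi>\<epsilon> \<longrightarrow>
    sobolev_norm 1 (ereal p) \<Omega> (\<lambda>x. u x - u\<epsilon> x)
      + Lp_norm (ereal p) (lebesgue_on \<Omega>) (\<lambda>x. \<pi> x - \<pi>\<epsilon> x)
      \<le> C * Lp_norm (ereal p) (lebesgue_on \<Theta>) F
          * \<epsilon> powr (1 - real CARD('n) + real CARD('n) / p)"
proof -
  let ?n = "real CARD('n)"
  define \<alpha> where "\<alpha> = 1 - ?n + ?n / p"
  note Om = polyhedral_domain_open_bounded[OF assms(3)]
  have \<alpha>: "0 < \<alpha>"
  proof -
    have "1 < ?n" using assms(1) by auto
    then have "p * (?n - 1) < ?n" using assms(7) by (simp add: pos_less_divide_eq)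
    then have "?n - 1 < ?n / p" using assms(6) by (simp add: pos_less_divide_eq mult.commute)
    then show ?thesis by (simp add: \<alpha>_def)
  qed
  have \<Theta>: "bounded \<Theta>" "\<Theta> \<in> sets lebesgue"
    and chart: "\<exists>U. open U \<and> \<Theta> \<subseteq> U \<and> C1_on U X"
    and XOm: "X ` \<Theta> \<subseteq> \<Omega>" and dist: "setdist (X ` \<Theta>) (frontier \<Omega>) > 0"
    using assms(4) unfolding immersed_boundary_def by - (elim conjE, assumption)+
  obtain U where U: "open U" "\<Theta> \<subseteq> U" "C1_on U X" using chart by blast
  have \<Theta>M: "\<Theta> \<in> lmeasurable" using bounded_set_imp_lmeasurable \<Theta> by blast
  have Xc: "continuous_on \<Theta> X"
  proof (rule continuous_at_imp_continuous_on, rule ballI)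
    fix \<theta> assume "\<theta> \<in> \<Theta>"
    then have "\<theta> \<in> U" using U(2) by blast
    then obtain D where "(X has_derivative D) (at \<theta>)" using U(3) unfolding C1_on_def by blast
    then show "isCont X \<theta>" by (rule has_derivative_continuous)
  qed
  \<comment> \<open>The mollifier of scale \<open>\<epsilon>0\<close> about a point of the immersed boundary is supported in the ball
    of radius \<open>\<epsilon>0 n K = \<rho>\<close>, which stays away from the boundary of \<open>\<Omega>\<close>.\<close>
  define \<rho> where "\<rho> = setdist (X ` \<Theta>) (frontier \<Omega>) / 2"
  define \<epsilon>0 where "\<epsilon>0 = \<rho> / (?n * K)"
  have \<epsilon>0: "0 < \<epsilon>0" "\<epsilon>0 * (?n * K) = \<rho>" using dist assms(9) by (auto simp: \<epsilon>0_def \<rho>_def)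
  have ball: "cball (X \<theta>) (\<epsilon>0 * (?n * K)) \<subseteq> \<Omega>" if "\<theta> \<in> \<Theta>" for \<theta>
    unfolding \<epsilon>0(2) by (rule cball_subset_if_setdist_frontier[of _ "X ` \<Theta>"])
      (use that XOm dist in \<open>auto simp: \<rho>_def\<close>)
  obtain C1 where C1: "C1 > 0" and stab: "\<And>g w r. g \<in> dual_sobolev p \<Omega> \<Longrightarrow> stokes_weak_solution \<nu> p \<Omega> g w r \<Longrightarrow>
      sobolev_norm 1 (ereal p) \<Omega> w + Lp_norm (ereal p) (lebesgue_on \<Omega>) r \<le> C1 * dual_sobolev_norm p \<Omega> g"
    using assms(8) unfolding stokes_regularity_def by blast
  \<comment> \<open>The constant is chosen before the mollifier, so \<open>M\<close> can be any real number here; the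
    absolute value and the summand \<open>1\<close> below make the constant positive.\<close>
  define C2 where "C2 = \<bar>mollification_constant \<Omega> p K M \<epsilon>0\<bar>"
  define C where "C = C1 * C2 * measure lebesgue \<Theta> powr (1 - 1 / p) + 1"
  have C0: "0 < C" using C1 by (simp add: C_def C2_def add_nonneg_pos)
  show ?thesis
  proof (intro exI[of _ C] conjI C0 allI impI)
    fix \<phi> :: "real \<Rightarrow> real" and F \<epsilon> u \<pi> u\<epsilon> \<pi>\<epsilon>
    assume \<phi>: "continuous_on UNIV \<phi>" "closure {s. \<phi> s \<noteq> 0} \<subseteq> {-K<..<K}" "(\<integral>s. \<phi> s \<partial>lborel) = 1"
        "Lp_norm \<infinity> lborel \<phi> = M"
      and F: "F \<in> Lp_space (ereal p) (lebesgue_on \<Theta>)" and \<epsilon>: "\<epsilon> > 0"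
      and sol: "stokes_weak_solution \<nu> p \<Omega> (force_functional \<Omega> \<Theta> X F) u \<pi>"
        "stokes_weak_solution \<nu> p \<Omega> (fun_functional \<Omega> (regularized_force \<Theta> X F \<phi> \<epsilon>)) u\<epsilon> \<pi>\<epsilon>"
    interpret mollifier \<phi> K M by standard (use \<phi> assms(9) in auto)
    let ?g = "\<lambda>v. force_functional \<Omega> \<Theta> X F v - fun_functional \<Omega> (regularized_force \<Theta> X F \<phi> \<epsilon>) v"
    let ?F = "Lp_norm (ereal p) (lebesgue_on \<Theta>) F"
    have \<Theta>sp: "measure (lebesgue_on \<Theta>) (space (lebesgue_on \<Theta>)) = measure lebesgue \<Theta>"
      using \<Theta>(2) by (simp add: measure_restrict_space)
    note F1 = integral_norm_le_Lp_norm[OF finite_measure_lebesgue_on[OF \<Theta>M] F assms(6), unfolded \<Theta>sp]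
    note g = force_minus_regularized_force[OF Om assms(6) \<alpha>[unfolded \<alpha>_def] \<epsilon>0(1) ball \<epsilon> \<Theta>M Xc F1(1)]
    define B where "B = C2 * (measure lebesgue \<Theta> powr (1 - 1 / p) * ?F) * \<epsilon> powr \<alpha>"
    have B0: "0 \<le> B" by (simp add: B_def C2_def Lp_norm_ereal_nonneg)
    have "dual_sobolev_norm p \<Omega> ?g \<le> B"
      unfolding dual_sobolev_norm_def
    proof (rule cSUP_least)
      show "{v \<in> sobolev0 (conj_exponent p) \<Omega>. sobolev_norm 1 (conj_exponent p) \<Omega> v \<le> 1} \<noteq> ({} :: (real^'n \<Rightarrow> real^'n) set)"
        using zero_in_sobolev0[OF Om(1), of "conj_exponent p", where 'b = "real^'n"]
        by (metis (mono_tags, lifting) empty_iff mem_Collect_eq zero_le_one)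
      fix v :: "real^'n \<Rightarrow> real^'n"
      assume "v \<in> {v \<in> sobolev0 (conj_exponent p) \<Omega>. sobolev_norm 1 (conj_exponent p) \<Omega> v \<le> 1}"
      then have v: "v \<in> sobolev0 (conj_exponent p) \<Omega>" "sobolev_norm 1 (conj_exponent p) \<Omega> v \<le> 1" by auto
      have vL: "v \<in> Lp_space (conj_exponent p) (lebesgue_on \<Omega>)"
        using v(1) unfolding sobolev0_def sobolev_1_iff[OF Om(1)] by blast
      have "\<bar>?g v\<bar> \<le> mollification_constant \<Omega> p K M \<epsilon>0 * L1_norm \<Theta> F * \<epsilon> powr \<alpha>
          * sobolev_norm 1 (conj_exponent p) \<Omega> v"
        unfolding \<alpha>_def by (rule g(1)[OF _ v(1)])
      also have "\<dots> \<le> B * sobolev_norm 1 (conj_exponent p) \<Omega> v"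
        unfolding B_def C2_def using F1(2) sobolev_norm_nonneg[OF assms(6) vL]
        by (intro mult_right_mono mult_mono) auto
      also have "\<dots> \<le> B" using v(2) B0 by (simp add: mult_left_le)
      finally show "\<bar>?g v\<bar> \<le> B" .
    qed
    moreover have "sobolev_norm 1 (ereal p) \<Omega> (\<lambda>x. u x - u\<epsilon> x) + Lp_norm (ereal p) (lebesgue_on \<Omega>) (\<lambda>x. \<pi> x - \<pi>\<epsilon> x)
        \<le> C1 * dual_sobolev_norm p \<Omega> ?g"
      by (rule stab[OF g(2) stokes_weak_solution_diff[OF sol Om assms(6)]])
    ultimately have "sobolev_norm 1 (ereal p) \<Omega> (\<lambda>x. u x - u\<epsilon> x) + Lp_norm (ereal p) (lebesgue_on \<Omega>) (\<lambda>x. \<pi> x - \<pi>\<epsilon> x)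
        \<le> C1 * B"
      using C1 by (meson mult_left_mono less_imp_le order_trans)
    also have "\<dots> = C1 * C2 * measure lebesgue \<Theta> powr (1 - 1 / p) * (?F * \<epsilon> powr \<alpha>)"
      by (simp add: B_def ac_simps)
    also have "\<dots> \<le> C * (?F * \<epsilon> powr \<alpha>)"
      by (intro mult_right_mono) (auto simp: C_def Lp_norm_ereal_nonneg)
    finally show "sobolev_norm 1 (ereal p) \<Omega> (\<lambda>x. u x - u\<epsilon> x)
        + Lp_norm (ereal p) (lebesgue_on \<Omega>) (\<lambda>x. \<pi> x - \<pi>\<epsilon> x)
        \<le> C * Lp_norm (ereal p) (lebesgue_on \<Theta>) F * \<epsilon> powr (1 - ?n + ?n / p)"
      by (simp add: \<alpha>_def mult.assoc)
  qed
qed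

end
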